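(* Let the function $\Psi$ be analytic at infinity. Then there is a constant $C$, depending only on $\Psi$, such that for all $p\in[1,\infty]$ and all $n\in\mathbb{N}$ the operator $\Psi(L)$ is bounded on $L^p(\mathbb{R}^n)$ with norm at most $C$ (in particular, $C$ depends neither on $n$ nor on $p$).
   Context: $L=-\Delta+|x|^2$ is the Hermite operator on $\mathbb{R}^n$. Its eigenfunctions are the Hermite functions $h_\alpha$, $\alpha\in\mathbb{N}_0^n$: $h_\alpha=h_{\alpha_1}\otimes\cdots\otimes h_{\alpha_n}$, where on $\mathbb{R}$, $h_m(x)=(2^mm!\sqrt{\pi})^{-1/2}(-1)^me^{x^2/2}\frac{d^m}{dx^m}e^{-x^2}$; they satisfy $Lh_\alpha=(2|\alpha|+n)h_\alpha$ with $|\alpha|=\alpha_1+\dots+\alpha_n$. For a bounded function $\Psi:\mathbb{N}\to\mathbb{C}$ ($\mathbb{N}$ being the positive integers) the spectral multiplier is $$\Psi(L)=\sum_{m=0}^\infty\Psi(2m+n)\,\mathcal{P}_m,$$ where $\mathcal{P}_m$ is the orthogonal projection of $L^2(\mathbb{R}^n)$ onto the span of all $h_\alpha$ with $|\alpha|=m$. "$\Psi$ is analytic at infinity" means that $\Psi$ is a bounded complex function on $\mathbb{N}$ for which there is a function $\Phi$ holomorphic in a neighbourhood of $0\in\mathbb{C}$ with $\Psi(k)=\Phi(1/k)$ for all sufficiently large $k$. Boundedness on $L^p$ with norm at most $C$ means $\|\Psi(L)f\|_p\leq C\|f\|_p$ for all $f\in L^2(\mathbb{R}^n)\cap L^p(\mathbb{R}^n)$.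 *)

theory Defs
  imports "HOL-Analysis.Analysis" "HOL-Probability.Essential_Supremum"
begin

text \<open>
  The dimension is quantified inside the main statement, so \<open>\<real>\<^sup>n\<close> is the space of the
  \<open>n\<close>-fold product of Lebesgue measure on the line: points are functions on \<open>nat\<close>
  whose coordinates are indexed by \<open>{..<n}\<close>.  Only values at points of the space of
  this measure matter below.  The measure lives on the Borel sets; as every Lebesgue
  measurable function agrees almost everywhere with a Borel function, it yields the usual
  Lebesgue spaces.
\<close>

definition lebesgue_n :: "nat \<Rightarrow> (nat \<Rightarrow> real) measure" where
  "lebesgue_n n = (\<Pi>\<^sub>M i\<in>{..<n}. (lborel :: real measure))"

definition Lp_norm :: "ennreal \<Rightarrow> 'a measure \<Rightarrow> ('a \<Rightarrow> complex) \<Rightarrow> ennreal" where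
  "Lp_norm p M f =
    (if p = \<infinity> then esssup M (\<lambda>x. ennreal (norm (f x)))
     else (let I = \<integral>\<^sup>+ x. ennreal (norm (f x) powr enn2real p) \<partial>M
           in if I = \<infinity> then \<infinity> else ennreal (enn2real I powr (1 / enn2real p))))"

definition Lp_space :: "ennreal \<Rightarrow> 'a measure \<Rightarrow> ('a \<Rightarrow> complex) set" where
  "Lp_space p M = {f. f \<in> borel_measurable M \<and> Lp_norm p M f < \<infinity>}"

definition hermite_function :: "nat \<Rightarrow> real \<Rightarrow> real" where
  "hermite_function m x =
    (2 ^ m * fact m * sqrt pi) powr (- 1 / 2) * (- 1) ^ m * exp (x\<^sup>2 / 2) *
    (deriv ^^ m) (\<lambda>t. exp (- (t\<^sup>2))) x"

definition hermite_function_n :: "nat \<Rightarrow> (nat \<Rightarrow> nat) \<Rightarrow> (nat \<Rightarrow> real) \<Rightarrow> real" where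
  "hermite_function_n n \<alpha> x = (\<Prod>i<n. hermite_function (\<alpha> i) (x i))"

text \<open>Multi-indices in \<open>n\<close> variables are normalised to be \<open>undefined\<close> outside \<open>{..<n}\<close>,
  so that each occurs exactly once.\<close>

definition multi_indices :: "nat \<Rightarrow> nat \<Rightarrow> (nat \<Rightarrow> nat) set" where
  "multi_indices n m = {\<alpha> \<in> {..<n} \<rightarrow>\<^sub>E UNIV. (\<Sum>i<n. \<alpha> i) = m}"

lemma finite_multi_indices: "finite (multi_indices n m)"
proof (rule finite_subset)
  show "multi_indices n m \<subseteq> {..<n} \<rightarrow>\<^sub>E {..m}"
    unfolding multi_indices_def by (fastforce intro!: PiE_I member_le_sum dest: PiE_arb)
qed (auto intro: finite_PiE)

definition hermite_eigenspace :: "nat \<Rightarrow> nat \<Rightarrow> ((nat \<Rightarrow> real) \<Rightarrow> complex) set" where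
  "hermite_eigenspace n m =
    {(\<lambda>x. \<Sum>\<alpha>\<in>multi_indices n m. c \<alpha> * of_real (hermite_function_n n \<alpha> x)) |
     c. True}"

text \<open>The projection is characterised by \<open>f - \<P>\<^sub>m f\<close> being orthogonal to the eigenspace; as the
  Hermite functions are linearly independent, this determines \<open>\<P>\<^sub>m f\<close> pointwise and not only
  almost everywhere.\<close>

definition hermite_projection ::
  "nat \<Rightarrow> nat \<Rightarrow> ((nat \<Rightarrow> real) \<Rightarrow> complex) \<Rightarrow> (nat \<Rightarrow> real) \<Rightarrow> complex" where
  "hermite_projection n m f =
    (THE g. g \<in> hermite_eigenspace n m \<and>
       (\<forall>h\<in>hermite_eigenspace n m. (\<integral>x. (f x - g x) * cnj (h x) \<partial>lebesgue_n n) = 0))"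

text \<open>\<open>g\<close> is a representative of \<open>\<Psi>(L) f\<close>, the series converging in \<open>L\<^sup>2\<close>.\<close>

definition is_hermite_multiplier ::
  "nat \<Rightarrow> (nat \<Rightarrow> complex) \<Rightarrow> ((nat \<Rightarrow> real) \<Rightarrow> complex) \<Rightarrow> ((nat \<Rightarrow> real) \<Rightarrow> complex) \<Rightarrow> bool"
where
  "is_hermite_multiplier n \<Psi> f g \<longleftrightarrow>
    g \<in> Lp_space 2 (lebesgue_n n) \<and>
    (\<lambda>N. Lp_norm 2 (lebesgue_n n)
           (\<lambda>x. g x - (\<Sum>m<N. \<Psi> (2 * m + n) * hermite_projection n m f x)))
      \<longlonglongrightarrow> 0"

text \<open>The value \<open>\<Psi> 0\<close> is irrelevant: \<open>\<Psi>\<close> is a function on the positive integers.\<close>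

definition analytic_at_infinity :: "(nat \<Rightarrow> complex) \<Rightarrow> bool" where
  "analytic_at_infinity \<Psi> \<longleftrightarrow>
    bounded (\<Psi> ` {1..}) \<and>
    (\<exists>\<Phi>. \<Phi> analytic_on {0} \<and> (\<forall>\<^sub>F k in sequentially. \<Psi> k = \<Phi> (1 / of_nat k)))"

end

theory Submission
  imports Defs "HOL-Probability.Probability" "HOL-Complex_Analysis.Complex_Analysis"
begin

text \<open>
  Near infinity \<open>\<Psi> k = a\<^sub>0 + (\<Sum>j. a\<^sub>j\<^sub>+\<^sub>1 / k ^ (j + 1))\<close> with \<open>\<bar>a\<^sub>j\<bar> \<le> A R\<^sup>j\<close>, so \<open>\<Psi>(L) - a\<^sub>0\<close> should be a series
  of negative powers of \<open>L\<close>, and \<open>L\<close> to the power \<open>-(j + 1)\<close> is the integral of \<open>t\<^sup>j / j! exp (- t L)\<close> over all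
  times \<open>t > 0\<close>.  The heat operator \<open>exp (- t L)\<close> has an explicit nonnegative kernel, a product of one-dimensional
  Mehler kernels, whose integral in either variable is at most \<open>cosh (2 t)\<close> to the power \<open>- n / 2\<close>.  By Schur's
  test a kernel whose row and column integrals are bounded by \<open>C\<close> acts on every \<open>L\<^sup>p\<close> with norm at most \<open>C\<close>
  (\<open>Lp_norm_kernel_operator_le\<close>), which makes \<open>p\<close> irrelevant and leaves only the dimension to be controlled.

  If \<open>n \<ge> N\<close> then \<open>cosh (2 t)\<close> to the power \<open>- n / 2\<close> is at most \<open>sqrt 2 ^ N exp (- N t)\<close>, so the power \<open>-(j + 1)\<close>
  of \<open>L\<close> has norm at most \<open>sqrt 2 ^ N / N ^ (j + 1)\<close>.  For \<open>N > R\<close> the series converges absolutely with a bound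
  that is the same for all \<open>n \<ge> N\<close> (\<open>uniform_bound_large_dimension\<close>).  For each of the finitely many
  remaining dimensions any constant will do (\<open>bound_fixed_dimension\<close>): a partial sum of the series is bounded as
  before, and what remains has values \<open>O(m ^ (- 3 n - 2))\<close> on the \<open>m\<close>-th eigenspace, while the projection onto that
  eigenspace has a kernel with Schur bound \<open>O(m ^ (3 n))\<close>, because sup norms and \<open>L\<^sup>1\<close> norms of Hermite functions
  grow polynomially.  This remainder also absorbs the finitely many \<open>k\<close> at which the expansion of \<open>\<Psi>\<close> fails.

  The kernel operators so obtained have the right eigenvalues on the Hermite functions.  That they agree with the
  series defining \<open>\<Psi>(L)\<close> is the completeness of the Hermite functions in \<open>L\<^sup>2\<close>
  (\<open>hermite_expansion_converges\<close>).  For it, consider the closed span \<open>D\<close> of the Hermite functions and the bounded functions \<open>u\<close>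
  with \<open>u D \<subseteq> D\<close>.  They form an algebra that is closed under bounded pointwise limits.  It contains the
  Gaussians in one coordinate, by their power series, hence the indicators of sets where such a Gaussian is below a
  threshold, hence those of all Borel sets; multiplying the ground state by simple functions gives a dense set.
\<close>

section \<open>Hermite functions on the line\<close>

fun hermite_poly :: "nat \<Rightarrow> real \<Rightarrow> real" where
  "hermite_poly 0 x = 1"
| "hermite_poly (Suc 0) x = 2 * x"
| "hermite_poly (Suc (Suc k)) x = 2 * x * hermite_poly (Suc k) x - 2 * (real k + 1) * hermite_poly k x"

lemma hermite_poly_Suc:
  "hermite_poly (Suc k) x = 2 * x * hermite_poly k x - 2 * real k * hermite_poly (k - 1) x"
  by (cases k) auto

lemma has_field_derivative_hermite_poly:
  "(hermite_poly k has_field_derivative 2 * real k * hermite_poly (k - 1) x) (at x)"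
proof (induction k x rule: hermite_poly.induct)
  case (1 x)
  then show ?case by simp
next
  case (2 x)
  have "((\<lambda>x. 2 * x) has_field_derivative 2) (at x)" 
    by (auto intro!: derivative_eq_intros)
  moreover have "hermite_poly (Suc 0) = (\<lambda>x. 2 * x)" by auto
  ultimately show ?case by simp
next
  case (3 k x)
  have "((\<lambda>x. 2 * x * hermite_poly (Suc k) x - 2 * (real k + 1) * hermite_poly k x) has_field_derivative
      2 * hermite_poly (Suc k) x + 2 * x * (2 * real (Suc k) * hermite_poly k x)
        - 2 * (real k + 1) * (2 * real k * hermite_poly (k - 1) x)) (at x)"
    using 3 by (auto intro!: derivative_eq_intros simp: algebra_simps)
  also have "2 * hermite_poly (Suc k) x + 2 * x * (2 * real (Suc k) * hermite_poly k x)
        - 2 * (real k + 1) * (2 * real k * hermite_poly (k - 1) x)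
      = 2 * hermite_poly (Suc k) x + 2 * (real k + 1) * hermite_poly (Suc k) x"
    unfolding hermite_poly_Suc[of k] by (simp add: algebra_simps)
  also have "\<dots> = 2 * real (Suc (Suc k)) * hermite_poly (Suc (Suc k) - 1) x"
    by (simp add: algebra_simps)
  finally show ?case by simp
qed

text \<open>Rodrigues' formula: it replaces the iterated derivatives in the definition of the Hermite functions by a recurrence.\<close>

lemma higher_deriv_gaussian:
  "(deriv ^^ k) (\<lambda>t. exp (- (t\<^sup>2))) = (\<lambda>x::real. (- 1) ^ k * hermite_poly k x * exp (- x\<^sup>2))"
proof (induction k)
  case (Suc k)
  have "((\<lambda>x. (- 1) ^ k * hermite_poly k x * exp (- x\<^sup>2)) has_field_derivative
      (- 1) ^ Suc k * hermite_poly (Suc k) x * exp (- x\<^sup>2)) (at x)" for x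
    unfolding hermite_poly_Suc
    by (auto intro!: derivative_eq_intros has_field_derivative_hermite_poly simp: algebra_simps)
  then have "deriv (\<lambda>x. (- 1) ^ k * hermite_poly k x * exp (- x\<^sup>2))
      = (\<lambda>x. (- 1) ^ Suc k * hermite_poly (Suc k) x * exp (- x\<^sup>2))"
    by (intro ext DERIV_imp_deriv)
  with Suc show ?case by simp
qed simp

definition hermite_const :: "nat \<Rightarrow> real" where
  "hermite_const k = (2 ^ k * fact k * sqrt pi) powr (- 1 / 2)"

lemma hermite_function_eq:
  "hermite_function k x = hermite_const k * hermite_poly k x * exp (- (x\<^sup>2 / 2))"
proof -
  have "exp (x\<^sup>2 / 2) * exp (- x\<^sup>2) = exp (- (x\<^sup>2 / 2))"
    by (simp flip: exp_add)
  moreover have "(- 1 :: real) ^ k * (- 1) ^ k = 1"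
    by (simp flip: power_mult_distrib)
  moreover have "hermite_function k x = hermite_const k * ((- 1) ^ k * (- 1) ^ k) * hermite_poly k x
      * (exp (x\<^sup>2 / 2) * exp (- x\<^sup>2))"
    unfolding hermite_function_def higher_deriv_gaussian hermite_const_def by (simp only: mult_ac)
  ultimately show ?thesis by simp
qed

lemma hermite_const_pos: "hermite_const k > 0"
  by (simp add: hermite_const_def)

lemma hermite_const_Suc: "hermite_const k = sqrt (2 * (real k + 1)) * hermite_const (Suc k)"
proof -
  have "2 ^ Suc k * fact (Suc k) * sqrt pi = (2 * (real k + 1)) * (2 ^ k * fact k * sqrt pi)"
    by (simp add: algebra_simps)
  then have "hermite_const (Suc k) = (2 * (real k + 1)) powr (- 1 / 2) * hermite_const k"
    unfolding hermite_const_def by (simp only: powr_mult)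
  moreover have "sqrt (2 * (real k + 1)) * (2 * (real k + 1)) powr (- 1 / 2) = 1"
    by (simp add: powr_half_sqrt [symmetric] flip: powr_add)
  ultimately show ?thesis by (simp flip: mult.assoc)
qed

lemma hermite_function_0: "hermite_function 0 x = pi powr (- 1 / 4) * exp (- (x\<^sup>2 / 2))"
  by (simp add: hermite_function_eq hermite_const_def powr_powr flip: powr_half_sqrt)

lemma sqrt_double_half: "sqrt (2 * a) = 2 * sqrt (a / 2)"
proof -
  have "2 * sqrt (a / 2) = sqrt 4 * sqrt (a / 2)" by simp
  also have "\<dots> = sqrt (2 * a)" unfolding real_sqrt_mult [symmetric] by simp
  finally show ?thesis by simp
qed

text \<open>Sum of a raising and a lowering operator.  The derivative formula below is their difference, and the two
  together carry all the algebra that follows; the polynomials themselves return only in the decay estimate.\<close>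

lemma hermite_function_recurrence:
  "x * hermite_function k x =
    sqrt ((real k + 1) / 2) * hermite_function (Suc k) x + sqrt (real k / 2) * hermite_function (k - 1) x"
proof -
  have 1: "hermite_const k = 2 * sqrt ((real k + 1) / 2) * hermite_const (Suc k)"
    by (subst hermite_const_Suc) (simp only: sqrt_double_half)
  have 2: "sqrt (real k / 2) * hermite_const (k - 1) * hermite_poly (k - 1) x 
      = real k * hermite_const k * hermite_poly (k - 1) x"
  proof (cases k)
    case (Suc j)
    have "sqrt (real k / 2) * hermite_const (k - 1)
      = (sqrt (real k / 2) * sqrt (2 * (real j + 1))) * hermite_const k"
      unfolding Suc using hermite_const_Suc[of j] by (simp del: real_sqrt_mult)
    also have "sqrt (real k / 2) * sqrt (2 * (real j + 1)) = real k"
    proof -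
      have "sqrt (real k / 2) * sqrt (2 * (real j + 1)) = sqrt ((real k)\<^sup>2)"
        unfolding real_sqrt_mult [symmetric] Suc by (simp add: power2_eq_square field_simps)
      then show ?thesis by simp
    qed
    finally show ?thesis by simp
  qed simp
  have "sqrt ((real k + 1) / 2) * hermite_const (Suc k) * hermite_poly (Suc k) x
      + sqrt (real k / 2) * hermite_const (k - 1) * hermite_poly (k - 1) x
      = hermite_const k / 2 * hermite_poly (Suc k) x + real k * hermite_const k * hermite_poly (k - 1) x"
    unfolding 2 by (subst 1) simp
  also have "\<dots> = x * hermite_const k * hermite_poly k x"
    unfolding hermite_poly_Suc by (simp add: algebra_simps)
  finally have "(sqrt ((real k + 1) / 2) * hermite_const (Suc k) * hermite_poly (Suc k) x
      + sqrt (real k / 2) * hermite_const (k - 1) * hermite_poly (k - 1) x) * exp (- (x\<^sup>2 / 2))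
      = x * hermite_const k * hermite_poly k x * exp (- (x\<^sup>2 / 2))" by simp
  then show ?thesis
    unfolding hermite_function_eq by (simp only: algebra_simps)
qed

lemma has_field_derivative_hermite_function:
  "(hermite_function k has_field_derivative
     sqrt (real k / 2) * hermite_function (k - 1) x - sqrt ((real k + 1) / 2) * hermite_function (Suc k) x) (at x)"
proof -
  let ?e = "exp (- (x\<^sup>2 / 2))"
  have "((\<lambda>x. hermite_const k * hermite_poly k x * exp (- (x\<^sup>2 / 2))) has_field_derivative
      hermite_const k * (2 * real k * hermite_poly (k - 1) x) * ?e - x * (hermite_const k * hermite_poly k x * ?e)) (at x)"
    by (auto intro!: derivative_eq_intros has_field_derivative_hermite_poly simp: algebra_simps)
  also have "hermite_const k * (2 * real k * hermite_poly (k - 1) x) 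
     = hermite_const k * (2 * x * hermite_poly k x - hermite_poly (Suc k) x)"
    unfolding hermite_poly_Suc[of k] by simp
  also have "\<dots> * ?e - x * (hermite_const k * hermite_poly k x * ?e)
     = x * hermite_function k x - hermite_const k * hermite_poly (Suc k) x * ?e"
    unfolding hermite_function_eq by (simp add: algebra_simps)
  also have "hermite_const k * hermite_poly (Suc k) x * ?e = 2 * sqrt ((real k + 1) / 2) * hermite_function (Suc k) x"
    unfolding hermite_function_eq
    by (subst hermite_const_Suc) (simp only: sqrt_double_half mult_ac)
  also have "x * hermite_function k x - \<dots> = 
     sqrt (real k / 2) * hermite_function (k - 1) x - sqrt ((real k + 1) / 2) * hermite_function (Suc k) x"
    unfolding hermite_function_recurrence by simp
  also have "(\<lambda>x. hermite_const k * hermite_poly k x * exp (- (x\<^sup>2 / 2))) = hermite_function k"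
    by (simp add: hermite_function_eq fun_eq_iff)
  finally show ?thesis .
qed

lemma continuous_on_hermite_function: "continuous_on S (hermite_function k)"
  by (intro continuous_at_imp_continuous_on ballI DERIV_isCont[OF has_field_derivative_hermite_function])

lemma isCont_hermite_function [continuous_intros]: "isCont (hermite_function k) x"
  using has_field_derivative_hermite_function DERIV_isCont by blast

lemma borel_measurable_hermite_function [measurable]: "hermite_function k \<in> borel_measurable borel"
  by (intro borel_measurable_continuous_onI continuous_on_hermite_function)

lemma abs_le_exp_sq: 
  fixes \<delta> x :: real
  assumes "\<delta> > 0"
  shows "\<bar>x\<bar> \<le> (1 + 1 / \<delta>) * exp (\<delta> * x\<^sup>2)"
proof -
  have "\<bar>x\<bar> \<le> 1 + x\<^sup>2"
    using sum_squares_bound[of 1 "\<bar>x\<bar>"] by simp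
  also have "\<dots> \<le> (1 + 1 / \<delta>) * (1 + \<delta> * x\<^sup>2)"
    using assms by (simp add: field_simps)
  also have "\<dots> \<le> (1 + 1 / \<delta>) * exp (\<delta> * x\<^sup>2)"
    using assms exp_ge_add_one_self by (intro mult_left_mono) auto
  finally show ?thesis .
qed

text \<open>An arbitrary rate \<open>\<delta>\<close> is what the induction needs: half of it pays for the additional factor \<open>x\<close>.\<close>

lemma hermite_poly_growth:
  assumes "\<delta> > 0"
  shows "\<exists>C\<ge>0. \<forall>x. \<bar>hermite_poly k x\<bar> \<le> C * exp (\<delta> * x\<^sup>2)"
  using assms
proof (induction k arbitrary: \<delta> rule: less_induct)
  case (less k \<delta>)
  show ?case
  proof (cases k)
    case 0
    then show ?thesis using less.prems by (intro exI[of _ 1]) auto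
  next
    case (Suc j)
    obtain C where C: "C \<ge> 0" "\<And>x. \<bar>hermite_poly j x\<bar> \<le> C * exp (\<delta> / 2 * x\<^sup>2)"
      using less.IH[of j "\<delta> / 2"] less.prems Suc by auto
    obtain D where D: "D \<ge> 0" "\<And>x. \<bar>hermite_poly (j - 1) x\<bar> \<le> D * exp (\<delta> * x\<^sup>2)"
      using less.IH[of "j - 1" \<delta>] less.prems Suc by fastforce
    let ?B = "2 * (1 + 2 / \<delta>) * C + 2 * real j * D"
    have "\<bar>hermite_poly k x\<bar> \<le> ?B * exp (\<delta> * x\<^sup>2)" for x
    proof -
      have "\<bar>hermite_poly k x\<bar> \<le> 2 * (\<bar>x\<bar> * \<bar>hermite_poly j x\<bar>) + 2 * real j * \<bar>hermite_poly (j - 1) x\<bar>"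
        unfolding Suc hermite_poly_Suc
        by (rule order_trans[OF abs_triangle_ineq4]) (simp add: abs_mult)
      also have "\<dots> \<le> 2 * (((1 + 1 / (\<delta> / 2)) * exp (\<delta> / 2 * x\<^sup>2)) * (C * exp (\<delta> / 2 * x\<^sup>2)))
           + 2 * real j * (D * exp (\<delta> * x\<^sup>2))"
        using less.prems C(1) by (intro add_mono mult_mono C(2) D(2) abs_le_exp_sq) auto
      also have "\<dots> = 2 * (1 + 2 / \<delta>) * C * (exp (\<delta> / 2 * x\<^sup>2) * exp (\<delta> / 2 * x\<^sup>2)) + 2 * real j * D * exp (\<delta> * x\<^sup>2)"
        by simp
      also have "exp (\<delta> / 2 * x\<^sup>2) * exp (\<delta> / 2 * x\<^sup>2) = exp (\<delta> * x\<^sup>2)"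
        by (simp flip: exp_add)
      finally show ?thesis by (simp add: algebra_simps)
    qed
    moreover have "?B \<ge> 0"
      using C D less.prems by simp
    ultimately show ?thesis by blast
  qed
qed

text \<open>The rate is half of the one in \<open>hermite_function_eq\<close>.  The slack absorbs polynomials and, in the proof of
  completeness, a growing Gaussian with small rate.\<close>

definition gaussian_dominated :: "(real \<Rightarrow> real) \<Rightarrow> bool" where
  "gaussian_dominated f \<longleftrightarrow> (\<exists>C. \<forall>x. \<bar>f x\<bar> \<le> C * exp (- (x\<^sup>2 / 4)))"

lemma gaussian_dominated_bounded_mult:
  assumes g: "\<And>x. \<bar>g x\<bar> \<le> B" and "gaussian_dominated f"
  shows "gaussian_dominated (\<lambda>x. g x * f x)"
proof -
  obtain C where C: "\<And>x. \<bar>f x\<bar> \<le> C * exp (- (x\<^sup>2 / 4))"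
    using assms(2) by (auto simp: gaussian_dominated_def)
  have "\<bar>g x * f x\<bar> \<le> (B * C) * exp (- (x\<^sup>2 / 4))" for x
    using mult_mono[OF g C, of x x] order_trans[OF abs_ge_zero g] by (simp add: abs_mult mult.assoc)
  then show ?thesis by (auto simp: gaussian_dominated_def)
qed

lemma gaussian_dominated_cmult: "gaussian_dominated f \<Longrightarrow> gaussian_dominated (\<lambda>x. c * f x)"
  by (rule gaussian_dominated_bounded_mult[OF order_refl])

lemma gaussian_dominated_add:
  assumes "gaussian_dominated f" "gaussian_dominated g"
  shows "gaussian_dominated (\<lambda>x. f x + g x)"
proof -
  obtain C D where "\<And>x. \<bar>f x\<bar> \<le> C * exp (- (x\<^sup>2 / 4))" "\<And>x. \<bar>g x\<bar> \<le> D * exp (- (x\<^sup>2 / 4))"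
    using assms unfolding gaussian_dominated_def by blast
  then have "\<bar>f x + g x\<bar> \<le> (C + D) * exp (- (x\<^sup>2 / 4))" for x
    unfolding distrib_right by (intro order_trans[OF abs_triangle_ineq] add_mono)
  then show ?thesis unfolding gaussian_dominated_def by blast
qed

lemma gaussian_dominated_diff:
  "gaussian_dominated f \<Longrightarrow> gaussian_dominated g \<Longrightarrow> gaussian_dominated (\<lambda>x. f x - g x)"
  using gaussian_dominated_add[OF _ gaussian_dominated_cmult, of f g "-1"] by simp

lemma gaussian_dominated_hermite_function: "gaussian_dominated (hermite_function k)"
proof -
  obtain C where C: "C \<ge> 0" "\<And>x. \<bar>hermite_poly k x\<bar> \<le> C * exp (1 / 4 * x\<^sup>2)"
    using hermite_poly_growth[of "1/4" k] by auto
  have "\<bar>hermite_function k x\<bar> \<le> (hermite_const k * C) * exp (- (x\<^sup>2 / 4))" for x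
  proof -
    have "\<bar>hermite_function k x\<bar> = hermite_const k * \<bar>hermite_poly k x\<bar> * exp (- (x\<^sup>2 / 2))"
      using hermite_const_pos[of k] by (simp add: hermite_function_eq abs_mult)
    also have "\<dots> \<le> hermite_const k * (C * exp (1 / 4 * x\<^sup>2)) * exp (- (x\<^sup>2 / 2))"
      using hermite_const_pos[of k] C by (intro mult_mono) auto
    also have "\<dots> = hermite_const k * C * exp (- (x\<^sup>2 / 4))"
      by (simp flip: exp_add)
    finally show ?thesis .
  qed
  then show ?thesis unfolding gaussian_dominated_def by blast
qed

lemma gaussian_dominated_hermite_function_mult:
  "gaussian_dominated (\<lambda>x. hermite_function j x * hermite_function k x)"
proof -
  obtain C where C: "\<And>x. \<bar>hermite_function j x\<bar> \<le> C * exp (- (x\<^sup>2 / 4))"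
    using gaussian_dominated_hermite_function by (auto simp: gaussian_dominated_def)
  have "0 \<le> C" using order_trans[OF abs_ge_zero C[of 0]] by simp
  then have "\<bar>hermite_function j x\<bar> \<le> C" for x
    by (intro order_trans[OF C] mult_left_le) auto
  then show ?thesis by (intro gaussian_dominated_bounded_mult gaussian_dominated_hermite_function)
qed

text \<open>Completing the square reduces this to the total mass of a normal density.\<close>

lemma has_bochner_integral_gaussian:
  fixes a b :: real
  assumes "a > 0"
  shows "has_bochner_integral lborel (\<lambda>y. exp (b * y - a * y\<^sup>2)) (sqrt (pi / a) * exp (b\<^sup>2 / (4 * a)))"
proof -
  let ?\<sigma> = "sqrt (1 / (2 * a))" and ?\<mu> = "b / (2 * a)"
  let ?c = "sqrt (pi / a) * exp (b\<^sup>2 / (4 * a))"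
  have \<sigma>2: "?\<sigma>\<^sup>2 = 1 / (2 * a)" using assms by simp
  have "has_bochner_integral lborel (normal_density ?\<mu> ?\<sigma>) 1"
    using assms by (simp add: has_bochner_integral_iff)
  then have "has_bochner_integral lborel (\<lambda>y. ?c * normal_density ?\<mu> ?\<sigma> y) (?c * 1)"
    by (rule has_bochner_integral_mult_right) 
  moreover have "?c * normal_density ?\<mu> ?\<sigma> y = exp (b * y - a * y\<^sup>2)" for y
  proof -
    have "?c * normal_density ?\<mu> ?\<sigma> y = exp (b\<^sup>2 / (4 * a)) * exp (- (y - ?\<mu>)\<^sup>2 / (2 * (1 / (2 * a))))"
      using assms unfolding normal_density_def \<sigma>2 by (simp add: real_sqrt_divide)
    also have "\<dots> = exp (b * y - a * y\<^sup>2)"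
      using assms unfolding exp_add [symmetric]
      by (simp add: field_simps power2_eq_square)
    finally show ?thesis .
  qed
  ultimately show ?thesis by simp
qed

lemma integrable_gaussian_dominated:
  assumes "f \<in> borel_measurable borel" "gaussian_dominated f"
  shows "integrable lborel f"
proof -
  obtain C where C: "\<And>x. \<bar>f x\<bar> \<le> C * exp (- (x\<^sup>2 / 4))"
    using assms(2) by (auto simp: gaussian_dominated_def)
  show ?thesis
  proof (rule Bochner_Integration.integrable_bound)
    show "integrable lborel (\<lambda>x. C * exp (- (x\<^sup>2 / 4)))"
      using has_bochner_integral_gaussian[of "1/4" 0]
      by (intro integrable_mult_right) (simp add: has_bochner_integral_iff)
    show "AE x in lborel. norm (f x) \<le> norm (C * exp (- (x\<^sup>2 / 4)))"
      using C by (intro AE_I2) (simp add: order_trans[OF _ abs_ge_self])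
  qed (use assms in auto)
qed

text \<open>Integration by parts on the whole line, in the form in which it is applied to a product \<open>F\<close>.\<close>

lemma integral_derivative_eq_0:
  fixes F f :: "real \<Rightarrow> real"
  assumes deriv: "\<And>x. (F has_field_derivative f x) (at x)" and cont: "\<And>x. isCont f x"
    and f: "gaussian_dominated f" and F: "gaussian_dominated F"
  shows "(\<integral>x. f x \<partial>lborel) = 0"
proof -
  have [measurable]: "f \<in> borel_measurable borel"
    using cont by (intro borel_measurable_continuous_onI continuous_at_imp_continuous_on) auto
  obtain C where C: "\<And>x. norm (F x) \<le> C * exp (- (x\<^sup>2 / 4))"
    using F by (auto simp: gaussian_dominated_def)
  have "((\<lambda>x. C * exp (- (x\<^sup>2 / 4))) \<longlongrightarrow> 0) at_top" "((\<lambda>x. C * exp (- (x\<^sup>2 / 4))) \<longlongrightarrow> 0) at_bot"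
    by real_asymp+
  then have lim: "(F \<longlongrightarrow> 0) at_top" "(F \<longlongrightarrow> 0) at_bot"
    by (auto intro: Lim_null_comparison[OF always_eventually[OF allI[OF C]]])
  have "(LBINT x=-\<infinity>..\<infinity>. f x) = 0 - 0"
  proof (rule interval_integral_FTC_integrable)
    show "set_integrable lborel (einterval (-\<infinity>) \<infinity>) f"
      using integrable_gaussian_dominated[OF _ f] by (simp add: set_integrable_def)
    show "((F \<circ> real_of_ereal) \<longlongrightarrow> 0) (at_right (-\<infinity>))" "((F \<circ> real_of_ereal) \<longlongrightarrow> 0) (at_left \<infinity>)"
      unfolding ereal_tendsto_simps using lim by auto
    show "(F has_vector_derivative f x) (at x)" for x
      using deriv[of x] by (simp add: has_real_derivative_iff_has_vector_derivative)
  qed (use cont in auto)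
  then show ?thesis
    by (simp add: interval_lebesgue_integral_def set_lebesgue_integral_def)
qed

lemma integrable_hermite_function: "integrable lborel (hermite_function k)"
  by (intro integrable_gaussian_dominated gaussian_dominated_hermite_function) measurable

lemma integrable_hermite_function_mult:
  "integrable lborel (\<lambda>x. hermite_function j x * hermite_function k x)"
  by (intro integrable_gaussian_dominated gaussian_dominated_hermite_function_mult) measurable

text \<open>Raising is adjoint to lowering.  The derivative of \<open>h\<^sub>k h\<^sub>j\<close> integrates to zero, which is one relation between
  neighbouring inner products; a second one comes from expanding \<open>x h\<^sub>k h\<^sub>j\<close> in two ways.  Half their difference is the claim.\<close>

lemma hermite_function_inner_step:
  "sqrt ((real k + 1) / 2) * (\<integral>x. hermite_function (Suc k) x * hermite_function j x \<partial>lborel)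
   = sqrt (real j / 2) * (\<integral>x. hermite_function k x * hermite_function (j - 1) x \<partial>lborel)"
proof -
  let ?h = hermite_function
  let ?I = "\<lambda>k j. \<integral>x. ?h k x * ?h j x \<partial>lborel"
  let ?a = "\<lambda>k. sqrt ((real k + 1) / 2)" and ?b = "\<lambda>k. sqrt (real k / 2)"
  let ?f = "\<lambda>x. ?b k * (?h (k - 1) x * ?h j x) - ?a k * (?h (Suc k) x * ?h j x) 
          + (?b j * (?h k x * ?h (j - 1) x) - ?a j * (?h k x * ?h (Suc j) x))"
  note int [simp] = integrable_hermite_function_mult integrable_mult_right
  have "(\<integral>x. ?f x \<partial>lborel) = 0"
  proof (rule integral_derivative_eq_0)
    show "((\<lambda>x. ?h k x * ?h j x) has_field_derivative ?f x) (at x)" for x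
      by (auto intro!: derivative_eq_intros has_field_derivative_hermite_function simp: algebra_simps)
    show "isCont ?f x" for x by (intro continuous_intros)
  qed (intro gaussian_dominated_add gaussian_dominated_diff gaussian_dominated_cmult
      gaussian_dominated_hermite_function_mult)+
  also have "(\<integral>x. ?f x \<partial>lborel) = ?b k * ?I (k-1) j - ?a k * ?I (Suc k) j + (?b j * ?I k (j - 1) - ?a j * ?I k (Suc j))"
    by (simp)
  finally have 1: "?b k * ?I (k-1) j - ?a k * ?I (Suc k) j + (?b j * ?I k (j - 1) - ?a j * ?I k (Suc j)) = 0" .
  have "(\<lambda>x. ?a k * (?h (Suc k) x * ?h j x) + ?b k * (?h (k - 1) x * ?h j x))
      = (\<lambda>x. ?a j * (?h k x * ?h (Suc j) x) + ?b j * (?h k x * ?h (j - 1) x))"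
  proof
    fix x
    have "(x * ?h k x) * ?h j x = ?h k x * (x * ?h j x)" by simp
    then show "?a k * (?h (Suc k) x * ?h j x) + ?b k * (?h (k - 1) x * ?h j x)
      = ?a j * (?h k x * ?h (Suc j) x) + ?b j * (?h k x * ?h (j - 1) x)"
      unfolding hermite_function_recurrence by (simp only: algebra_simps)
  qed
  then have "(\<integral>x. ?a k * (?h (Suc k) x * ?h j x) + ?b k * (?h (k - 1) x * ?h j x) \<partial>lborel)
      = (\<integral>x. ?a j * (?h k x * ?h (Suc j) x) + ?b j * (?h k x * ?h (j - 1) x) \<partial>lborel)" by simp
  then have "?a k * ?I (Suc k) j + ?b k * ?I (k - 1) j = ?a j * ?I k (Suc j) + ?b j * ?I k (j - 1)"
    by simp
  with 1 show ?thesis by linarith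
qed

theorem hermite_function_orthonormal:
  "(\<integral>x. hermite_function k x * hermite_function j x \<partial>lborel) = (if k = j then 1 else 0)"
proof (induction k arbitrary: j)
  case 0
  have "(\<integral>x. hermite_function 0 x * hermite_function (Suc i) x \<partial>lborel) = 0" for i
    using hermite_function_inner_step[of i 0] by (simp add: mult.commute)
  moreover have "(\<integral>x. hermite_function 0 x * hermite_function 0 x \<partial>lborel) = 1"
  proof -
    have "hermite_function 0 x * hermite_function 0 x = (pi powr (-1/4) * pi powr (-1/4)) * exp (0 * x - 1 * x\<^sup>2)" for x
      unfolding hermite_function_0 by (simp flip: exp_add)
    moreover have "pi powr (-1/4) * pi powr (-1/4) = 1 / sqrt pi"
      by (simp add: powr_minus_divide powr_half_sqrt flip: powr_add)
    ultimately show ?thesis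
      using has_bochner_integral_gaussian[of 1 0] 
      by (simp add: has_bochner_integral_iff)
  qed
  ultimately show ?case by (cases j) auto
next
  case (Suc k)
  show ?case
  proof (cases j)
    case 0
    then show ?thesis using hermite_function_inner_step[of k j] by simp
  next
    case (Suc i)
    have "sqrt ((real k + 1) / 2) * (\<integral>x. hermite_function (Suc k) x * hermite_function j x \<partial>lborel)
      = sqrt ((real i + 1) / 2) * (if k = i then 1 else 0)"
      using hermite_function_inner_step[of k j] Suc.IH[of i] unfolding Suc by (simp add: add.commute)
    then show ?thesis using Suc by (auto split: if_splits)
  qed
qed

section \<open>The Mehler kernel on the line\<close>

text \<open>The integral kernel of the heat operator \<open>exp (- t L)\<close> in dimension one, for \<open>t > 0\<close>.\<close>

definition mehler :: "real \<Rightarrow> real \<Rightarrow> real \<Rightarrow> real" where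
  "mehler t x y = 1 / sqrt (2 * pi * sinh (2 * t)) *
     exp (x * y / sinh (2 * t) - cosh (2 * t) / sinh (2 * t) / 2 * (x\<^sup>2 + y\<^sup>2))"

lemma mehler_commute: "mehler t x y = mehler t y x"
  by (simp add: mehler_def ac_simps)

lemma mehler_nonneg: "t \<ge> 0 \<Longrightarrow> mehler t x y \<ge> 0"
  by (simp add: mehler_def)

lemma borel_measurable_mehler [measurable (raw)]:
  assumes [measurable]: "f \<in> borel_measurable M" "g \<in> borel_measurable M" "h \<in> borel_measurable M"
  shows "(\<lambda>z. mehler (f z) (g z) (h z)) \<in> borel_measurable M"
  unfolding mehler_def sinh_def cosh_def by measurable

text \<open>The exponent is not positive, because \<open>cosh (2 t) \<ge> 1\<close> and \<open>2 x y \<le> x\<^sup>2 + y\<^sup>2\<close>.\<close>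

lemma mehler_le:
  assumes "t > 0"
  shows "mehler t x y \<le> 1 / sqrt (2 * pi * sinh (2 * t))"
proof -
  have s: "sinh (2 * t) > 0" using assms by simp
  have "x * y / sinh (2 * t) \<le> 1 / sinh (2 * t) / 2 * (x\<^sup>2 + y\<^sup>2)"
    using s sum_squares_bound[of x y] by (simp add: field_simps)
  also have "\<dots> \<le> cosh (2 * t) / sinh (2 * t) / 2 * (x\<^sup>2 + y\<^sup>2)"
    using s by (intro mult_right_mono divide_right_mono cosh_real_ge_1) auto
  finally have "exp (x * y / sinh (2 * t) - cosh (2 * t) / sinh (2 * t) / 2 * (x\<^sup>2 + y\<^sup>2)) \<le> 1"
    by simp
  then show ?thesis
    unfolding mehler_def using s by (intro mult_left_le) auto
qed

text \<open>One computation for two purposes: \<open>c = 0\<close> gives the mass of the kernel, \<open>c = 1\<close> its action on the ground state.\<close>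

lemma has_bochner_integral_mehler_gaussian:
  fixes c t x :: real
  defines "S \<equiv> sinh (2 * t)" and "C \<equiv> cosh (2 * t)"
  assumes t: "t > 0" and c: "c \<ge> 0"
  shows "has_bochner_integral lborel (\<lambda>y. mehler t x y * exp (- (c / 2 * y\<^sup>2)))
    (1 / sqrt (C + c * S) * exp (- ((S + c * C) / (C + c * S) / 2 * x\<^sup>2)))"
proof -
  define E where "E = C + c * S"
  have S: "S > 0" and C: "C > 0" using t by (simp_all add: S_def C_def)
  have E: "E > 0" using S C c by (simp add: E_def add_pos_nonneg)
  have CS: "C * C = 1 + S * S" using cosh_square_eq[of "2 * t"] by (simp add: C_def S_def power2_eq_square)
  let ?c = "1 / sqrt (2 * pi * S) * exp (- (C / S / 2 * x\<^sup>2))" and ?a = "E / S / 2"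
  have main: "has_bochner_integral lborel (\<lambda>y. ?c * exp (x / S * y - ?a * y\<^sup>2))
     (?c * (sqrt (pi / ?a) * exp ((x / S)\<^sup>2 / (4 * ?a))))"
    using S E by (intro has_bochner_integral_mult_right has_bochner_integral_gaussian) auto
  have e1: "?c * exp (x / S * y - ?a * y\<^sup>2) = mehler t x y * exp (- (c / 2 * y\<^sup>2))" for y
  proof -
    have "- (C / S / 2 * x\<^sup>2) + (x / S * y - ?a * y\<^sup>2) = (x * y / S - C / S / 2 * (x\<^sup>2 + y\<^sup>2)) + - (c / 2 * y\<^sup>2)"
      unfolding E_def using S by (simp add: field_simps)
    then show ?thesis
      unfolding mehler_def S_def [symmetric] C_def [symmetric] mult.assoc exp_add [symmetric] by simp
  qed
  have e2: "?c * (sqrt (pi / ?a) * exp ((x / S)\<^sup>2 / (4 * ?a)))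
     = (1 / sqrt (2 * pi * S) * sqrt (pi / ?a)) * exp (- (C / S / 2 * x\<^sup>2) + (x / S)\<^sup>2 / (4 * ?a))"
    by (simp only: exp_add mult_ac)
  have e3: "1 / sqrt (2 * pi * S) * sqrt (pi / ?a) = 1 / sqrt E"
    using S E by (simp add: real_sqrt_mult real_sqrt_divide field_simps)
  have e4: "- (C / S / 2 * x\<^sup>2) + (x / S)\<^sup>2 / (4 * ?a) = - ((S + c * C) / E / 2 * x\<^sup>2)"
  proof -
    have "- (C / S / 2 * x\<^sup>2) + (x / S)\<^sup>2 / (4 * ?a) = x\<^sup>2 * (1 - C * E) / (2 * S * E)"
      using S E by (simp add: field_simps power2_eq_square)
    also have "1 - C * E = - S * (S + c * C)" by (simp add: E_def algebra_simps CS)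
    also have "x\<^sup>2 * (- S * (S + c * C)) / (2 * S * E) = - ((S + c * C) / E / 2 * x\<^sup>2)"
      using S E by (simp add: field_simps)
    finally show ?thesis .
  qed
  show ?thesis using main unfolding e1 e2 e3 e4 unfolding E_def .
qed

lemma has_bochner_integral_mehler:
  assumes "t > 0"
  shows "has_bochner_integral lborel (mehler t x)
    (1 / sqrt (cosh (2 * t)) * exp (- (sinh (2 * t) / cosh (2 * t) / 2 * x\<^sup>2)))"
  using has_bochner_integral_mehler_gaussian[OF assms, of 0 x] by simp

lemma integral_mehler_le:
  assumes "t > 0"
  shows "(\<integral>y. mehler t x y \<partial>lborel) \<le> 1 / sqrt (cosh (2 * t))"
proof -
  have "(\<integral>y. mehler t x y \<partial>lborel)
     = 1 / sqrt (cosh (2 * t)) * exp (- (sinh (2 * t) / cosh (2 * t) / 2 * x\<^sup>2))"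
    using has_bochner_integral_mehler[OF assms] by (simp add: has_bochner_integral_iff)
  also have "\<dots> \<le> 1 / sqrt (cosh (2 * t)) * 1"
    using assms by (intro mult_left_mono) auto
  finally show ?thesis by simp
qed

lemma integrable_mehler: "t > 0 \<Longrightarrow> integrable lborel (mehler t x)"
  using has_bochner_integral_mehler by (simp add: has_bochner_integral_iff)

lemma gaussian_dominated_mehler_hermite:
  assumes "t > 0"
  shows "gaussian_dominated (\<lambda>y. mehler t x y * hermite_function k y)"
  using assms
  by (intro gaussian_dominated_bounded_mult[where B = "1 / sqrt (2 * pi * sinh (2 * t))"]
      gaussian_dominated_hermite_function) (simp add: mehler_nonneg mehler_le)

lemma integrable_mehler_hermite:
  "t > 0 \<Longrightarrow> integrable lborel (\<lambda>y. mehler t x y * hermite_function k y)"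
  by (intro integrable_gaussian_dominated gaussian_dominated_mehler_hermite) measurable

lemma integral_mehler_hermite_0:
  assumes "t > 0"
  shows "(\<integral>y. mehler t x y * hermite_function 0 y \<partial>lborel) = exp (- t) * hermite_function 0 x"
proof -
  have E: "cosh (2 * t) + 1 * sinh (2 * t) = exp (2 * t)" "sinh (2 * t) + 1 * cosh (2 * t) = exp (2 * t)"
    using cosh_plus_sinh[of "2 * t"] by simp_all
  have "sqrt (exp (2 * t)) = exp t" by (simp add: exp_double)
  then have "has_bochner_integral lborel (\<lambda>y. mehler t x y * exp (- (1 / 2 * y\<^sup>2))) (exp (- t) * exp (- (1 / 2 * x\<^sup>2)))"
    using has_bochner_integral_mehler_gaussian[OF assms, of 1 x] unfolding E by (simp add: exp_minus inverse_eq_divide)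
  then have "has_bochner_integral lborel (\<lambda>y. pi powr (- 1 / 4) * (mehler t x y * exp (- (1 / 2 * y\<^sup>2))))
     (pi powr (- 1 / 4) * (exp (- t) * exp (- (1 / 2 * x\<^sup>2))))"
    by (rule has_bochner_integral_mult_right)
  then show ?thesis by (simp add: has_bochner_integral_iff hermite_function_0 mult_ac)
qed

text \<open>The derivative of the kernel in \<open>y\<close> is the kernel times an affine function of \<open>y\<close>.  Integrating by parts in \<open>y\<close>
  and removing every factor \<open>y\<close> with the recurrence leaves a three-term relation in \<open>k\<close>.  No derivative in \<open>x\<close>
  is taken, so there is no differentiation under the integral sign.\<close>

lemma mehler_hermite_step:
  fixes x t :: real and k :: nat
  defines "A \<equiv> (\<lambda>k. \<integral>y. mehler t x y * hermite_function k y \<partial>lborel)"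
  assumes "t > 0"
  shows "sqrt ((real k + 1) / 2) * exp (2 * t) * A (Suc k) = x * A k - sqrt (real k / 2) * exp (- (2 * t)) * A (k - 1)"
proof -
  define S where "S = sinh (2 * t)"
  define C where "C = cosh (2 * t)"
  have S: "S > 0" and C: "C > 0" using assms by (simp_all add: S_def C_def)
  let ?a = "sqrt ((real k + 1) / 2)" and ?b = "sqrt (real k / 2)"
  let ?g = "\<lambda>k y. mehler t x y * hermite_function k y"
  let ?f = "\<lambda>y. x / S * ?g k y - (C / S + 1) * ?a * ?g (Suc k) y + (1 - C / S) * ?b * ?g (k - 1) y"
  have "(\<integral>y. ?f y \<partial>lborel) = 0"
  proof (rule integral_derivative_eq_0)
    show "(?g k has_field_derivative ?f y) (at y)" for y
    proof -
      have "(mehler t x has_field_derivative (x / S - C / S * y) * mehler t x y) (at y)"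
      proof -
        have "((\<lambda>y. x * y / S - C / S / 2 * (x\<^sup>2 + y\<^sup>2)) has_field_derivative (x / S - C / S * y)) (at y)"
          using S by (auto intro!: derivative_eq_intros simp: field_simps)
        from DERIV_cmult[OF DERIV_fun_exp[OF this], of "1 / sqrt (2 * pi * S)"]
        show ?thesis
          unfolding mehler_def [abs_def] S_def [symmetric] C_def [symmetric] by (simp only: mult_ac)
      qed
      then have "(?g k has_field_derivative
        mehler t x y * (?b * hermite_function (k - 1) y - ?a * hermite_function (Suc k) y)
        + (x / S - C / S * y) * mehler t x y * hermite_function k y) (at y)"
        by (intro DERIV_mult' has_field_derivative_hermite_function)
      also have "(x / S - C / S * y) * mehler t x y * hermite_function k y
        = x / S * ?g k y - C / S * mehler t x y * (y * hermite_function k y)"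
        by (simp add: algebra_simps)
      also have "mehler t x y * (?b * hermite_function (k - 1) y - ?a * hermite_function (Suc k) y)
        + (x / S * ?g k y - C / S * mehler t x y * (y * hermite_function k y)) = ?f y"
        unfolding hermite_function_recurrence by (simp only: algebra_simps)
      finally show ?thesis .
    qed
    show "isCont ?f y" for y
      unfolding mehler_def using S by (intro continuous_intros) (auto simp: S_def)
  qed (intro gaussian_dominated_add gaussian_dominated_diff gaussian_dominated_cmult
      gaussian_dominated_mehler_hermite assms(2))+
  also have "(\<integral>y. ?f y \<partial>lborel) = x / S * A k - (C / S + 1) * ?a * A (Suc k) + (1 - C / S) * ?b * A (k - 1)"
    unfolding A_def using integrable_mehler_hermite[OF assms(2)] by simp
  finally have 1: "x / S * A k - (C / S + 1) * ?a * A (Suc k) + (1 - C / S) * ?b * A (k - 1) = 0" .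
  have "x * A k - (C + S) * ?a * A (Suc k) + (S - C) * ?b * A (k - 1)
     = S * (x / S * A k - (C / S + 1) * ?a * A (Suc k) + (1 - C / S) * ?b * A (k - 1))"
    using S by (simp add: field_simps)
  also have "\<dots> = 0" unfolding 1 by simp
  finally have 2: "(C + S) * ?a * A (Suc k) = x * A k + (S - C) * ?b * A (k - 1)" by linarith
  have E: "exp (2 * t) = C + S" "exp (- (2 * t)) = C - S"
    using cosh_plus_sinh[of "2 * t"] cosh_minus_sinh[of "2 * t"] by (simp_all add: C_def S_def)
  show ?thesis unfolding E using 2 by (simp only: algebra_simps)
qed

text \<open>The claimed values satisfy the relation of the previous lemma and agree with the integral for \<open>k = 0\<close>.\<close>

theorem mehler_eigenfunction:
  assumes "t > 0"
  shows "(\<integral>y. mehler t x y * hermite_function k y \<partial>lborel) = exp (- (2 * real k + 1) * t) * hermite_function k x"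
proof (induction k rule: less_induct)
  case (less k)
  show ?case
  proof (cases k)
    case 0
    then show ?thesis using integral_mehler_hermite_0[OF assms, of x] by simp
  next
    case (Suc j)
    let ?A = "\<lambda>k. \<integral>y. mehler t x y * hermite_function k y \<partial>lborel"
    let ?a = "sqrt ((real j + 1) / 2)" and ?b = "sqrt (real j / 2)"
    have 1: "?b * exp (- (2 * t)) * ?A (j - 1) = ?b * exp (- (2 * real j + 1) * t) * hermite_function (j - 1) x"
    proof (cases j)
      case (Suc i)
      have "?A (j - 1) = exp (- (2 * real i + 1) * t) * hermite_function (j - 1) x"
        using less.IH[of i] \<open>k = Suc j\<close> Suc by simp
      moreover have "exp (- (2 * t)) * exp (- (2 * real i + 1) * t) = exp (- (2 * real j + 1) * t)"
        unfolding Suc by (simp add: algebra_simps flip: exp_add)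
      ultimately show ?thesis by (simp only: mult.assoc [symmetric]) (simp only: mult.assoc)
    qed simp
    have "?a * exp (2 * t) * ?A k = x * ?A j - ?b * exp (- (2 * t)) * ?A (j - 1)"
      using mehler_hermite_step[OF assms, of j x] unfolding Suc .
    also have "?A j = exp (- (2 * real j + 1) * t) * hermite_function j x"
      using less.IH[of j] Suc by simp
    also have "x * (exp (- (2 * real j + 1) * t) * hermite_function j x) - ?b * exp (- (2 * t)) * ?A (j - 1)
       = exp (- (2 * real j + 1) * t) * (x * hermite_function j x - ?b * hermite_function (j - 1) x)"
      unfolding 1 by (simp only: algebra_simps)
    also have "\<dots> = exp (- (2 * real j + 1) * t) * (?a * hermite_function k x)"
      unfolding hermite_function_recurrence Suc by simp
    finally have "?a * (exp (2 * t) * ?A k) = ?a * (exp (- (2 * real j + 1) * t) * hermite_function k x)"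
      by (simp only: mult_ac)
    then have "exp (2 * t) * ?A k = exp (- (2 * real j + 1) * t) * hermite_function k x" by simp
    then have "exp (- (2 * t)) * exp (2 * t) * ?A k
       = exp (- (2 * t)) * exp (- (2 * real j + 1) * t) * hermite_function k x" 
      by (simp only: mult.assoc)
    then show ?thesis
      unfolding exp_add [symmetric] Suc by (simp add: algebra_simps)
  qed
qed

text \<open>The Hermite function is recovered from its image under the heat operator at time \<open>t\<close> at the cost of a factor
  \<open>exp ((2 k + 1) t)\<close>, which is \<open>e\<close> for the time chosen here.  The image is bounded because \<open>2 M h \<le> M\<^sup>2 + h\<^sup>2\<close> for the Mehler kernel \<open>M\<close>,
  and the integral of \<open>M\<^sup>2\<close> is at most the supremum \<open>K\<close> of the kernel, which grows at most linearly in \<open>k\<close>.\<close>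

lemma hermite_function_sup_bound: "\<bar>hermite_function k x\<bar> \<le> 3 * (real k + 1)"
proof -
  define t where "t = 1 / (2 * real k + 1)"
  define K where "K = 1 / sqrt (2 * pi * sinh (2 * t))"
  have t: "t > 0" by (simp add: t_def)
  have K0: "K \<ge> 0" using t by (simp add: K_def)
  have "\<bar>exp (- 1) * hermite_function k x\<bar> = \<bar>\<integral>y. mehler t x y * hermite_function k y \<partial>lborel\<bar>"
  proof -
    have "(2 * real k + 1) * t = 1" by (simp add: t_def)
    then have "- (2 * real k + 1) * t = - 1" by linarith
    then show ?thesis unfolding mehler_eigenfunction[OF t] by simp
  qed
  also have "\<dots> \<le> (\<integral>y. \<bar>mehler t x y * hermite_function k y\<bar> \<partial>lborel)"
    using integral_norm_bound[of lborel "\<lambda>y. mehler t x y * hermite_function k y"] by simp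
  also have "\<dots> \<le> (\<integral>y. (K / 2) * mehler t x y + 1 / 2 * (hermite_function k y * hermite_function k y) \<partial>lborel)"
  proof (rule integral_mono)
    fix y
    have "\<bar>mehler t x y * hermite_function k y\<bar> \<le> 1 / 2 * (mehler t x y * mehler t x y) + 1 / 2 * (hermite_function k y * hermite_function k y)"
      using sum_squares_bound[of "\<bar>mehler t x y\<bar>" "\<bar>hermite_function k y\<bar>"]
      by (simp add: abs_mult power2_eq_square)
    also have "mehler t x y * mehler t x y \<le> K * mehler t x y"
      unfolding K_def using t by (intro mult_right_mono mehler_le mehler_nonneg) auto
    finally show "\<bar>mehler t x y * hermite_function k y\<bar> \<le> (K / 2) * mehler t x y + 1 / 2 * (hermite_function k y * hermite_function k y)"
      by simp
  qed (use t integrable_mehler integrable_mehler_hermite integrable_hermite_function_mult in auto)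
  also have "\<dots> = (K / 2) * (\<integral>y. mehler t x y \<partial>lborel) + 1 / 2"
    using t integrable_mehler[OF t] integrable_hermite_function_mult hermite_function_orthonormal[of k k] by simp
  also have "(K / 2) * (\<integral>y. mehler t x y \<partial>lborel) \<le> K / 2 * 1"
  proof (rule mult_left_mono)
    have "1 / sqrt (cosh (2 * t)) \<le> 1" using cosh_real_ge_1[of "2 * t"] by simp
    then show "(\<integral>y. mehler t x y \<partial>lborel) \<le> 1"
      using integral_mehler_le[OF t, of x] by linarith
  qed (use K0 in auto)
  also have "K \<le> 2 * real k + 1"
  proof -
    have "t \<le> 2 * pi * sinh (2 * t)"
    proof -
      have "exp (- (2 * t)) \<le> 1" "1 + 2 * t \<le> exp (2 * t)"
        using t exp_ge_add_one_self[of "2 * t"] by simp_all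
      moreover have "t \<le> (p - q) / 2" if "q \<le> 1" "1 + 2 * t \<le> p" for p q :: real
        using that by simp
      ultimately have "t \<le> sinh (2 * t)" unfolding sinh_field_def by blast
      moreover have "sinh (2 * t) \<le> 2 * pi * sinh (2 * t)" using t pi_gt3 by simp
      ultimately show ?thesis using t by linarith
    qed
    then have "K \<le> 1 / sqrt t" unfolding K_def using t by (intro divide_left_mono real_sqrt_le_mono) auto
    also have "\<dots> = sqrt (2 * real k + 1)" by (simp add: t_def real_sqrt_divide)
    also have "\<dots> \<le> 2 * real k + 1" by (intro real_le_lsqrt self_le_power) auto
    finally show ?thesis .
  qed
  also have "(2 * real k + 1) / 2 * 1 + 1 / 2 = real k + 1" by (simp add: field_simps)
  finally have "exp (- 1) * \<bar>hermite_function k x\<bar> \<le> real k + 1"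
    by (simp only: abs_mult abs_exp_cancel)
  then have "\<bar>hermite_function k x\<bar> \<le> exp 1 * (real k + 1)"
    by (simp add: exp_minus field_simps)
  also have "\<dots> \<le> 3 * (real k + 1)" using exp_le by (intro mult_right_mono) auto
  finally show ?thesis .
qed

lemma integrable_inverse_1_plus_square': "integrable lborel (\<lambda>x::real. inverse (1 + x\<^sup>2))"
  using integrable_inverse_1_plus_square by (simp add: set_integrable_def)

text \<open>Weighted arithmetic-geometric mean: \<open>2 \<bar>h\<bar> \<le> 1 / (1 + x\<^sup>2) + (1 + x\<^sup>2) h\<^sup>2\<close>, where the recurrence and
  orthonormality bound the integral of \<open>x\<^sup>2 h\<^sup>2\<close>.\<close>

lemma hermite_function_L1_bound:
  "(\<integral>x. \<bar>hermite_function k x\<bar> \<partial>lborel) \<le> ((\<integral>x. inverse (1 + (x::real)\<^sup>2) \<partial>lborel) + 2) * (real k + 1)"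
proof -
  let ?h = hermite_function and ?J = "\<integral>x. inverse (1 + (x::real)\<^sup>2) \<partial>lborel"
  let ?g = "\<lambda>x. inverse (1 + x\<^sup>2) + (?h k x * ?h k x + ((real k + 1) * (?h (Suc k) x * ?h (Suc k) x) + real k * (?h (k - 1) x * ?h (k - 1) x)))"
  have J: "?J \<ge> 0" by (intro integral_nonneg_AE) auto
  have "(\<integral>x. \<bar>?h k x\<bar> \<partial>lborel) \<le> (\<integral>x. 1 / 2 * ?g x \<partial>lborel)"
  proof (rule integral_mono)
    fix x
    have "x * ?h k x = sqrt ((real k + 1) / 2) * ?h (Suc k) x + sqrt (real k / 2) * ?h (k - 1) x"
      by (rule hermite_function_recurrence)
    then have "(x * ?h k x)\<^sup>2 \<le> 2 * (sqrt ((real k + 1) / 2) * ?h (Suc k) x)\<^sup>2 + 2 * (sqrt (real k / 2) * ?h (k - 1) x)\<^sup>2"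
      using sum_squares_bound[of "sqrt ((real k + 1) / 2) * ?h (Suc k) x" "sqrt (real k / 2) * ?h (k - 1) x"]
      by (simp add: power2_sum)
    also have "\<dots> = (real k + 1) * (?h (Suc k) x * ?h (Suc k) x) + real k * (?h (k - 1) x * ?h (k - 1) x)"
      by (simp only: power_mult_distrib) (simp add: power2_eq_square)
    finally have 1: "(x * ?h k x)\<^sup>2 \<le> \<dots>" .
    have "2 * \<bar>?h k x\<bar> = 2 * (1 / sqrt (1 + x\<^sup>2)) * (sqrt (1 + x\<^sup>2) * \<bar>?h k x\<bar>)"
      using sum_power2_ge_zero[of 1 x] by (simp add: add_nonneg_eq_0_iff)
    also have "\<dots> \<le> (1 / sqrt (1 + x\<^sup>2))\<^sup>2 + (sqrt (1 + x\<^sup>2) * \<bar>?h k x\<bar>)\<^sup>2"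
      by (rule sum_squares_bound)
    also have "(1 / sqrt (1 + x\<^sup>2))\<^sup>2 = inverse (1 + x\<^sup>2)"
      by (simp add: power_divide inverse_eq_divide)
    also have "(sqrt (1 + x\<^sup>2) * \<bar>?h k x\<bar>)\<^sup>2 = ?h k x * ?h k x + (x * ?h k x)\<^sup>2"
      by (simp add: power_mult_distrib algebra_simps) (simp add: power2_eq_square)
    finally show "\<bar>?h k x\<bar> \<le> 1 / 2 * ?g x" using 1 by simp
  qed (use integrable_hermite_function integrable_inverse_1_plus_square' integrable_hermite_function_mult in auto)
  also have "\<dots> = 1 / 2 * (?J + (1 + ((real k + 1) + (if k = 0 then 0 else real k))))"
    using integrable_inverse_1_plus_square' integrable_hermite_function_mult
    by (simp add: hermite_function_orthonormal)
  also have "\<dots> \<le> (?J + 2) * (real k + 1)"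
    using J by (simp add: algebra_simps)
  finally show ?thesis .
qed

section \<open>Hermite functions and Mehler kernels in several variables\<close>

interpretation lborel_product: product_sigma_finite "\<lambda>_::nat. lborel :: real measure" ..

lemma sigma_finite_lebesgue_n: "sigma_finite_measure (lebesgue_n n)"
proof -
  interpret finite_product_sigma_finite "\<lambda>_::nat. lborel :: real measure" "{..<n}" by standard auto
  show ?thesis unfolding lebesgue_n_def by (rule sigma_finite_measure_axioms)
qed

lemma measurable_coordinate:
  "i < n \<Longrightarrow> (\<lambda>x. x i) \<in> borel_measurable (lebesgue_n n)"
  unfolding lebesgue_n_def using measurable_component_singleton[of i "{..<n}" "\<lambda>_. lborel :: real measure"] by simp

lemma measurable_coordinate':
  assumes "f \<in> measurable N (lebesgue_n n)" "i < n"
  shows "(\<lambda>z. f z i) \<in> borel_measurable N"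
  using measurable_compose[OF assms(1) measurable_coordinate[OF assms(2)]] .

lemma borel_measurable_hermite_function_n [measurable (raw)]:
  assumes [measurable]: "f \<in> measurable N (lebesgue_n n)"
  shows "(\<lambda>z. hermite_function_n n \<alpha> (f z)) \<in> borel_measurable N"
  unfolding hermite_function_n_def
  by (intro borel_measurable_prod measurable_compose[OF _ borel_measurable_hermite_function])
     (auto intro: measurable_coordinate'[OF assms])

lemma integrable_prod_lebesgue_n:
  fixes f :: "nat \<Rightarrow> real \<Rightarrow> real"
  assumes "\<And>i. i < n \<Longrightarrow> integrable lborel (f i)"
  shows "integrable (lebesgue_n n) (\<lambda>x. \<Prod>i<n. f i (x i))"
    and "(\<integral>x. (\<Prod>i<n. f i (x i)) \<partial>lebesgue_n n) = (\<Prod>i<n. \<integral>x. f i x \<partial>lborel)"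
  unfolding lebesgue_n_def
  using assms by (intro lborel_product.product_integrable_prod lborel_product.product_integral_prod; simp)+

lemma integrable_hermite_function_n:
  "integrable (lebesgue_n n) (hermite_function_n n \<alpha>)"
  unfolding hermite_function_n_def
  by (intro integrable_prod_lebesgue_n integrable_hermite_function)

lemma integrable_hermite_function_n_mult:
  "integrable (lebesgue_n n) (\<lambda>x. hermite_function_n n \<alpha> x * hermite_function_n n \<beta> x)"
  unfolding hermite_function_n_def prod.distrib [symmetric]
  by (intro integrable_prod_lebesgue_n integrable_hermite_function_mult)

lemma hermite_function_n_orthonormal:
  assumes "\<alpha> \<in> {..<n} \<rightarrow>\<^sub>E UNIV" "\<beta> \<in> {..<n} \<rightarrow>\<^sub>E UNIV"
  shows "(\<integral>x. hermite_function_n n \<alpha> x * hermite_function_n n \<beta> x \<partial>lebesgue_n n) = (if \<alpha> = \<beta> then 1 else 0)"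
proof -
  have "(\<integral>x. hermite_function_n n \<alpha> x * hermite_function_n n \<beta> x \<partial>lebesgue_n n)
     = (\<Prod>i<n. \<integral>x. hermite_function (\<alpha> i) x * hermite_function (\<beta> i) x \<partial>lborel)"
    unfolding hermite_function_n_def prod.distrib [symmetric]
    by (intro integrable_prod_lebesgue_n integrable_hermite_function_mult)
  also have "\<dots> = (\<Prod>i<n. if \<alpha> i = \<beta> i then 1 else 0)"
    by (simp add: hermite_function_orthonormal)
  also have "\<dots> = (if \<alpha> = \<beta> then 1 else 0)"
  proof (cases "\<alpha> = \<beta>")
    case False
    then obtain i where "\<alpha> i \<noteq> \<beta> i" by blast
    moreover have "i < n" using calculation assms by (metis PiE_arb lessThan_iff)
    ultimately show ?thesis using False by (auto intro!: prod_zero bexI[of _ i])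
  qed simp
  finally show ?thesis .
qed

lemma hermite_function_n_recurrence:
  assumes "i < n"
  shows "x i * hermite_function_n n \<alpha> x = 
     sqrt ((real (\<alpha> i) + 1) / 2) * hermite_function_n n (\<alpha>(i := Suc (\<alpha> i))) x
     + sqrt (real (\<alpha> i) / 2) * hermite_function_n n (\<alpha>(i := \<alpha> i - 1)) x"
proof -
  define P where "P = (\<Prod>j\<in>{..<n} - {i}. hermite_function (\<alpha> j) (x j))"
  have upd: "hermite_function_n n (\<alpha>(i := k)) x = hermite_function k (x i) * P" for k
  proof -
    have "hermite_function_n n (\<alpha>(i := k)) x = hermite_function k (x i)
        * (\<Prod>j\<in>{..<n} - {i}. hermite_function ((\<alpha>(i := k)) j) (x j))"
      unfolding hermite_function_n_def using assms by (subst prod.remove[of _ i]) auto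
    also have "(\<Prod>j\<in>{..<n} - {i}. hermite_function ((\<alpha>(i := k)) j) (x j)) = P"
      unfolding P_def by (intro prod.cong) auto
    finally show ?thesis .
  qed
  have "x i * hermite_function_n n \<alpha> x = (x i * hermite_function (\<alpha> i) (x i)) * P"
    using upd[of "\<alpha> i"] by simp
  then show ?thesis
    unfolding hermite_function_recurrence upd by (simp only: algebra_simps)
qed

text \<open>One constant that serves for the supremum as well as for the \<open>L\<^sup>1\<close> norm in one variable.  It is crude, since only
  polynomial growth in the index matters.\<close>

definition hermite_bound_const :: real where
  "hermite_bound_const = max 3 ((\<integral>x. inverse (1 + (x::real)\<^sup>2) \<partial>lborel) + 2)"

lemma hermite_function_n_bounds:
  assumes "\<alpha> \<in> multi_indices n m"
  shows "\<bar>hermite_function_n n \<alpha> x\<bar> \<le> (hermite_bound_const * (real m + 1)) ^ n"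
    and "(\<integral>x. \<bar>hermite_function_n n \<alpha> x\<bar> \<partial>lebesgue_n n) \<le> (hermite_bound_const * (real m + 1)) ^ n"
proof -
  let ?B = "hermite_bound_const"
  have le: "real (\<alpha> i) + 1 \<le> real m + 1" if "i < n" for i
    using assms that member_le_sum[of i "{..<n}" \<alpha>] by (auto simp: multi_indices_def)
  have B: "?B \<ge> 3" "?B \<ge> (\<integral>x. inverse (1 + (x::real)\<^sup>2) \<partial>lborel) + 2"
    by (auto simp: hermite_bound_const_def)
  have "\<bar>hermite_function_n n \<alpha> x\<bar> = (\<Prod>i<n. \<bar>hermite_function (\<alpha> i) (x i)\<bar>)"
    by (simp add: hermite_function_n_def abs_prod)
  also have "\<dots> \<le> (\<Prod>i<n. ?B * (real m + 1))"
  proof (intro prod_mono conjI)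
    fix i assume "i \<in> {..<n}"
    then have "\<bar>hermite_function (\<alpha> i) (x i)\<bar> \<le> 3 * (real (\<alpha> i) + 1)" by (intro hermite_function_sup_bound)
    also have "\<dots> \<le> ?B * (real m + 1)" using B le \<open>i \<in> {..<n}\<close> by (intro mult_mono) auto
    finally show "\<bar>hermite_function (\<alpha> i) (x i)\<bar> \<le> ?B * (real m + 1)" .
  qed auto
  finally show "\<bar>hermite_function_n n \<alpha> x\<bar> \<le> (?B * (real m + 1)) ^ n" by simp
  have "(\<integral>x. \<bar>hermite_function_n n \<alpha> x\<bar> \<partial>lebesgue_n n) = (\<Prod>i<n. \<integral>x. \<bar>hermite_function (\<alpha> i) x\<bar> \<partial>lborel)"
    unfolding hermite_function_n_def abs_prod
    by (intro integrable_prod_lebesgue_n integrable_abs integrable_hermite_function)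
  also have "\<dots> \<le> (\<Prod>i<n. ?B * (real m + 1))"
  proof (intro prod_mono conjI)
    fix i assume "i \<in> {..<n}"
    have "(\<integral>x. \<bar>hermite_function (\<alpha> i) x\<bar> \<partial>lborel) \<le> ((\<integral>x. inverse (1 + (x::real)\<^sup>2) \<partial>lborel) + 2) * (real (\<alpha> i) + 1)"
      by (rule hermite_function_L1_bound)
    also have "\<dots> \<le> ?B * (real m + 1)" using B le \<open>i \<in> {..<n}\<close> by (intro mult_mono) auto
    finally show "(\<integral>x. \<bar>hermite_function (\<alpha> i) x\<bar> \<partial>lborel) \<le> ?B * (real m + 1)" .
  qed auto
  finally show "(\<integral>x. \<bar>hermite_function_n n \<alpha> x\<bar> \<partial>lebesgue_n n) \<le> (?B * (real m + 1)) ^ n" by simp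
qed

definition mehler_n :: "nat \<Rightarrow> real \<Rightarrow> (nat \<Rightarrow> real) \<Rightarrow> (nat \<Rightarrow> real) \<Rightarrow> real" where
  "mehler_n n t x y = (\<Prod>i<n. mehler t (x i) (y i))"

lemma mehler_n_commute: "mehler_n n t x y = mehler_n n t y x"
  by (simp add: mehler_n_def mehler_commute)

lemma mehler_n_nonneg: "t \<ge> 0 \<Longrightarrow> mehler_n n t x y \<ge> 0"
  by (simp add: mehler_n_def mehler_nonneg prod_nonneg)

lemma borel_measurable_mehler_n [measurable (raw)]:
  assumes [measurable]: "s \<in> borel_measurable N" "f \<in> measurable N (lebesgue_n n)" "g \<in> measurable N (lebesgue_n n)"
  shows "(\<lambda>z. mehler_n n (s z) (f z) (g z)) \<in> borel_measurable N"
  unfolding mehler_n_def by (intro borel_measurable_prod borel_measurable_mehler) (auto intro: measurable_coordinate' assms)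

lemma nn_integral_mehler_n_le:
  assumes "t > 0"
  shows "(\<integral>\<^sup>+y. ennreal (mehler_n n t x y) \<partial>lebesgue_n n) \<le> ennreal ((1 / sqrt (cosh (2 * t))) ^ n)"
proof -
  have int: "integrable (lebesgue_n n) (mehler_n n t x)"
    unfolding mehler_n_def by (intro integrable_prod_lebesgue_n integrable_mehler assms)
  have "(\<integral>\<^sup>+y. ennreal (mehler_n n t x y) \<partial>lebesgue_n n) = ennreal (\<integral>y. mehler_n n t x y \<partial>lebesgue_n n)"
    using int assms by (intro nn_integral_eq_integral) (auto simp: mehler_n_nonneg)
  also have "(\<integral>y. mehler_n n t x y \<partial>lebesgue_n n) = (\<Prod>i<n. \<integral>y. mehler t (x i) y \<partial>lborel)"
    unfolding mehler_n_def by (intro integrable_prod_lebesgue_n integrable_mehler assms)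
  also have "\<dots> \<le> (\<Prod>i<n. 1 / sqrt (cosh (2 * t)))"
    using assms by (intro prod_mono conjI integral_mehler_le integral_nonneg_AE) (auto simp: mehler_nonneg)
  finally show ?thesis by (simp add: ennreal_leI)
qed

theorem mehler_n_eigenfunction:
  assumes "t > 0" "\<alpha> \<in> multi_indices n m"
  shows "(\<integral>y. mehler_n n t x y * hermite_function_n n \<alpha> y \<partial>lebesgue_n n)
     = exp (- (2 * real m + real n) * t) * hermite_function_n n \<alpha> x"
proof -
  have "(\<integral>y. mehler_n n t x y * hermite_function_n n \<alpha> y \<partial>lebesgue_n n)
      = (\<Prod>i<n. \<integral>y. mehler t (x i) y * hermite_function (\<alpha> i) y \<partial>lborel)"
    unfolding mehler_n_def hermite_function_n_def prod.distrib [symmetric]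
    by (intro integrable_prod_lebesgue_n integrable_mehler_hermite assms)
  also have "\<dots> = (\<Prod>i<n. exp (- (2 * real (\<alpha> i) + 1) * t)) * hermite_function_n n \<alpha> x"
    by (simp add: mehler_eigenfunction[OF assms(1)] prod.distrib hermite_function_n_def)
  also have "(\<Prod>i<n. exp (- (2 * real (\<alpha> i) + 1) * t)) = exp (\<Sum>i<n. - (2 * real (\<alpha> i) + 1) * t)"
    by (simp add: exp_sum)
  also have "(\<Sum>i<n. - (2 * real (\<alpha> i) + 1) * t) = - (2 * (\<Sum>i<n. real (\<alpha> i)) + real n) * t"
    by (simp add: sum_distrib_right [symmetric] sum.distrib sum_negf sum_distrib_left sum_subtractf)
  also have "(\<Sum>i<n. real (\<alpha> i)) = real m"
    using assms(2) by (simp add: multi_indices_def flip: of_nat_sum)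
  finally show ?thesis .
qed

section \<open>Square integrable functions and Hermite coefficients\<close>

definition square_integrable :: "'a measure \<Rightarrow> ('a \<Rightarrow> complex) set" where
  "square_integrable M = {f \<in> borel_measurable M. integrable M (\<lambda>x. (norm (f x))\<^sup>2)}"

definition norm2_sq :: "'a measure \<Rightarrow> ('a \<Rightarrow> complex) \<Rightarrow> real" where
  "norm2_sq M f = (\<integral>x. (norm (f x))\<^sup>2 \<partial>M)"

lemma square_integrable_measurable: "f \<in> square_integrable M \<Longrightarrow> f \<in> borel_measurable M"
  by (simp add: square_integrable_def)

lemma norm2_sq_nonneg: "norm2_sq M f \<ge> 0"
  by (simp add: norm2_sq_def)

lemma nn_integral_norm_sq:
  assumes "f \<in> square_integrable M"
  shows "(\<integral>\<^sup>+x. ennreal ((norm (f x))\<^sup>2) \<partial>M) = ennreal (norm2_sq M f)"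
  using assms unfolding norm2_sq_def square_integrable_def by (intro nn_integral_eq_integral) auto

lemma square_integrableI_dominated:
  assumes "f \<in> borel_measurable M" "integrable M w" "\<And>x. x \<in> space M \<Longrightarrow> (norm (f x))\<^sup>2 \<le> w x"
  shows "f \<in> square_integrable M"
  using assms unfolding square_integrable_def
  by (auto intro!: Bochner_Integration.integrable_bound[OF assms(2)] AE_I2 order_trans[OF _ abs_ge_self])

lemma norm_add_sq_le:
  fixes a b :: "'a::real_normed_vector"
  shows "(norm (a + b))\<^sup>2 \<le> 2 * (norm a)\<^sup>2 + 2 * (norm b)\<^sup>2"
proof -
  have "(norm (a + b))\<^sup>2 \<le> (norm a + norm b)\<^sup>2" by (intro power_mono norm_triangle_ineq) simp
  also have "\<dots> \<le> 2 * (norm a)\<^sup>2 + 2 * (norm b)\<^sup>2"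
    using sum_squares_bound[of "norm a" "norm b"] by (simp add: power2_sum)
  finally show ?thesis .
qed

lemma square_integrable_add:
  assumes "f \<in> square_integrable M" "g \<in> square_integrable M"
  shows "(\<lambda>x. f x + g x) \<in> square_integrable M"
    and "norm2_sq M (\<lambda>x. f x + g x) \<le> 2 * norm2_sq M f + 2 * norm2_sq M g"
proof -
  show 1: "(\<lambda>x. f x + g x) \<in> square_integrable M"
    using assms
    by (intro square_integrableI_dominated[where w = "\<lambda>x. 2 * (norm (f x))\<^sup>2 + 2 * (norm (g x))\<^sup>2"] norm_add_sq_le)
       (auto simp: square_integrable_def)
  have "norm2_sq M (\<lambda>x. f x + g x) \<le> (\<integral>x. 2 * (norm (f x))\<^sup>2 + 2 * (norm (g x))\<^sup>2 \<partial>M)"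
    unfolding norm2_sq_def using assms 1
    by (intro integral_mono norm_add_sq_le) (auto simp: square_integrable_def)
  then show "norm2_sq M (\<lambda>x. f x + g x) \<le> 2 * norm2_sq M f + 2 * norm2_sq M g"
    using assms by (simp add: norm2_sq_def square_integrable_def)
qed

lemma square_integrable_cmult:
  assumes "f \<in> square_integrable M"
  shows "(\<lambda>x. c * f x) \<in> square_integrable M"
    and "norm2_sq M (\<lambda>x. c * f x) = (norm c)\<^sup>2 * norm2_sq M f"
  using assms by (auto simp: square_integrable_def norm2_sq_def norm_mult power_mult_distrib)

lemma square_integrable_diff:
  assumes "f \<in> square_integrable M" "g \<in> square_integrable M"
  shows "(\<lambda>x. f x - g x) \<in> square_integrable M"
  using square_integrable_add(1)[OF assms(1) square_integrable_cmult(1)[OF assms(2), of "-1"]] by simp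

lemma square_integrable_0: "(\<lambda>x. 0) \<in> square_integrable M"
  by (simp add: square_integrable_def)

lemma square_integrable_sum:
  assumes "\<And>i. i \<in> I \<Longrightarrow> f i \<in> square_integrable M"
  shows "(\<lambda>x. \<Sum>i\<in>I. f i x) \<in> square_integrable M"
  using assms by (induction I rule: infinite_finite_induct) (auto intro: square_integrable_0 square_integrable_add(1))

lemma square_integrable_bounded_mult:
  fixes u :: "'a \<Rightarrow> real"
  assumes "f \<in> square_integrable M" "u \<in> borel_measurable M" "\<And>x. x \<in> space M \<Longrightarrow> \<bar>u x\<bar> \<le> B"
  shows "(\<lambda>x. of_real (u x) * f x) \<in> square_integrable M"
    and "norm2_sq M (\<lambda>x. of_real (u x) * f x) \<le> B\<^sup>2 * norm2_sq M f"
proof -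
  have le: "(norm (of_real (u x) * f x))\<^sup>2 \<le> B\<^sup>2 * (norm (f x))\<^sup>2" if "x \<in> space M" for x
    unfolding norm_mult norm_of_real power_mult_distrib
    using power_mono[OF assms(3)[OF that], of 2] by (intro mult_right_mono) auto
  show 1: "(\<lambda>x. of_real (u x) * f x) \<in> square_integrable M"
    using assms le
    by (intro square_integrableI_dominated[where w = "\<lambda>x. B\<^sup>2 * (norm (f x))\<^sup>2"]) (auto simp: square_integrable_def)
  have "norm2_sq M (\<lambda>x. of_real (u x) * f x) \<le> (\<integral>x. B\<^sup>2 * (norm (f x))\<^sup>2 \<partial>M)"
    unfolding norm2_sq_def using assms 1 le
    by (intro integral_mono) (auto simp: square_integrable_def)
  then show "norm2_sq M (\<lambda>x. of_real (u x) * f x) \<le> B\<^sup>2 * norm2_sq M f"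
    by (simp add: norm2_sq_def)
qed

lemma square_integrable_mult_integrable:
  assumes "f \<in> square_integrable M" "g \<in> square_integrable M"
  shows "integrable M (\<lambda>x. f x * g x)"
proof (rule Bochner_Integration.integrable_bound[where f = "\<lambda>x. (norm (f x))\<^sup>2 + (norm (g x))\<^sup>2"])
  show "AE x in M. norm (f x * g x) \<le> norm ((norm (f x))\<^sup>2 + (norm (g x))\<^sup>2)"
  proof (intro AE_I2)
    fix x
    have "2 * (norm (f x) * norm (g x)) \<le> (norm (f x))\<^sup>2 + (norm (g x))\<^sup>2" "0 \<le> norm (f x) * norm (g x)"
      using sum_squares_bound[of "norm (f x)" "norm (g x)"] by (simp_all add: mult.assoc)
    then have "norm (f x) * norm (g x) \<le> (norm (f x))\<^sup>2 + (norm (g x))\<^sup>2" by linarith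
    then show "norm (f x * g x) \<le> norm ((norm (f x))\<^sup>2 + (norm (g x))\<^sup>2)" by (simp add: norm_mult)
  qed
qed (use assms in \<open>auto simp: square_integrable_def\<close>)

lemma norm2_sq_dominated_convergence:
  assumes "\<And>k. f k \<in> borel_measurable M" "g \<in> borel_measurable M" "integrable M (\<lambda>x. (w x :: real)\<^sup>2)"
    and "\<And>k x. x \<in> space M \<Longrightarrow> norm (f k x) \<le> w x" "\<And>x. x \<in> space M \<Longrightarrow> (\<lambda>k. f k x) \<longlonglongrightarrow> g x"
  shows "(\<lambda>k. norm2_sq M (\<lambda>x. g x - f k x)) \<longlonglongrightarrow> 0" "g \<in> square_integrable M"
proof -
  have gle: "norm (g x) \<le> w x" if "x \<in> space M" for x
    using assms(4,5)[OF that] by (intro LIMSEQ_le_const2[OF tendsto_norm]) auto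
  show "g \<in> square_integrable M"
    using assms gle by (intro square_integrableI_dominated[where w = "\<lambda>x. (w x)\<^sup>2"] power_mono) auto
  have "(\<lambda>k. \<integral>x. (norm (g x - f k x))\<^sup>2 \<partial>M) \<longlonglongrightarrow> (\<integral>x. 0 \<partial>M)"
  proof (rule integral_dominated_convergence[where w = "\<lambda>x. 4 * (w x)\<^sup>2"])
    show "AE x in M. (\<lambda>k. (norm (g x - f k x))\<^sup>2) \<longlonglongrightarrow> 0"
    proof (intro AE_I2)
      fix x assume "x \<in> space M"
      then have "(\<lambda>k. (norm (g x - f k x))\<^sup>2) \<longlonglongrightarrow> (norm (g x - g x))\<^sup>2"
        using assms(5) by (intro tendsto_intros) auto
      then show "(\<lambda>k. (norm (g x - f k x))\<^sup>2) \<longlonglongrightarrow> 0" by simp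
    qed
    show "AE x in M. norm ((norm (g x - f k x))\<^sup>2) \<le> 4 * (w x)\<^sup>2" for k
    proof (intro AE_I2)
      fix x assume x: "x \<in> space M"
      have "norm (g x - f k x) \<le> 2 * w x"
        using norm_triangle_ineq4[of "g x" "f k x"] gle[OF x] assms(4)[OF x, of k] by linarith
      then have "(norm (g x - f k x))\<^sup>2 \<le> (2 * w x)\<^sup>2" by (intro power_mono) auto
      then show "norm ((norm (g x - f k x))\<^sup>2) \<le> 4 * (w x)\<^sup>2" by (simp add: power_mult_distrib)
    qed
  qed (use assms in auto)
  then show "(\<lambda>k. norm2_sq M (\<lambda>x. g x - f k x)) \<longlonglongrightarrow> 0" by (simp add: norm2_sq_def)
qed

abbreviation hermite_fun :: "nat \<Rightarrow> (nat \<Rightarrow> nat) \<Rightarrow> (nat \<Rightarrow> real) \<Rightarrow> complex" where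
  "hermite_fun n \<alpha> x \<equiv> of_real (hermite_function_n n \<alpha> x)"

abbreviation L2 :: "nat \<Rightarrow> ((nat \<Rightarrow> real) \<Rightarrow> complex) set" where
  "L2 n \<equiv> square_integrable (lebesgue_n n)"

abbreviation sqnorm :: "nat \<Rightarrow> ((nat \<Rightarrow> real) \<Rightarrow> complex) \<Rightarrow> real" where
  "sqnorm n \<equiv> norm2_sq (lebesgue_n n)"

definition hermite_coeff :: "nat \<Rightarrow> ((nat \<Rightarrow> real) \<Rightarrow> complex) \<Rightarrow> (nat \<Rightarrow> nat) \<Rightarrow> complex" where
  "hermite_coeff n f \<alpha> = (\<integral>x. f x * hermite_fun n \<alpha> x \<partial>lebesgue_n n)"

lemma square_integrable_hermite_fun: "hermite_fun n \<alpha> \<in> L2 n"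
  using integrable_hermite_function_n_mult[of n \<alpha> \<alpha>]
  by (auto simp: square_integrable_def power2_eq_square)

lemma hermite_coeff_add:
  assumes "f \<in> L2 n" "g \<in> L2 n"
  shows "hermite_coeff n (\<lambda>x. f x + g x) \<alpha> = hermite_coeff n f \<alpha> + hermite_coeff n g \<alpha>"
  unfolding hermite_coeff_def
  using square_integrable_mult_integrable[OF assms(1) square_integrable_hermite_fun]
    square_integrable_mult_integrable[OF assms(2) square_integrable_hermite_fun]
  by (simp add: distrib_right)

lemma hermite_coeff_cmult: "hermite_coeff n (\<lambda>x. c * f x) \<alpha> = c * hermite_coeff n f \<alpha>"
  unfolding hermite_coeff_def by (simp add: mult.assoc)

lemma hermite_coeff_diff:
  assumes "f \<in> L2 n" "g \<in> L2 n"
  shows "hermite_coeff n (\<lambda>x. f x - g x) \<alpha> = hermite_coeff n f \<alpha> - hermite_coeff n g \<alpha>"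
  using hermite_coeff_add[OF assms(1) square_integrable_cmult(1)[OF assms(2), of "-1"], of \<alpha>]
    hermite_coeff_cmult[of n "-1" g \<alpha>] by simp

lemma hermite_coeff_hermite_fun:
  assumes "\<alpha> \<in> {..<n} \<rightarrow>\<^sub>E UNIV" "\<beta> \<in> {..<n} \<rightarrow>\<^sub>E UNIV"
  shows "hermite_coeff n (hermite_fun n \<beta>) \<alpha> = (if \<alpha> = \<beta> then 1 else 0)"
proof -
  have "hermite_coeff n (hermite_fun n \<beta>) \<alpha>
    = of_real (\<integral>x. hermite_function_n n \<beta> x * hermite_function_n n \<alpha> x \<partial>lebesgue_n n)"
    unfolding hermite_coeff_def by (simp flip: integral_complex_of_real)
  then show ?thesis using assms by (simp add: hermite_function_n_orthonormal)
qed

lemma square_integrable_hermite_sum: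
  "(\<lambda>x. \<Sum>\<alpha>\<in>S. c \<alpha> * hermite_fun n \<alpha> x) \<in> L2 n"
  by (intro square_integrable_sum square_integrable_cmult square_integrable_hermite_fun)

lemma hermite_coeff_hermite_sum:
  assumes "finite S" "S \<subseteq> {..<n} \<rightarrow>\<^sub>E UNIV" "\<alpha> \<in> {..<n} \<rightarrow>\<^sub>E UNIV"
  shows "hermite_coeff n (\<lambda>x. \<Sum>\<beta>\<in>S. c \<beta> * hermite_fun n \<beta> x) \<alpha> = (if \<alpha> \<in> S then c \<alpha> else 0)"
  using assms(1,2)
proof (induction S rule: finite_induct)
  case empty
  then show ?case by (simp add: hermite_coeff_def)
next
  case (insert \<beta> S)
  have "hermite_coeff n (\<lambda>x. \<Sum>\<beta>\<in>insert \<beta> S. c \<beta> * hermite_fun n \<beta> x) \<alpha>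
     = hermite_coeff n (\<lambda>x. c \<beta> * hermite_fun n \<beta> x + (\<Sum>\<beta>\<in>S. c \<beta> * hermite_fun n \<beta> x)) \<alpha>"
    using insert.hyps by simp
  also have "\<dots> = c \<beta> * hermite_coeff n (hermite_fun n \<beta>) \<alpha> + (if \<alpha> \<in> S then c \<alpha> else 0)"
    using insert
    by (subst hermite_coeff_add)
       (auto intro: square_integrable_cmult square_integrable_hermite_fun square_integrable_hermite_sum
          simp: hermite_coeff_cmult)
  finally show ?case
    using insert assms(3) by (auto simp: hermite_coeff_hermite_fun)
qed

lemma norm2_sq_orthogonal_add:
  assumes "f \<in> square_integrable M" "g \<in> square_integrable M" "(\<integral>x. f x * cnj (g x) \<partial>M) = 0"
  shows "norm2_sq M (\<lambda>x. f x + g x) = norm2_sq M f + norm2_sq M g"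
proof -
  have g': "(\<lambda>x. cnj (g x)) \<in> square_integrable M"
    using assms(2) measurable_compose[OF _ borel_measurable_continuous_onI[OF continuous_on_cnj[OF continuous_on_id]]]
    by (auto simp: square_integrable_def)
  have int: "integrable M (\<lambda>x. f x * cnj (g x))"
    by (rule square_integrable_mult_integrable[OF assms(1) g'])
  have "(norm (a + b))\<^sup>2 = (norm a)\<^sup>2 + (norm b)\<^sup>2 + 2 * Re (a * cnj b)" for a b :: complex
    unfolding cmod_power2 by (simp add: power2_eq_square algebra_simps)
  then have "norm2_sq M (\<lambda>x. f x + g x) = (\<integral>x. (norm (f x))\<^sup>2 + (norm (g x))\<^sup>2 + 2 * Re (f x * cnj (g x)) \<partial>M)"
    by (simp only: norm2_sq_def)
  also have "\<dots> = norm2_sq M f + norm2_sq M g + 2 * (\<integral>x. Re (f x * cnj (g x)) \<partial>M)"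
    using assms(1,2) int integrable_Re[OF int]
    by (simp add: norm2_sq_def square_integrable_def del: times_complex.sel)
  also have "(\<integral>x. Re (f x * cnj (g x)) \<partial>M) = 0"
    using integral_Re[OF int] assms(3) by simp
  finally show ?thesis by simp
qed

lemma integral_mult_cnj_hermite_sum:
  assumes "f \<in> L2 n"
  shows "(\<integral>x. f x * cnj (\<Sum>\<alpha>\<in>S. c \<alpha> * hermite_fun n \<alpha> x) \<partial>lebesgue_n n) = (\<Sum>\<alpha>\<in>S. cnj (c \<alpha>) * hermite_coeff n f \<alpha>)"
proof -
  have "f x * cnj (\<Sum>\<alpha>\<in>S. c \<alpha> * hermite_fun n \<alpha> x) = (\<Sum>\<alpha>\<in>S. cnj (c \<alpha>) * (f x * hermite_fun n \<alpha> x))" for x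
    by (simp add: sum_distrib_left mult_ac)
  then show ?thesis
    using square_integrable_mult_integrable[OF assms square_integrable_hermite_fun]
    unfolding hermite_coeff_def by simp
qed

text \<open>Bessel's inequality: the residual is orthogonal to the partial sum.\<close>

lemma bessel_residual_norm_le:
  assumes f: "f \<in> L2 n" and S: "finite S" "S \<subseteq> {..<n} \<rightarrow>\<^sub>E UNIV"
  shows "sqnorm n (\<lambda>x. f x - (\<Sum>\<alpha>\<in>S. hermite_coeff n f \<alpha> * hermite_fun n \<alpha> x)) \<le> sqnorm n f"
proof -
  let ?g = "\<lambda>x. \<Sum>\<alpha>\<in>S. hermite_coeff n f \<alpha> * hermite_fun n \<alpha> x"
  let ?r = "\<lambda>x. f x - ?g x"
  have g: "?g \<in> L2 n" by (rule square_integrable_hermite_sum)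
  have r: "?r \<in> L2 n" using f g by (rule square_integrable_diff)
  have "hermite_coeff n ?r \<alpha> = 0" if "\<alpha> \<in> S" for \<alpha>
    using hermite_coeff_diff[OF f g, of \<alpha>] hermite_coeff_hermite_sum[OF S, of \<alpha>] that S by auto
  then have "(\<integral>x. ?r x * cnj (?g x) \<partial>lebesgue_n n) = 0"
    unfolding integral_mult_cnj_hermite_sum[OF r] by simp
  from norm2_sq_orthogonal_add[OF r g this]
  have "sqnorm n f = sqnorm n ?r + sqnorm n ?g" by simp
  then show ?thesis using norm2_sq_nonneg[of "lebesgue_n n" ?g] by linarith
qed

lemma multi_indices_subset: "multi_indices n m \<subseteq> {..<n} \<rightarrow>\<^sub>E UNIV"
  by (auto simp: multi_indices_def)

text \<open>Elements of the eigenspace are determined, even pointwise, by their Hermite coefficients; hence the uniqueness.\<close>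

lemma hermite_projection_eq:
  assumes f: "f \<in> L2 n"
  shows "hermite_projection n m f = (\<lambda>x. \<Sum>\<alpha>\<in>multi_indices n m. hermite_coeff n f \<alpha> * hermite_fun n \<alpha> x)"
  unfolding hermite_projection_def
proof (rule the_equality, safe)
  let ?S = "multi_indices n m"
  note S = finite_multi_indices[of n m] multi_indices_subset[of n m]
  show "(\<lambda>x. \<Sum>\<alpha>\<in>?S. hermite_coeff n f \<alpha> * hermite_fun n \<alpha> x) \<in> hermite_eigenspace n m"
    unfolding hermite_eigenspace_def by blast
  fix h assume "h \<in> hermite_eigenspace n m"
  then obtain c where h: "h = (\<lambda>x. \<Sum>\<alpha>\<in>?S. c \<alpha> * hermite_fun n \<alpha> x)" by (auto simp: hermite_eigenspace_def)
  have "hermite_coeff n (\<lambda>x. f x - (\<Sum>\<alpha>\<in>?S. hermite_coeff n f \<alpha> * hermite_fun n \<alpha> x)) \<alpha> = 0" if "\<alpha> \<in> ?S" for \<alpha>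
    using hermite_coeff_diff[OF f square_integrable_hermite_sum] hermite_coeff_hermite_sum[OF S, of \<alpha>] that S by auto
  then show "(\<integral>x. (f x - (\<Sum>\<alpha>\<in>?S. hermite_coeff n f \<alpha> * hermite_fun n \<alpha> x)) * cnj (h x) \<partial>lebesgue_n n) = 0"
    unfolding h using f
    by (subst integral_mult_cnj_hermite_sum) (auto intro!: square_integrable_diff square_integrable_hermite_sum)
next
  let ?S = "multi_indices n m"
  note S = finite_multi_indices[of n m] multi_indices_subset[of n m]
  fix g assume "g \<in> hermite_eigenspace n m"
    and orth: "\<forall>h\<in>hermite_eigenspace n m. (\<integral>x. (f x - g x) * cnj (h x) \<partial>lebesgue_n n) = 0"
  then obtain c where g: "g = (\<lambda>x. \<Sum>\<alpha>\<in>?S. c \<alpha> * hermite_fun n \<alpha> x)" by (auto simp: hermite_eigenspace_def)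
  have g2: "g \<in> L2 n" unfolding g by (rule square_integrable_hermite_sum)
  have "c \<alpha> = hermite_coeff n f \<alpha>" if \<alpha>: "\<alpha> \<in> ?S" for \<alpha>
  proof -
    have "hermite_fun n \<alpha> \<in> hermite_eigenspace n m"
      unfolding hermite_eigenspace_def
    proof (intro CollectI exI[of _ "\<lambda>\<beta>. if \<beta> = \<alpha> then 1 else 0"] conjI TrueI ext)
      fix x
      have "(\<Sum>\<beta>\<in>?S. (if \<beta> = \<alpha> then 1 else 0) * hermite_fun n \<beta> x) = (\<Sum>\<beta>\<in>?S. if \<beta> = \<alpha> then hermite_fun n \<beta> x else 0)"
        by (intro sum.cong) auto
      then show "hermite_fun n \<alpha> x = (\<Sum>\<beta>\<in>?S. (if \<beta> = \<alpha> then 1 else 0) * hermite_fun n \<beta> x)"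
        using \<alpha> S by simp
    qed
    with orth have "hermite_coeff n (\<lambda>x. f x - g x) \<alpha> = 0"
      unfolding hermite_coeff_def by fastforce
    then have "hermite_coeff n f \<alpha> = hermite_coeff n g \<alpha>"
      using hermite_coeff_diff[OF f g2] by simp
    also have "\<dots> = c \<alpha>" unfolding g using hermite_coeff_hermite_sum[OF S, of \<alpha> c] \<alpha> S by auto
    finally show ?thesis by simp
  qed
  then show "g = (\<lambda>x. \<Sum>\<alpha>\<in>?S. hermite_coeff n f \<alpha> * hermite_fun n \<alpha> x)"
    unfolding g by simp
qed

section \<open>Completeness of the Hermite functions\<close>

text \<open>Generated inductively, so that linear properties of its elements follow by induction without handling index sets.\<close>

inductive_set hermite_span :: "nat \<Rightarrow> ((nat \<Rightarrow> real) \<Rightarrow> complex) set" for n where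
  zero: "(\<lambda>x. 0) \<in> hermite_span n"
| basis: "\<alpha> \<in> {..<n} \<rightarrow>\<^sub>E UNIV \<Longrightarrow> hermite_fun n \<alpha> \<in> hermite_span n"
| add: "f \<in> hermite_span n \<Longrightarrow> g \<in> hermite_span n \<Longrightarrow> (\<lambda>x. f x + g x) \<in> hermite_span n"
| scale: "f \<in> hermite_span n \<Longrightarrow> (\<lambda>x. c * f x) \<in> hermite_span n"

lemma square_integrable_hermite_span:
  "f \<in> hermite_span n \<Longrightarrow> f \<in> L2 n"
  by (induction rule: hermite_span.induct)
     (auto intro: square_integrable_0 square_integrable_hermite_fun square_integrable_add square_integrable_cmult)

lemma hermite_span_sum:
  "(\<And>i. i \<in> I \<Longrightarrow> f i \<in> hermite_span n) \<Longrightarrow> (\<lambda>x. \<Sum>i\<in>I. f i x) \<in> hermite_span n"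
  by (induction I rule: infinite_finite_induct) (auto intro: hermite_span.intros)

text \<open>Multiplication by a coordinate raises or lowers one index.\<close>

lemma hermite_span_coordinate:
  assumes "f \<in> hermite_span n" "i < n"
  shows "(\<lambda>x. of_real (x i - a) * f x) \<in> hermite_span n"
  using assms(1)
proof induction
  case (basis \<alpha>)
  have "of_real (x i - a) * hermite_fun n \<alpha> x = 
     (of_real (sqrt ((real (\<alpha> i) + 1) / 2)) * hermite_fun n (\<alpha>(i := Suc (\<alpha> i))) x
     + of_real (sqrt (real (\<alpha> i) / 2)) * hermite_fun n (\<alpha>(i := \<alpha> i - 1)) x) + (- of_real a) * hermite_fun n \<alpha> x" for x
    unfolding of_real_mult [symmetric] of_real_add [symmetric] hermite_function_n_recurrence[OF assms(2), symmetric]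
    by (simp add: algebra_simps)
  moreover have "\<alpha>(i := k) \<in> {..<n} \<rightarrow>\<^sub>E UNIV" for k
    using basis assms(2) by (auto simp: PiE_def extensional_def)
  ultimately show ?case
    using basis by (simp only:) (intro hermite_span.intros; assumption)
next
  case (add f g)
  have "of_real (x i - a) * (f x + g x) = of_real (x i - a) * f x + of_real (x i - a) * g x" for x
    by (rule distrib_left)
  then show ?case using hermite_span.add[OF add.IH] by simp
next
  case (scale f c)
  have eq: "of_real (x i - a) * (c * f x) = c * (of_real (x i - a) * f x)" for x by simp
  show ?case unfolding eq by (rule hermite_span.scale[OF scale.IH])
qed (auto intro: hermite_span.zero)

lemma hermite_span_coordinate_power:
  assumes "f \<in> hermite_span n" "i < n"
  shows "(\<lambda>x. of_real ((x i - a) ^ k) * f x) \<in> hermite_span n"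
proof (induction k)
  case (Suc k)
  show ?case using hermite_span_coordinate[OF Suc assms(2), of a] by (simp add: mult_ac)
qed (use assms in simp)

lemma sum_hermite_projection:
  assumes "f \<in> L2 n"
  shows "(\<Sum>m<N. hermite_projection n m f x)
     = (\<Sum>\<alpha>\<in>(\<Union>m<N. multi_indices n m). hermite_coeff n f \<alpha> * hermite_fun n \<alpha> x)"
proof -
  have "multi_indices n m \<inter> multi_indices n k = {}" if "m \<noteq> k" for m k
    using that unfolding multi_indices_def by blast
  then have "(\<Sum>\<alpha>\<in>(\<Union>m<N. multi_indices n m). hermite_coeff n f \<alpha> * hermite_fun n \<alpha> x)
     = (\<Sum>m<N. \<Sum>\<alpha>\<in>multi_indices n m. hermite_coeff n f \<alpha> * hermite_fun n \<alpha> x)"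
    by (intro sum.UNION_disjoint ballI impI finite_multi_indices finite_lessThan) auto
  then show ?thesis by (simp only: hermite_projection_eq[OF assms])
qed

definition hermite_residual :: "nat \<Rightarrow> nat \<Rightarrow> ((nat \<Rightarrow> real) \<Rightarrow> complex) \<Rightarrow> (nat \<Rightarrow> real) \<Rightarrow> complex" where
  "hermite_residual n N f x = f x - (\<Sum>m<N. hermite_projection n m f x)"

lemma hermite_residual_eq:
  assumes "f \<in> L2 n"
  shows "hermite_residual n N f = (\<lambda>x. f x - (\<Sum>\<alpha>\<in>(\<Union>m<N. multi_indices n m). hermite_coeff n f \<alpha> * hermite_fun n \<alpha> x))"
  unfolding hermite_residual_def[abs_def] sum_hermite_projection[OF assms] ..

lemma hermite_residual_L2: "f \<in> L2 n \<Longrightarrow> hermite_residual n N f \<in> L2 n"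
  by (simp only: hermite_residual_eq) (intro square_integrable_diff square_integrable_hermite_sum)

lemma hermite_residual_norm_le: "f \<in> L2 n \<Longrightarrow> sqnorm n (hermite_residual n N f) \<le> sqnorm n f"
  using multi_indices_subset
  by (simp only: hermite_residual_eq) (intro bessel_residual_norm_le, auto intro: finite_multi_indices)

lemma hermite_residual_add:
  assumes "f \<in> L2 n" "g \<in> L2 n"
  shows "hermite_residual n N (\<lambda>x. f x + g x) = (\<lambda>x. hermite_residual n N f x + hermite_residual n N g x)"
  using assms
  by (simp add: hermite_residual_eq square_integrable_add hermite_coeff_add distrib_right sum.distrib fun_eq_iff)

lemma hermite_residual_cmult:
  assumes "f \<in> L2 n"
  shows "hermite_residual n N (\<lambda>x. c * f x) = (\<lambda>x. c * hermite_residual n N f x)"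
  using assms
  by (simp add: hermite_residual_eq square_integrable_cmult hermite_coeff_cmult right_diff_distrib sum_distrib_left mult.assoc)

lemma hermite_residual_span:
  assumes "g \<in> hermite_span n"
  shows "\<forall>\<^sub>F N in sequentially. hermite_residual n N g = (\<lambda>x. 0)"
  using assms
proof induction
  case zero
  show ?case by (simp add: hermite_residual_eq[OF square_integrable_0] hermite_coeff_def)
next
  case (basis \<alpha>)
  have "hermite_residual n N (hermite_fun n \<alpha>) = (\<lambda>x. 0)" if N: "(\<Sum>i<n. \<alpha> i) < N" for N
  proof
    fix x
    let ?S = "\<Union>m<N. multi_indices n m"
    have "(\<Sum>\<beta>\<in>?S. hermite_coeff n (hermite_fun n \<alpha>) \<beta> * hermite_fun n \<beta> x) = (\<Sum>\<beta>\<in>?S. if \<beta> = \<alpha> then hermite_fun n \<alpha> x else 0)"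
    proof (intro sum.cong refl)
      fix \<beta> assume "\<beta> \<in> ?S"
      then have "\<beta> \<in> {..<n} \<rightarrow>\<^sub>E UNIV" using multi_indices_subset by blast
      then show "hermite_coeff n (hermite_fun n \<alpha>) \<beta> * hermite_fun n \<beta> x = (if \<beta> = \<alpha> then hermite_fun n \<alpha> x else 0)"
        using basis by (simp add: hermite_coeff_hermite_fun)
    qed
    also have "\<dots> = hermite_fun n \<alpha> x"
    proof -
      have "finite ?S" by (intro finite_UN_I finite_multi_indices finite_lessThan)
      moreover have "\<alpha> \<in> ?S" using N basis unfolding multi_indices_def by blast
      ultimately show ?thesis by simp
    qed
    finally show "hermite_residual n N (hermite_fun n \<alpha>) x = 0"
      by (simp add: hermite_residual_eq[OF square_integrable_hermite_fun])
  qed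
  then show ?case by (intro eventually_sequentiallyI[of "Suc (\<Sum>i<n. \<alpha> i)"]) simp
next
  case (add f g)
  note eq = hermite_residual_add[OF add.hyps[THEN square_integrable_hermite_span]]
  from add.IH show ?case unfolding eq by eventually_elim simp
next
  case (scale f c)
  note eq = hermite_residual_cmult[OF scale.hyps[THEN square_integrable_hermite_span]]
  from scale.IH show ?case unfolding eq by eventually_elim simp
qed

text \<open>The functions that are the \<open>L\<^sup>2\<close> limit of their Hermite series; by Bessel's inequality this is a closed subspace.\<close>

definition hermite_closure :: "nat \<Rightarrow> ((nat \<Rightarrow> real) \<Rightarrow> complex) set" where
  "hermite_closure n = {f \<in> L2 n. (\<lambda>N. sqnorm n (hermite_residual n N f)) \<longlonglongrightarrow> 0}"

lemma hermite_closureD: "f \<in> hermite_closure n \<Longrightarrow> f \<in> L2 n"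
  by (simp add: hermite_closure_def)

lemma hermite_span_closure: "f \<in> hermite_span n \<Longrightarrow> f \<in> hermite_closure n"
  unfolding hermite_closure_def
  by (auto intro!: tendsto_eventually eventually_mono[OF hermite_residual_span] square_integrable_hermite_span
      simp: norm2_sq_def)

lemma hermite_closure_scale:
  assumes f: "f \<in> hermite_closure n"
  shows "(\<lambda>x. c * f x) \<in> hermite_closure n"
proof -
  note f2 = hermite_closureD[OF f]
  have "(\<lambda>N. (norm c)\<^sup>2 * sqnorm n (hermite_residual n N f)) \<longlonglongrightarrow> (norm c)\<^sup>2 * 0"
    using f unfolding hermite_closure_def by (intro tendsto_intros) simp
  then show ?thesis
    using f2 by (simp add: hermite_closure_def hermite_residual_cmult square_integrable_cmult hermite_residual_L2)
qed

lemma hermite_closure_add: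
  assumes f: "f \<in> hermite_closure n" and g: "g \<in> hermite_closure n"
  shows "(\<lambda>x. f x + g x) \<in> hermite_closure n"
  unfolding hermite_closure_def
proof (intro CollectI conjI)
  note f2 = hermite_closureD[OF f] and g2 = hermite_closureD[OF g]
  show "(\<lambda>x. f x + g x) \<in> L2 n" by (rule square_integrable_add[OF f2 g2])
  have "(\<lambda>N. 2 * sqnorm n (hermite_residual n N f) + 2 * sqnorm n (hermite_residual n N g)) \<longlonglongrightarrow> 2 * 0 + 2 * 0"
    using f g unfolding hermite_closure_def by (intro tendsto_intros) simp_all
  then have lim: "(\<lambda>N. 2 * sqnorm n (hermite_residual n N f) + 2 * sqnorm n (hermite_residual n N g)) \<longlonglongrightarrow> 0"
    by (simp only: mult_zero_right add_0_right)
  have le: "sqnorm n (hermite_residual n N (\<lambda>x. f x + g x)) \<le> 2 * sqnorm n (hermite_residual n N f) + 2 * sqnorm n (hermite_residual n N g)" for N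
    unfolding hermite_residual_add[OF f2 g2] by (intro square_integrable_add hermite_residual_L2 f2 g2)
  show "(\<lambda>N. sqnorm n (hermite_residual n N (\<lambda>x. f x + g x))) \<longlonglongrightarrow> 0"
    by (rule tendsto_sandwich[OF always_eventually[OF allI[OF norm2_sq_nonneg]] always_eventually[OF allI[OF le]]
          tendsto_const lim])
qed

lemma hermite_closure_span_approx:
  assumes f: "f \<in> hermite_closure n" and "\<epsilon> > 0"
  obtains g where "g \<in> hermite_span n" "sqnorm n (\<lambda>x. f x - g x) < \<epsilon>"
proof -
  have "(\<lambda>N. sqnorm n (hermite_residual n N f)) \<longlonglongrightarrow> 0" using f by (simp add: hermite_closure_def)
  from order_tendstoD(2)[OF this \<open>\<epsilon> > 0\<close>] obtain N where N: "sqnorm n (hermite_residual n N f) < \<epsilon>"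
    by (auto simp: eventually_sequentially)
  have "(\<lambda>x. \<Sum>\<alpha>\<in>(\<Union>m<N. multi_indices n m). hermite_coeff n f \<alpha> * hermite_fun n \<alpha> x) \<in> hermite_span n"
    using multi_indices_subset by (intro hermite_span_sum hermite_span.scale hermite_span.basis) blast
  then show ?thesis using N unfolding hermite_residual_eq[OF hermite_closureD[OF f]] by (rule that)
qed

text \<open>The residual of \<open>f\<close> differs from that of \<open>g\<close> by the residual of \<open>f - g\<close>, which Bessel's inequality makes small.\<close>

lemma hermite_closure_approx:
  assumes f: "f \<in> L2 n"
    and approx: "\<And>\<epsilon>. \<epsilon> > 0 \<Longrightarrow> \<exists>g\<in>hermite_closure n. sqnorm n (\<lambda>x. f x - g x) < \<epsilon>"
  shows "f \<in> hermite_closure n"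
proof -
  have small: "\<forall>\<^sub>F N in sequentially. sqnorm n (hermite_residual n N f) < \<epsilon>" if "\<epsilon> > 0" for \<epsilon>
  proof -
    have e: "\<epsilon> / 4 > 0" using that by simp
    obtain g where g: "g \<in> hermite_closure n" "sqnorm n (\<lambda>x. f x - g x) < \<epsilon> / 4" using approx[OF e] by blast
    note g2 = hermite_closureD[OF g(1)]
    have d: "(\<lambda>x. f x - g x) \<in> L2 n" using f g2 by (rule square_integrable_diff)
    have "(\<lambda>N. sqnorm n (hermite_residual n N g)) \<longlonglongrightarrow> 0" using g(1) by (simp add: hermite_closure_def)
    from order_tendstoD(2)[OF this e] show ?thesis
    proof eventually_elim
      case (elim N)
      have "sqnorm n (hermite_residual n N (\<lambda>x. (f x - g x) + g x))
        \<le> 2 * sqnorm n (hermite_residual n N (\<lambda>x. f x - g x)) + 2 * sqnorm n (hermite_residual n N g)"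
        unfolding hermite_residual_add[OF d g2] by (intro square_integrable_add hermite_residual_L2 d g2)
      then show ?case using hermite_residual_norm_le[OF d, of N] g(2) elim by simp
    qed
  qed
  have "(\<lambda>N. sqnorm n (hermite_residual n N f)) \<longlonglongrightarrow> 0"
    by (rule order_tendstoI[OF always_eventually small]) (simp add: less_le_trans[OF _ norm2_sq_nonneg])
  then show ?thesis using f by (simp add: hermite_closure_def)
qed

lemma hermite_closure_dominated:
  assumes "\<And>k. f k \<in> hermite_closure n" "g \<in> borel_measurable (lebesgue_n n)"
    "integrable (lebesgue_n n) (\<lambda>x. (w x :: real)\<^sup>2)"
    "\<And>k x. x \<in> space (lebesgue_n n) \<Longrightarrow> norm (f k x) \<le> w x"
    "\<And>x. x \<in> space (lebesgue_n n) \<Longrightarrow> (\<lambda>k. f k x) \<longlonglongrightarrow> g x"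
  shows "g \<in> hermite_closure n"
proof (rule hermite_closure_approx)
  note lim = norm2_sq_dominated_convergence[OF square_integrable_measurable[OF hermite_closureD[OF assms(1)]] assms(2-5)]
  show "g \<in> L2 n" by (rule lim(2))
  fix \<epsilon> :: real assume "\<epsilon> > 0"
  from order_tendstoD(2)[OF lim(1) this] obtain k where "sqnorm n (\<lambda>x. g x - f k x) < \<epsilon>"
    by (auto simp: eventually_sequentially)
  then show "\<exists>h\<in>hermite_closure n. sqnorm n (\<lambda>x. g x - h x) < \<epsilon>"
    using assms(1) by blast
qed

text \<open>The bounded functions that map the closed subspace into itself.  Products and bounded limits keep this property,
  and so it passes from a few smooth functions to indicators.\<close>

definition closure_multiplier :: "nat \<Rightarrow> ((nat \<Rightarrow> real) \<Rightarrow> real) \<Rightarrow> bool" where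
  "closure_multiplier n u \<longleftrightarrow> u \<in> borel_measurable (lebesgue_n n) \<and>
     (\<exists>B. \<forall>x\<in>space (lebesgue_n n). \<bar>u x\<bar> \<le> B) \<and>
     (\<forall>f\<in>hermite_closure n. (\<lambda>x. of_real (u x) * f x) \<in> hermite_closure n)"

lemma multiplierD:
  assumes "closure_multiplier n u"
  shows "u \<in> borel_measurable (lebesgue_n n)" "f \<in> hermite_closure n \<Longrightarrow> (\<lambda>x. of_real (u x) * f x) \<in> hermite_closure n"
  using assms by (auto simp: closure_multiplier_def)

lemma multiplier_const: "closure_multiplier n (\<lambda>x. c)"
  unfolding closure_multiplier_def by (auto intro: hermite_closure_scale)

lemma multiplier_add:
  assumes "closure_multiplier n u" "closure_multiplier n v"
  shows "closure_multiplier n (\<lambda>x. u x + v x)"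
proof -
  obtain B C where "\<And>x. x\<in>space (lebesgue_n n) \<Longrightarrow> \<bar>u x\<bar> \<le> B" "\<And>x. x\<in>space (lebesgue_n n) \<Longrightarrow> \<bar>v x\<bar> \<le> C"
    using assms unfolding closure_multiplier_def by blast
  then have "\<bar>u x + v x\<bar> \<le> B + C" if "x \<in> space (lebesgue_n n)" for x
    using that by (intro order_trans[OF abs_triangle_ineq] add_mono) auto
  then show ?thesis
    using assms unfolding closure_multiplier_def
    by (auto simp: distrib_right intro: hermite_closure_add)
qed

lemma multiplier_mult:
  assumes "closure_multiplier n u" "closure_multiplier n v"
  shows "closure_multiplier n (\<lambda>x. u x * v x)"
proof -
  obtain B C where "\<And>x. x\<in>space (lebesgue_n n) \<Longrightarrow> \<bar>u x\<bar> \<le> B" "\<And>x. x\<in>space (lebesgue_n n) \<Longrightarrow> \<bar>v x\<bar> \<le> C"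
    using assms unfolding closure_multiplier_def by blast
  then have "\<bar>u x * v x\<bar> \<le> B * C" if "x \<in> space (lebesgue_n n)" for x
    using that unfolding abs_mult by (intro mult_mono) (auto intro: order_trans[OF abs_ge_zero])
  then show ?thesis
    using assms unfolding closure_multiplier_def by (auto simp: mult.assoc)
qed

lemma multiplier_diff:
  assumes "closure_multiplier n u" "closure_multiplier n v"
  shows "closure_multiplier n (\<lambda>x. u x - v x)"
  using multiplier_add[OF assms(1) multiplier_mult[OF multiplier_const[of n "-1"] assms(2)]] by simp

lemma multiplier_power:
  "closure_multiplier n u \<Longrightarrow> closure_multiplier n (\<lambda>x. u x ^ k)"
  by (induction k) (auto intro: multiplier_const multiplier_mult)

lemma multiplier_sum:
  "(\<And>i. i \<in> I \<Longrightarrow> closure_multiplier n (u i)) \<Longrightarrow> closure_multiplier n (\<lambda>x. \<Sum>i\<in>I. u i x)"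
  by (induction I rule: infinite_finite_induct) (auto intro: multiplier_const multiplier_add)

lemma multiplier_bounded_limit:
  assumes u: "\<And>k. closure_multiplier n (u k)"
    and B: "\<And>k x. x \<in> space (lebesgue_n n) \<Longrightarrow> \<bar>u k x\<bar> \<le> B"
    and lim: "\<And>x. x \<in> space (lebesgue_n n) \<Longrightarrow> (\<lambda>k. u k x) \<longlonglongrightarrow> v x"
  shows "closure_multiplier n v"
  unfolding closure_multiplier_def
proof (intro conjI ballI)
  show v: "v \<in> borel_measurable (lebesgue_n n)"
    by (rule borel_measurable_LIMSEQ_real[OF lim multiplierD(1)[OF u]])
  show "\<exists>B. \<forall>x\<in>space (lebesgue_n n). \<bar>v x\<bar> \<le> B"
  proof (intro exI ballI)
    fix x assume x: "x \<in> space (lebesgue_n n)"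
    show "\<bar>v x\<bar> \<le> B" using B[OF x] by (intro LIMSEQ_le_const2[OF tendsto_rabs[OF lim[OF x]]]) auto
  qed
  fix f assume f: "f \<in> hermite_closure n"
  show "(\<lambda>x. of_real (v x) * f x) \<in> hermite_closure n"
  proof (rule hermite_closure_dominated)
    show "(\<lambda>x. of_real (u k x) * f x) \<in> hermite_closure n" for k
      by (rule multiplierD(2)[OF u f])
    show "(\<lambda>x. of_real (v x) * f x) \<in> borel_measurable (lebesgue_n n)"
      using v square_integrable_measurable[OF hermite_closureD[OF f]] by simp
    show "integrable (lebesgue_n n) (\<lambda>x. (B * norm (f x))\<^sup>2)"
      using hermite_closureD[OF f] by (simp add: power_mult_distrib square_integrable_def)
    show "norm (of_real (u k x) * f x) \<le> B * norm (f x)" if "x \<in> space (lebesgue_n n)" for k x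
      using B[OF that] by (simp add: norm_mult mult_right_mono)
    show "(\<lambda>k. of_real (u k x) * f x) \<longlonglongrightarrow> of_real (v x) * f x" if "x \<in> space (lebesgue_n n)" for x
      by (intro tendsto_intros lim[OF that])
  qed
qed

text \<open>Partial sums of the exponential series stay in the span.  They are dominated by \<open>exp (s (x\<^sub>i - a)\<^sup>2) \<bar>h\<^sub>\<alpha>\<bar>\<close>, which is
  square integrable as long as \<open>s\<close> is small compared to the decay of the Hermite functions.\<close>

lemma hermite_closure_exp_basis:
  assumes \<alpha>: "\<alpha> \<in> {..<n} \<rightarrow>\<^sub>E UNIV" and i: "i < n" and s: "0 \<le> s" "s \<le> 1/16"
  shows "(\<lambda>x. of_real (exp (- (s * (x i - a)\<^sup>2))) * hermite_fun n \<alpha> x) \<in> hermite_closure n"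
proof (rule hermite_closure_dominated)
  let ?M = "lebesgue_n n"
  let ?S = "\<lambda>k x. \<Sum>j<k. (- (s * (x i - a)\<^sup>2)) ^ j / fact j :: real"
  note measurable_coordinate[OF i, measurable]
  show "(\<lambda>x. of_real (?S k x) * hermite_fun n \<alpha> x) \<in> hermite_closure n" for k
  proof -
    have "of_real (?S k x) * hermite_fun n \<alpha> x
      = (\<Sum>j<k. of_real ((- s) ^ j / fact j) * (of_real ((x i - a) ^ (2 * j)) * hermite_fun n \<alpha> x))" for x
    proof -
      have "(- (s * (x i - a)\<^sup>2)) ^ j / fact j = ((- s) ^ j / fact j) * (x i - a) ^ (2 * j)" for j
        unfolding minus_mult_left power_mult_distrib power_mult by simp
      then show ?thesis by (simp only: of_real_sum sum_distrib_right of_real_mult mult.assoc)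
    qed
    then show ?thesis
      by (simp only:) (intro hermite_span_closure hermite_span_sum hermite_span.scale
          hermite_span_coordinate_power hermite_span.basis \<alpha> i)
  qed
  show "norm (of_real (?S k x) * hermite_fun n \<alpha> x) \<le> exp (s * (x i - a)\<^sup>2) * \<bar>hermite_function_n n \<alpha> x\<bar>" for k x
  proof -
    have "\<bar>?S k x\<bar> \<le> (\<Sum>j<k. (s * (x i - a)\<^sup>2) ^ j / fact j)"
      using s by (intro order_trans[OF sum_abs] sum_mono) (simp add: power_abs abs_mult)
    also have "\<dots> \<le> exp (s * (x i - a)\<^sup>2)"
    proof -
      have "summable (\<lambda>j. (s * (x i - a)\<^sup>2) ^ j / fact j)"
        using summable_exp_generic[of "s * (x i - a)\<^sup>2"] by (simp add: field_simps)
      from sum_le_suminf[OF this, of "{..<k}"] show ?thesis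
        using s by (simp add: exp_def field_simps)
    qed
    finally show ?thesis unfolding norm_mult norm_of_real by (intro mult_right_mono) auto
  qed
  show "(\<lambda>k. of_real (?S k x) * hermite_fun n \<alpha> x) \<longlonglongrightarrow> of_real (exp (- (s * (x i - a)\<^sup>2))) * hermite_fun n \<alpha> x" for x
  proof -
    have "(\<lambda>j. (- (s * (x i - a)\<^sup>2)) ^ j / fact j) sums exp (- (s * (x i - a)\<^sup>2))"
      using exp_converges[of "- (s * (x i - a)\<^sup>2)"] by (simp add: field_simps)
    then show ?thesis unfolding sums_def by (intro tendsto_intros)
  qed
  show "integrable ?M (\<lambda>x. (exp (s * (x i - a)\<^sup>2) * \<bar>hermite_function_n n \<alpha> x\<bar>)\<^sup>2)"
  proof -
    define e where "e = (\<lambda>j z. if j = i then (exp (s * (z - a)\<^sup>2))\<^sup>2 else (1::real))"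
    have "integrable lborel (\<lambda>z. e j z * (hermite_function (\<alpha> j) z)\<^sup>2)" for j
    proof (cases "j = i")
      case True
      obtain C where C: "\<And>z. \<bar>hermite_function (\<alpha> j) z\<bar> \<le> C * exp (- (z\<^sup>2 / 4))"
        using gaussian_dominated_hermite_function by (auto simp: gaussian_dominated_def)
      have "norm (e j z * (hermite_function (\<alpha> j) z)\<^sup>2) \<le> C\<^sup>2 * exp (4 * s * a\<^sup>2) * exp (- (z\<^sup>2 / 4))" for z
      proof -
        have sq: "2 * s * (z - a)\<^sup>2 \<le> z\<^sup>2 / 4 + 4 * s * a\<^sup>2"
        proof -
          have "(z - a)\<^sup>2 \<le> 2 * z\<^sup>2 + 2 * a\<^sup>2"
            using norm_add_sq_le[of z "- a"] by simp
          then have "2 * s * (z - a)\<^sup>2 \<le> 2 * s * (2 * z\<^sup>2 + 2 * a\<^sup>2)" using s by (intro mult_left_mono) auto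
          also have "\<dots> = 4 * s * z\<^sup>2 + 4 * s * a\<^sup>2" by (simp add: algebra_simps)
          also have "4 * s * z\<^sup>2 \<le> (1/4) * z\<^sup>2" using s by (intro mult_right_mono) auto
          finally show ?thesis by simp
        qed
        have "norm (e j z * (hermite_function (\<alpha> j) z)\<^sup>2) = exp (2 * s * (z - a)\<^sup>2) * \<bar>hermite_function (\<alpha> j) z\<bar>\<^sup>2"
          using True by (simp add: e_def abs_mult exp_double [symmetric] mult.assoc)
        also have "\<dots> \<le> exp (z\<^sup>2 / 4 + 4 * s * a\<^sup>2) * (C * exp (- (z\<^sup>2 / 4)))\<^sup>2"
          by (intro mult_mono power_mono C) (simp_all add: sq)
        also have "\<dots> = C\<^sup>2 * exp (4 * s * a\<^sup>2) * exp (z\<^sup>2 / 4 + 2 * (- (z\<^sup>2 / 4)))"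
          unfolding power_mult_distrib exp_double [symmetric] exp_add by (simp only: mult_ac)
        also have "z\<^sup>2 / 4 + 2 * (- (z\<^sup>2 / 4)) = - (z\<^sup>2 / 4)" by simp
        finally show ?thesis .
      qed
      then have "gaussian_dominated (\<lambda>z. e j z * (hermite_function (\<alpha> j) z)\<^sup>2)"
        by (auto simp: gaussian_dominated_def)
      then show ?thesis by (intro integrable_gaussian_dominated) (simp_all add: e_def)
    next
      case False
      then show ?thesis using integrable_hermite_function_mult[of "\<alpha> j" "\<alpha> j"] by (simp add: e_def power2_eq_square)
    qed
    then have "integrable ?M (\<lambda>x. \<Prod>j<n. e j (x j) * (hermite_function (\<alpha> j) (x j))\<^sup>2)"
      by (intro integrable_prod_lebesgue_n)
    moreover have "(\<Prod>j<n. e j (x j) * (hermite_function (\<alpha> j) (x j))\<^sup>2)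
       = (exp (s * (x i - a)\<^sup>2) * \<bar>hermite_function_n n \<alpha> x\<bar>)\<^sup>2" for x
    proof -
      have "(\<Prod>j<n. e j (x j)) = (exp (s * (x i - a)\<^sup>2))\<^sup>2"
        unfolding e_def using i by (subst prod.delta) auto
      then show ?thesis
        unfolding prod.distrib power_mult_distrib power2_abs hermite_function_n_def prod_power_distrib by (rule arg_cong)
    qed
    ultimately show ?thesis by simp
  qed
  show "(\<lambda>x. of_real (exp (- (s * (x i - a)\<^sup>2))) * hermite_fun n \<alpha> x) \<in> borel_measurable ?M"
    by measurable
qed

lemma multiplier_exp_small:
  assumes i: "i < n" and s: "0 \<le> s" "s \<le> 1/16"
  shows "closure_multiplier n (\<lambda>x. exp (- (s * (x i - a)\<^sup>2)))"
  unfolding closure_multiplier_def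
proof (intro conjI ballI)
  let ?u = "\<lambda>x. exp (- (s * (x i - a)\<^sup>2))"
  note measurable_coordinate[OF i, measurable]
  show u: "?u \<in> borel_measurable (lebesgue_n n)" by measurable
  have u1: "\<bar>?u x\<bar> \<le> 1" for x using s by simp
  then show "\<exists>B. \<forall>x\<in>space (lebesgue_n n). \<bar>?u x\<bar> \<le> B" by blast
  have span: "(\<lambda>x. of_real (?u x) * g x) \<in> hermite_closure n" if "g \<in> hermite_span n" for g
    using that
  proof induction
    case (basis \<alpha>)
    then show ?case by (rule hermite_closure_exp_basis[OF _ i s])
  next
    case (add f g)
    then show ?case using hermite_closure_add[OF add.IH] by (simp add: distrib_left)
  next
    case (scale f c)
    then show ?case using hermite_closure_scale[OF scale.IH, of c] by (simp add: mult_ac)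
  qed (auto intro: hermite_span_closure hermite_span.zero)
  fix f assume f: "f \<in> hermite_closure n"
  show "(\<lambda>x. of_real (?u x) * f x) \<in> hermite_closure n"
  proof (rule hermite_closure_approx)
    show "(\<lambda>x. of_real (?u x) * f x) \<in> L2 n"
      using u u1 by (intro square_integrable_bounded_mult[where B = 1] hermite_closureD f)
    fix \<epsilon> :: real assume "\<epsilon> > 0"
    with f obtain g where g: "g \<in> hermite_span n" "sqnorm n (\<lambda>x. f x - g x) < \<epsilon>"
      by (rule hermite_closure_span_approx)
    have "sqnorm n (\<lambda>x. of_real (?u x) * (f x - g x)) \<le> 1\<^sup>2 * sqnorm n (\<lambda>x. f x - g x)"
      using u u1 hermite_closureD[OF f] square_integrable_hermite_span[OF g(1)]
      by (intro square_integrable_bounded_mult square_integrable_diff)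
    then have "sqnorm n (\<lambda>x. of_real (?u x) * f x - of_real (?u x) * g x) < \<epsilon>"
      using g(2) by (simp add: right_diff_distrib)
    then show "\<exists>h\<in>hermite_closure n. sqnorm n (\<lambda>x. of_real (?u x) * f x - h x) < \<epsilon>"
      using span[OF g(1)] by (intro bexI[of _ "\<lambda>x. of_real (?u x) * g x"])
  qed
qed

text \<open>A power of a Gaussian with small rate has an arbitrary rate.\<close>

lemma multiplier_exp:
  assumes i: "i < n" and s: "0 \<le> s"
  shows "closure_multiplier n (\<lambda>x. exp (- (s * (x i - a)\<^sup>2)))"
proof -
  obtain k :: nat where k: "16 * s + 1 \<le> real k" using real_arch_simple by blast
  have k0: "real k > 0" using k s by linarith
  have "s / real k \<le> 1/16" using k k0 s by (simp add: field_simps)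
  then have "closure_multiplier n (\<lambda>x. exp (- (s / real k * (x i - a)\<^sup>2)) ^ k)"
    using s by (intro multiplier_power multiplier_exp_small i) auto
  moreover have "exp (- (s / real k * (x i - a)\<^sup>2)) ^ k = exp (- (s * (x i - a)\<^sup>2))" for x
    using k0 by (simp flip: exp_of_nat_mult)
  ultimately show ?thesis by simp
qed

text \<open>The size of \<open>2\<^sup>k v\<^sup>k\<close> decides: Bernoulli's inequality applies below the threshold, \<open>1 - z \<le> exp (- z)\<close> from the
  threshold on.  At the threshold itself the exponent \<open>2\<^sup>k\<close> alone would give the limit \<open>1 / e\<close>; the additional factor \<open>k\<close> turns it into zero.\<close>

lemma threshold_tendsto:
  fixes v :: real
  assumes "0 \<le> v" "v \<le> 1"
  shows "(\<lambda>k. (1 - v ^ k) ^ (k * 2 ^ k)) \<longlonglongrightarrow> (if v < 1/2 then 1 else 0)"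
proof -
  have vk: "0 \<le> v ^ k" "v ^ k \<le> 1" for k using assms by (simp_all add: power_le_one)
  have upper: "(1 - v ^ k) ^ (k * 2 ^ k) \<le> 1" and lower: "0 \<le> (1 - v ^ k) ^ (k * 2 ^ k)" for k
    using vk[of k] by (simp_all add: power_le_one)
  have prod_eq: "real (k * 2 ^ k) * v ^ k = real k * (2 * v) ^ k" for k
    unfolding power_mult_distrib of_nat_mult of_nat_power by simp
  show ?thesis
  proof (cases "v < 1/2")
    case True
    have "(\<lambda>k. real k * (2 * v) ^ k) \<longlonglongrightarrow> 0"
      using assms True by (intro powser_times_n_limit_0) simp
    then have "(\<lambda>k. 1 - real k * (2 * v) ^ k) \<longlonglongrightarrow> 1 - 0"
      by (intro tendsto_diff tendsto_const)
    then have lim: "(\<lambda>k. 1 - real k * (2 * v) ^ k) \<longlonglongrightarrow> 1" by (simp only: diff_zero)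
    have bernoulli: "1 - real k * (2 * v) ^ k \<le> (1 - v ^ k) ^ (k * 2 ^ k)" for k
    proof -
      have "- 1 \<le> - (v ^ k)" using vk(2)[of k] by linarith
      then have "1 + real (k * 2 ^ k) * - (v ^ k) \<le> (1 + - (v ^ k)) ^ (k * 2 ^ k)"
        by (rule Bernoulli_inequality)
      then show ?thesis by (simp only: mult_minus_right prod_eq add_uminus_conv_diff)
    qed
    have "(\<lambda>k. (1 - v ^ k) ^ (k * 2 ^ k)) \<longlonglongrightarrow> 1"
      by (rule tendsto_sandwich[OF always_eventually[OF allI[OF bernoulli]] always_eventually[OF allI[OF upper]]
            lim tendsto_const])
    then show ?thesis using True by simp
  next
    case False
    have bound: "(1 - v ^ k) ^ (k * 2 ^ k) \<le> exp (- 1) ^ k" for k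
    proof -
      have "1 - v ^ k \<le> exp (- (v ^ k))" using exp_ge_add_one_self[of "- (v ^ k)"] by simp
      then have "(1 - v ^ k) ^ (k * 2 ^ k) \<le> exp (- (v ^ k)) ^ (k * 2 ^ k)"
        using vk[of k] by (intro power_mono) auto
      also have "\<dots> = exp (real (k * 2 ^ k) * - (v ^ k))"
        by (rule exp_of_nat_mult [symmetric])
      also have "\<dots> \<le> exp (real k * - 1)"
      proof -
        have "1 \<le> (2 * v) ^ k" using False by (intro one_le_power) simp
        then have "real k * 1 \<le> real k * (2 * v) ^ k" by (intro mult_left_mono) auto
        then show ?thesis unfolding mult_minus_right prod_eq exp_le_cancel_iff by linarith
      qed
      also have "\<dots> = exp (- 1) ^ k" by (rule exp_of_nat_mult)
      finally show ?thesis .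
    qed
    have lim: "(\<lambda>k. exp (- 1 :: real) ^ k) \<longlonglongrightarrow> 0"
      by (intro LIMSEQ_power_zero) simp
    have "(\<lambda>k. (1 - v ^ k) ^ (k * 2 ^ k)) \<longlonglongrightarrow> 0"
      by (rule tendsto_sandwich[OF always_eventually[OF allI[OF lower]] always_eventually[OF allI[OF bound]]
            tendsto_const lim])
    then show ?thesis using False by simp
  qed
qed

lemma multiplier_indicator_less_half:
  assumes "closure_multiplier n v" "\<And>x. 0 \<le> v x" "\<And>x. v x \<le> 1"
  shows "closure_multiplier n (indicator {x. v x < 1/2})"
proof (rule multiplier_bounded_limit[where u = "\<lambda>k x. (1 - v x ^ k) ^ (k * 2 ^ k)" and B = 1])
  show "closure_multiplier n (\<lambda>x. (1 - v x ^ k) ^ (k * 2 ^ k))" for k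
    by (intro multiplier_power multiplier_diff multiplier_const assms)
  show "\<bar>(1 - v x ^ k) ^ (k * 2 ^ k)\<bar> \<le> 1" for k x
    using assms(2,3)[of x] by (simp add: power_abs power_le_one)
  show "(\<lambda>k. (1 - v x ^ k) ^ (k * 2 ^ k)) \<longlonglongrightarrow> indicator {x. v x < 1/2} x" for x
    unfolding indicator_def of_bool_def mem_Collect_eq by (rule threshold_tendsto[OF assms(2,3)])
qed

lemma multiplier_indicator_compl:
  assumes "closure_multiplier n (indicator A)"
  shows "closure_multiplier n (indicator (- A))"
proof -
  have "(indicator (- A) :: _ \<Rightarrow> real) = (\<lambda>x. 1 - indicator A x)" by (auto simp: indicator_def)
  then show ?thesis using multiplier_diff[OF multiplier_const assms, of 1] by simp
qed

lemma multiplier_indicator_Int: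
  assumes "closure_multiplier n (indicator A)" "closure_multiplier n (indicator B)"
  shows "closure_multiplier n (indicator (A \<inter> B))"
proof -
  have "(indicator (A \<inter> B) :: _ \<Rightarrow> real) = (\<lambda>x. indicator A x * indicator B x)" by (auto simp: indicator_def)
  then show ?thesis using multiplier_mult[OF assms] by simp
qed

lemma multiplier_indicator_Un:
  assumes "closure_multiplier n (indicator A)" "closure_multiplier n (indicator B)"
  shows "closure_multiplier n (indicator (A \<union> B))"
  using multiplier_indicator_compl[OF multiplier_indicator_Int[OF multiplier_indicator_compl[OF assms(1)]
     multiplier_indicator_compl[OF assms(2)]]] by simp

lemma multiplier_indicator_UN:
  assumes "\<And>k::nat. closure_multiplier n (indicator (A k))"
  shows "closure_multiplier n (indicator (\<Union>k. A k))"
proof (rule multiplier_bounded_limit[where u = "\<lambda>k. indicator (\<Union>j<k. A j)" and B = 1])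
  show "closure_multiplier n (indicator (\<Union>j<k. A j))" for k
  proof (induction k)
    case 0
    then show ?case using multiplier_const[of n 0] by simp
  next
    case (Suc k)
    then show ?case using multiplier_indicator_Un[OF Suc assms[of k]] by (simp add: lessThan_Suc Un_commute)
  qed
  show "(\<lambda>k. indicator (\<Union>j<k. A j) x :: real) \<longlonglongrightarrow> indicator (\<Union>k. A k) x" for x
    by (rule LIMSEQ_indicator_UN)
qed (simp add: indicator_def)

lemma multiplier_cong:
  assumes "closure_multiplier n u" "\<And>x. x \<in> space (lebesgue_n n) \<Longrightarrow> u x = v x"
  shows "closure_multiplier n v"
proof -
  obtain B where "\<And>x. x \<in> space (lebesgue_n n) \<Longrightarrow> \<bar>u x\<bar> \<le> B"
    using assms(1) unfolding closure_multiplier_def by blast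
  moreover have "(\<lambda>_::nat. u x) \<longlonglongrightarrow> v x" if "x \<in> space (lebesgue_n n)" for x
    unfolding assms(2)[OF that] by (rule tendsto_const)
  ultimately show ?thesis by (rule multiplier_bounded_limit[OF assms(1)])
qed

text \<open>A Gaussian centred at \<open>b\<close> is at least one half exactly on a closed interval around \<open>b\<close>; every closed half-line is a countable union of these.\<close>

lemma multiplier_indicator_coordinate:
  assumes i: "i < n" and A: "A \<in> sets borel"
  shows "closure_multiplier n (indicator {x. x i \<in> A})"
proof -
  have "A \<in> sigma_sets UNIV (range (\<lambda>a. {a..}))"
    using A unfolding borel_Ici by simp
  then show ?thesis
  proof induction
    case (Basic A)
    then obtain a where A: "A = {a..}" by auto
    have ball: "closure_multiplier n (indicator {x. \<bar>x i - b\<bar> \<le> r})" if "r > 0" for b r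
    proof -
      \<comment> \<open>the rate makes the Gaussian equal to one half exactly at distance r\<close>
      define s where "s = ln 2 / r\<^sup>2"
      have s: "s \<ge> 0" by (simp add: s_def)
      have "closure_multiplier n (indicator {x. exp (- (s * (x i - b)\<^sup>2)) < 1/2})"
        using s by (intro multiplier_indicator_less_half multiplier_exp i) auto
      then have "closure_multiplier n (indicator (- {x. exp (- (s * (x i - b)\<^sup>2)) < 1/2}) )"
        by (rule multiplier_indicator_compl)
      moreover have "exp (- (s * (x i - b)\<^sup>2)) < 1/2 \<longleftrightarrow> \<not> \<bar>x i - b\<bar> \<le> r" for x :: "nat \<Rightarrow> real"
      proof -
        have "exp (- (s * (x i - b)\<^sup>2)) < 1/2 \<longleftrightarrow> exp (- (s * (x i - b)\<^sup>2)) < exp (- ln 2)"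
          by (simp add: exp_minus inverse_eq_divide)
        also have "\<dots> \<longleftrightarrow> ln 2 < s * (x i - b)\<^sup>2" by simp
        also have "\<dots> \<longleftrightarrow> r\<^sup>2 < (x i - b)\<^sup>2"
          using that by (simp add: s_def field_simps)
        also have "\<dots> \<longleftrightarrow> \<not> \<bar>x i - b\<bar> \<le> r"
          using that abs_le_square_iff[of "x i - b" r] by auto
        finally show ?thesis .
      qed
      ultimately show ?thesis by (simp add: Compl_eq)
    qed
    have "{x. x i \<in> A} = (\<Union>k. {x. \<bar>x i - (a + real (Suc k))\<bar> \<le> real (Suc k)})"
    proof (intro set_eqI iffI)
      fix x assume "x \<in> {x. x i \<in> A}"
      moreover obtain k :: nat where "x i - a < real k" using reals_Archimedean2 by blast
      ultimately have "\<bar>x i - (a + real (Suc k))\<bar> \<le> real (Suc k)" by (simp add: A abs_le_iff)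
      then show "x \<in> (\<Union>k. {x. \<bar>x i - (a + real (Suc k))\<bar> \<le> real (Suc k)})" by blast
    qed (auto simp: A abs_le_iff)
    then show ?case by (simp only:) (intro multiplier_indicator_UN ball; simp)
  next
    case Empty
    then show ?case using multiplier_const[of n 0] by simp
  next
    case (Compl A)
    then show ?case using multiplier_indicator_compl[OF Compl.IH] by (simp add: Collect_neg_eq)
  next
    case (Union A)
    have "{x. x i \<in> \<Union> (range A)} = (\<Union>k. {x. x i \<in> A k})" by auto
    then show ?case using multiplier_indicator_UN[OF Union.IH] by simp
  qed
qed

lemma multiplier_indicator:
  assumes "A \<in> sets (lebesgue_n n)"
  shows "closure_multiplier n (indicator A)"
proof -
  have "A \<in> sigma_sets (\<Pi>\<^sub>E i\<in>{..<n}. UNIV) {{f\<in>\<Pi>\<^sub>E i\<in>{..<n}. UNIV. f i \<in> A} | i A. i \<in> {..<n} \<and> A \<in> sets (borel::real measure)}"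
    using assms unfolding lebesgue_n_def sets_PiM_single by simp
  then show ?thesis
  proof induction
    case (Basic A)
    then obtain i B where i: "i < n" and B: "B \<in> sets borel" and A: "A = {f\<in>\<Pi>\<^sub>E i\<in>{..<n}. UNIV. f i \<in> B}" by auto
    show ?case
      by (rule multiplier_cong[OF multiplier_indicator_coordinate[OF i B]])
         (auto simp: A lebesgue_n_def space_PiM indicator_def)
  next
    case Empty
    then show ?case using multiplier_const[of n 0] by simp
  next
    case (Compl A)
    show ?case
      by (rule multiplier_cong[OF multiplier_indicator_compl[OF Compl.IH]])
         (auto simp: lebesgue_n_def space_PiM indicator_def)
  next
    case (Union A)
    show ?case by (rule multiplier_indicator_UN[OF Union.IH])
  qed
qed

lemma multiplier_simple_function:
  fixes u :: "_ \<Rightarrow> real"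
  assumes "simple_function (lebesgue_n n) u"
  shows "closure_multiplier n u"
proof (rule multiplier_cong)
  let ?M = "lebesgue_n n"
  show "closure_multiplier n (\<lambda>x. \<Sum>y\<in>u ` space ?M. y * indicator (u -` {y} \<inter> space ?M) x)"
    using assms
    by (intro multiplier_sum multiplier_mult multiplier_const multiplier_indicator simple_functionD)
  fix x assume "x \<in> space ?M"
  then show "(\<Sum>y\<in>u ` space ?M. y * indicator (u -` {y} \<inter> space ?M) x) = u x"
    using assms simple_functionD(1)[OF assms] by (simp add: indicator_def if_distrib[of "\<lambda>z. _ * z"] cong: if_cong)
qed

text \<open>The ground state \<open>G\<close> is positive, so \<open>f = (f / G) G\<close>.  Simple functions increasing to \<open>f / G\<close> are multipliers,
  and their products with \<open>G\<close> increase to \<open>f\<close>.\<close>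

lemma hermite_closure_nonneg_real:
  fixes f :: "_ \<Rightarrow> real"
  assumes f: "(\<lambda>x. of_real (f x)) \<in> L2 n" and nonneg: "\<And>x. 0 \<le> f x"
  shows "(\<lambda>x. of_real (f x)) \<in> hermite_closure n"
proof -
  let ?M = "lebesgue_n n"
  let ?\<alpha> = "\<lambda>i\<in>{..<n}. 0::nat"
  have \<alpha>: "?\<alpha> \<in> {..<n} \<rightarrow>\<^sub>E UNIV" by simp
  define G where "G = hermite_function_n n ?\<alpha>"
  have G: "G x > 0" for x
    unfolding G_def hermite_function_n_def by (intro prod_pos) (simp add: hermite_function_0)
  have [measurable]: "G \<in> borel_measurable ?M" unfolding G_def by measurable
  have [measurable]: "f \<in> borel_measurable ?M"
    using measurable_compose[OF square_integrable_measurable[OF f] borel_measurable_Re] by simp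
  have meas: "(\<lambda>x. f x / G x) \<in> borel_measurable ?M" by measurable
  have ratio_nonneg: "0 \<le> f x / G x" for x using nonneg[of x] G[of x] by simp
  obtain u where u: "incseq u" "\<And>k. simple_function ?M (u k)" "\<And>x. bdd_above (range (\<lambda>k. u k x))"
      "\<And>k x. 0 \<le> u k x" "(\<lambda>x. f x / G x) = (SUP k. u k)"
    using borel_measurable_implies_simple_function_sequence_real[OF meas ratio_nonneg] by blast
  have lim: "(\<lambda>k. u k x) \<longlonglongrightarrow> f x / G x" for x
  proof -
    have "f x / G x = (SUP k. u k x)" using fun_cong[OF u(5), of x] by (simp add: SUP_apply image_image)
    then show ?thesis
      using LIMSEQ_incseq_SUP[OF u(3)[of x]] u(1) by (simp add: incseq_def le_fun_def)
  qed
  have le: "u k x \<le> f x / G x" for k x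
    using incseq_le[OF _ lim[of x]] u(1) by (simp add: incseq_def le_fun_def)
  show ?thesis
  proof (rule hermite_closure_dominated[where w = f])
    show "(\<lambda>x. of_real (u k x) * hermite_fun n ?\<alpha> x) \<in> hermite_closure n" for k
      by (intro multiplierD(2) multiplier_simple_function u(2) hermite_span_closure hermite_span.basis \<alpha>)
    show "integrable ?M (\<lambda>x. (f x)\<^sup>2)" using f by (simp add: square_integrable_def)
    show "norm (complex_of_real (u k x) * hermite_fun n ?\<alpha> x) \<le> f x" for k x
      using le[of k x] u(4)[of k x] G[of x] unfolding G_def[symmetric] by (simp add: norm_mult field_simps)
    show "(\<lambda>k. of_real (u k x) * hermite_fun n ?\<alpha> x) \<longlonglongrightarrow> complex_of_real (f x)" for x
    proof -
      have "(\<lambda>k. complex_of_real (u k x) * hermite_fun n ?\<alpha> x) \<longlonglongrightarrow> of_real (f x / G x) * hermite_fun n ?\<alpha> x"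
        by (intro tendsto_intros lim)
      also have "of_real (f x / G x) * hermite_fun n ?\<alpha> x = complex_of_real (f x)"
        unfolding G_def[symmetric] using G[of x] by simp
      finally show ?thesis .
    qed
  qed measurable
qed

theorem hermite_closure_eq_square_integrable: "hermite_closure n = L2 n"
proof (intro equalityI subsetI)
  fix f assume f: "f \<in> L2 n"
  have real_part: "(\<lambda>x. complex_of_real (g x)) \<in> hermite_closure n"
    if g: "g \<in> borel_measurable (lebesgue_n n)" "\<And>x. \<bar>g x\<bar> \<le> norm (f x)" for g :: "_ \<Rightarrow> real"
  proof -
    have part: "(\<lambda>x. complex_of_real (h x)) \<in> hermite_closure n"
      if "h \<in> borel_measurable (lebesgue_n n)" "\<And>x. 0 \<le> h x" "\<And>x. h x \<le> norm (f x)" for h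
      using f that
      by (intro hermite_closure_nonneg_real square_integrableI_dominated[where w = "\<lambda>x. (norm (f x))\<^sup>2"])
         (auto simp: square_integrable_def intro: power_mono)
    have "(\<lambda>x. complex_of_real (max 0 (g x)) + (-1) * complex_of_real (max 0 (- g x))) \<in> hermite_closure n"
      using g by (intro hermite_closure_add hermite_closure_scale part) (auto simp: abs_le_iff)
    moreover have "complex_of_real (max 0 (g x)) + (-1) * complex_of_real (max 0 (- g x)) = complex_of_real (g x)" for x
      by (simp add: max_def)
    ultimately show ?thesis by simp
  qed
  have "(\<lambda>x. complex_of_real (Re (f x)) + \<i> * complex_of_real (Im (f x))) \<in> hermite_closure n"
    using square_integrable_measurable[OF f]
    by (intro hermite_closure_add hermite_closure_scale real_part) (auto intro: abs_Re_le_cmod abs_Im_le_cmod)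
  then show "f \<in> hermite_closure n" by (simp flip: complex_eq)
qed (auto dest: hermite_closureD)

theorem hermite_expansion_converges:
  assumes "f \<in> L2 n"
  shows "(\<lambda>N. sqnorm n (\<lambda>x. f x - (\<Sum>m<N. hermite_projection n m f x))) \<longlonglongrightarrow> 0"
  using assms unfolding hermite_closure_eq_square_integrable[symmetric]
  by (simp add: hermite_closure_def hermite_residual_def[abs_def])

section \<open>Schur's test on all Lebesgue spaces\<close>

abbreviation enorm :: "'a::real_normed_vector \<Rightarrow> ennreal" where
  "enorm x \<equiv> ennreal (norm x)"

lemma ennreal_norm_integral_le:
  fixes f :: "'a \<Rightarrow> 'b::{banach, second_countable_topology}"
  shows "enorm (\<integral>x. f x \<partial>M) \<le> (\<integral>\<^sup>+x. enorm (f x) \<partial>M)"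
  by (cases "integrable M f") (auto intro: integral_norm_bound_ennreal simp: not_integrable_integral_eq)

text \<open>The function \<open>u \<mapsto> u\<^sup>p\<close> lies above its tangent at \<open>s\<close>; here the inequality is solved for \<open>u\<close>.\<close>

lemma powr_tangent_bound:
  fixes u s p :: real
  assumes "u \<ge> 0" "s > 0" "p \<ge> 1"
  shows "u \<le> s powr (1 - p) / p * u powr p + s * (1 - 1 / p)"
proof (cases "u = 0")
  case False
  then have u: "u > 0" using assms by simp
  have "(u powr p * s powr (1 - p)) powr (1 / p) * s powr (1 - 1 / p)
      \<le> 1 / p * (u powr p * s powr (1 - p)) + (1 - 1 / p) * s"
    using assms u by (intro Youngs_inequality_0) (auto simp: field_simps)
  also have "(u powr p * s powr (1 - p)) powr (1 / p) * s powr (1 - 1 / p)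
      = u * (s powr ((1 - p) * (1 / p)) * s powr (1 - 1 / p))"
    using assms u by (simp add: powr_mult powr_powr)
  also have "s powr ((1 - p) * (1 / p)) * s powr (1 - 1 / p) = 1"
    using assms unfolding powr_add [symmetric] by (simp add: field_simps)
  finally show ?thesis by (simp add: field_simps)
qed (use assms in auto)

text \<open>The multiple of the identity stands for the value of the multiplier at infinity, which no integral kernel can produce.\<close>

definition kernel_operator ::
  "'a measure \<Rightarrow> ('a \<times> 'a \<Rightarrow> complex) \<Rightarrow> complex \<Rightarrow> ('a \<Rightarrow> complex) \<Rightarrow> 'a \<Rightarrow> complex" where
  "kernel_operator M k a f x = a * f x + (\<integral>y. k (x, y) * f y \<partial>M)"

locale schur_bounded =
  fixes M :: "'a measure" and k :: "'a \<times> 'a \<Rightarrow> complex" and C :: real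
  assumes sigma_finite: "sigma_finite_measure M"
    and kernel_measurable [measurable]: "k \<in> borel_measurable (M \<Otimes>\<^sub>M M)"
    and row_bound: "\<And>x. x \<in> space M \<Longrightarrow> (\<integral>\<^sup>+y. enorm (k (x, y)) \<partial>M) \<le> ennreal C"
    and column_bound: "\<And>y. y \<in> space M \<Longrightarrow> (\<integral>\<^sup>+x. enorm (k (x, y)) \<partial>M) \<le> ennreal C"
    and C_pos: "C > 0"
begin

sublocale pair_sigma_finite M M
  by (intro pair_sigma_finite.intro sigma_finite)

lemma kernel_operator_measurable [measurable]:
  assumes [measurable]: "f \<in> borel_measurable M"
  shows "kernel_operator M k a f \<in> borel_measurable M"
  unfolding kernel_operator_def[abs_def] by measurable

lemma norm_kernel_operator_le:
  "enorm (kernel_operator M k a f x)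
     \<le> enorm a * enorm (f x) + (\<integral>\<^sup>+y. enorm (k (x, y)) * enorm (f y) \<partial>M)"
proof -
  have "enorm (kernel_operator M k a f x)
     \<le> enorm (a * f x) + enorm (\<integral>y. k (x, y) * f y \<partial>M)"
    unfolding kernel_operator_def using ennreal_leI[OF norm_triangle_ineq[of "a * f x" "\<integral>y. k (x, y) * f y \<partial>M"]]
    by (simp only: ennreal_plus[OF norm_ge_zero norm_ge_zero])
  also have "\<dots> \<le> enorm (a * f x) + (\<integral>\<^sup>+y. enorm (k (x, y) * f y) \<partial>M)"
    by (intro add_left_mono ennreal_norm_integral_le)
  finally show ?thesis by (simp add: norm_mult ennreal_mult)
qed

text \<open>Jensen's inequality for the measure consisting of the mass \<open>\<bar>a\<bar>\<close> at \<open>x\<close> and the density \<open>\<bar>k (x, y)\<bar>\<close>, of total mass at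
  most \<open>A = \<bar>a\<bar> + C\<close>.  What is integrated is the tangent bound at a well chosen point.\<close>

lemma kernel_operator_powr_le:
  assumes f[measurable]: "f \<in> borel_measurable M" and p: "p \<ge> 1" and x: "x \<in> space M"
  shows "ennreal (norm (kernel_operator M k a f x) powr p)
     \<le> ennreal ((norm a + C) powr (p - 1)) * (enorm a * ennreal (norm (f x) powr p)
          + (\<integral>\<^sup>+y. enorm (k (x, y)) * ennreal (norm (f y) powr p) \<partial>M))"
    (is "ennreal (?r powr p) \<le> ennreal (?A powr (p - 1)) * ?J")
proof (cases "?r = 0 \<or> ?J = \<infinity>")
  case True
  have "?A \<noteq> 0" using C_pos norm_ge_zero[of a] by linarith
  then have "?A powr (p - 1) > 0" by simp
  then show ?thesis using True by (auto simp: ennreal_mult_top)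
next
  case False
  define r A where "r = ?r" and "A = ?A"
  have r: "r > 0" and A: "A > 0" using False C_pos by (auto simp: r_def A_def add_nonneg_pos)
  \<comment> \<open>the point of tangency for which the constant term of the tangent bound, times \<open>A\<close>, is a fixed part of \<open>r\<close>\<close>
  define s where "s = r / A"
  define c where "c = s powr (1 - p) / p"
  define d where "d = s * (1 - 1 / p)"
  let ?I = "\<integral>\<^sup>+y. enorm (k (x, y)) * ennreal (norm (f y) powr p) \<partial>M"
  let ?KI = "\<integral>\<^sup>+y. enorm (k (x, y)) * (ennreal c * ennreal (norm (f y) powr p) + ennreal d) \<partial>M"
  have s: "s > 0" using r A by (simp add: s_def)
  have c: "c \<ge> 0" and d: "d \<ge> 0" using s p by (auto simp: c_def d_def)
  obtain j where j: "j \<ge> 0" "?J = ennreal j"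
    using False by (cases ?J) auto
  have kx [measurable]: "(\<lambda>y. k (x, y)) \<in> borel_measurable M" using x by measurable
  have tangent: "enorm (f y) \<le> ennreal c * ennreal (norm (f y) powr p) + ennreal d" for y
  proof -
    have "norm (f y) \<le> c * norm (f y) powr p + d"
      unfolding c_def d_def using s p by (intro powr_tangent_bound) auto
    then have "enorm (f y) \<le> ennreal (c * norm (f y) powr p + d)" by (rule ennreal_leI)
    then show ?thesis using c d by (simp add: ennreal_plus ennreal_mult)
  qed
  have "?KI
     = (\<integral>\<^sup>+y. ennreal c * (enorm (k (x, y)) * ennreal (norm (f y) powr p)) + ennreal d * enorm (k (x, y)) \<partial>M)"
    by (simp only: distrib_left mult_ac)
  also have "\<dots> = ennreal c * ?I + ennreal d * (\<integral>\<^sup>+y. enorm (k (x, y)) \<partial>M)"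
    by (subst nn_integral_add) (auto simp: nn_integral_cmult)
  also have "\<dots> \<le> ennreal c * ?I + ennreal d * ennreal C"
    by (intro add_left_mono mult_left_mono row_bound x) auto
  finally have kernel_part: "?KI
     \<le> ennreal c * ?I + ennreal d * ennreal C" .
  have "ennreal r \<le> enorm a * enorm (f x) + (\<integral>\<^sup>+y. enorm (k (x, y)) * enorm (f y) \<partial>M)"
    unfolding r_def by (rule norm_kernel_operator_le)
  also have "\<dots> \<le> enorm a * (ennreal c * ennreal (norm (f x) powr p) + ennreal d) + ?KI"
    by (intro add_mono mult_left_mono nn_integral_mono tangent) auto
  also have "\<dots> \<le> enorm a * (ennreal c * ennreal (norm (f x) powr p) + ennreal d)
      + (ennreal c * ?I + ennreal d * ennreal C)"
    by (intro add_left_mono kernel_part)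
  also have "\<dots> = ennreal c * ?J + ennreal d * (enorm a + ennreal C)"
    by (simp only: distrib_left mult_ac add_ac)
  also have "\<dots> = ennreal (c * j + d * A)"
    unfolding j(2) A_def using c d j(1) C_pos by (simp add: ennreal_plus ennreal_mult)
  finally have "ennreal r \<le> ennreal (c * j + d * A)" .
  then have "r \<le> c * j + d * A"
    using c d j(1) A by (subst (asm) ennreal_le_iff) auto
  moreover have "d * A = r * (1 - 1 / p)" using A by (simp add: d_def s_def)
  ultimately have "r / p \<le> c * j" by (simp add: algebra_simps)
  then have "r \<le> s powr (1 - p) * j" using p by (simp add: c_def field_simps)
  then have "s powr (p - 1) * r \<le> s powr (p - 1) * (s powr (1 - p) * j)"
    by (intro mult_left_mono) auto
  also have "\<dots> = (s powr (p - 1) * s powr (1 - p)) * j" by simp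
  also have "s powr (p - 1) * s powr (1 - p) = 1"
    using s unfolding powr_add [symmetric] by simp
  finally have "s powr (p - 1) * r \<le> j" by simp
  then have "A powr (p - 1) * (s powr (p - 1) * r) \<le> A powr (p - 1) * j"
    by (intro mult_left_mono) auto
  also have "A powr (p - 1) * (s powr (p - 1) * r) = (A * s) powr (p - 1) * r"
    using A s by (simp add: powr_mult)
  also have "(A * s) powr (p - 1) * r = r powr p"
  proof -
    have "r powr p = r powr ((p - 1) + 1)" by simp
    also have "\<dots> = r powr (p - 1) * r" using r by (simp only: powr_add powr_one)
    finally show ?thesis using A by (simp add: s_def)
  qed
  finally have "ennreal (r powr p) \<le> ennreal (A powr (p - 1) * j)" by (rule ennreal_leI)
  then show ?thesis unfolding j(2) r_def[symmetric] A_def[symmetric] using j(1) by (simp add: ennreal_mult)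
qed

lemma nn_integral_kernel_swap:
  assumes g[measurable]: "g \<in> borel_measurable M"
  shows "(\<integral>\<^sup>+x. (\<integral>\<^sup>+y. enorm (k (x, y)) * g y \<partial>M) \<partial>M) \<le> ennreal C * (\<integral>\<^sup>+y. g y \<partial>M)"
proof -
  have "(\<integral>\<^sup>+x. (\<integral>\<^sup>+y. enorm (k (x, y)) * g y \<partial>M) \<partial>M)
     = (\<integral>\<^sup>+y. (\<integral>\<^sup>+x. enorm (k (x, y)) * g y \<partial>M) \<partial>M)"
    by (rule Fubini'[symmetric]) measurable
  also have "\<dots> = (\<integral>\<^sup>+y. (\<integral>\<^sup>+x. enorm (k (x, y)) \<partial>M) * g y \<partial>M)"
    by (intro nn_integral_cong nn_integral_multc) measurable
  also have "\<dots> \<le> (\<integral>\<^sup>+y. ennreal C * g y \<partial>M)"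
    by (intro nn_integral_mono mult_right_mono column_bound) auto
  also have "\<dots> = ennreal C * (\<integral>\<^sup>+y. g y \<partial>M)" by (intro nn_integral_cmult) measurable
  finally show ?thesis .
qed

text \<open>Rows enter through the pointwise bound, columns through Tonelli's theorem.\<close>

lemma nn_integral_kernel_operator_powr_le:
  assumes f[measurable]: "f \<in> borel_measurable M" and p: "p \<ge> 1"
  shows "(\<integral>\<^sup>+x. ennreal (norm (kernel_operator M k a f x) powr p) \<partial>M)
     \<le> ennreal ((norm a + C) powr p) * (\<integral>\<^sup>+x. ennreal (norm (f x) powr p) \<partial>M)"
proof -
  let ?F = "\<lambda>x. ennreal (norm (f x) powr p)" and ?A = "norm a + C"
  let ?IF = "\<integral>\<^sup>+x. ?F x \<partial>M"
  let ?IK = "\<integral>\<^sup>+x. enorm a * ?F x + (\<integral>\<^sup>+y. enorm (k (x, y)) * ?F y \<partial>M) \<partial>M"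
  have A: "?A > 0" using C_pos by (simp add: add_nonneg_pos)
  have "?IK
      = enorm a * ?IF + (\<integral>\<^sup>+x. (\<integral>\<^sup>+y. enorm (k (x, y)) * ?F y \<partial>M) \<partial>M)"
    by (subst nn_integral_add) (auto simp: nn_integral_cmult)
  also have "\<dots> \<le> enorm a * ?IF + ennreal C * ?IF"
    by (intro add_left_mono nn_integral_kernel_swap) measurable
  also have "\<dots> = ennreal ?A * ?IF"
    using C_pos by (simp add: ennreal_plus distrib_right)
  finally have inner: "?IK
      \<le> ennreal ?A * ?IF" .
  have "(\<integral>\<^sup>+x. ennreal (norm (kernel_operator M k a f x) powr p) \<partial>M)
     \<le> (\<integral>\<^sup>+x. ennreal (?A powr (p - 1)) * (enorm a * ?F x + (\<integral>\<^sup>+y. enorm (k (x, y)) * ?F y \<partial>M)) \<partial>M)"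
    by (intro nn_integral_mono kernel_operator_powr_le f p)
  also have "\<dots> = ennreal (?A powr (p - 1)) * ?IK"
    by (intro nn_integral_cmult) measurable
  also have "\<dots> \<le> ennreal (?A powr (p - 1)) * (ennreal ?A * ?IF)"
    by (intro mult_left_mono inner) auto
  also have "\<dots> = ennreal (?A powr p) * ?IF"
  proof -
    have "?A powr p = ?A powr ((p - 1) + 1)" by simp
    also have "\<dots> = ?A powr (p - 1) * ?A" using A by (simp only: powr_add powr_one)
    finally show ?thesis using A by (simp add: ennreal_mult mult.assoc)
  qed
  finally show ?thesis .
qed

lemma esssup_kernel_operator_le:
  assumes f[measurable]: "f \<in> borel_measurable M"
  shows "esssup M (\<lambda>x. enorm (kernel_operator M k a f x)) \<le> ennreal (norm a + C) * esssup M (\<lambda>x. enorm (f x))"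
proof (rule esssup_I)
  let ?E = "esssup M (\<lambda>x. enorm (f x))"
  have le: "AE x in M. enorm (f x) \<le> ?E" by (rule esssup_AE)
  have conv: "(\<integral>\<^sup>+y. enorm (k (x, y)) * enorm (f y) \<partial>M) \<le> ennreal C * ?E" if x: "x \<in> space M" for x
  proof -
    have kx [measurable]: "(\<lambda>y. k (x, y)) \<in> borel_measurable M" using x by measurable
    have "(\<integral>\<^sup>+y. enorm (k (x, y)) * enorm (f y) \<partial>M) \<le> (\<integral>\<^sup>+y. enorm (k (x, y)) * ?E \<partial>M)"
      using le by (intro nn_integral_mono_AE) (auto elim!: eventually_mono intro: mult_left_mono)
    also have "\<dots> = (\<integral>\<^sup>+y. enorm (k (x, y)) \<partial>M) * ?E" by (intro nn_integral_multc) measurable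
    also have "\<dots> \<le> ennreal C * ?E" by (intro mult_right_mono row_bound x) auto
    finally show ?thesis .
  qed
  show "AE x in M. enorm (kernel_operator M k a f x) \<le> ennreal (norm a + C) * ?E"
    using le AE_space
  proof eventually_elim
    case (elim x)
    have "enorm (kernel_operator M k a f x) \<le> enorm a * ?E + ennreal C * ?E"
      by (rule order_trans[OF norm_kernel_operator_le]) (intro add_mono mult_left_mono elim conv; simp)
    then show ?case using C_pos by (simp add: ennreal_plus distrib_right)
  qed
qed measurable

theorem Lp_norm_kernel_operator_le:
  assumes f[measurable]: "f \<in> borel_measurable M" and p: "1 \<le> p"
  shows "Lp_norm p M (kernel_operator M k a f) \<le> ennreal (norm a + C) * Lp_norm p M f"
proof (cases p)
  case top
  then show ?thesis using esssup_kernel_operator_le[OF f, of a] by (simp add: Lp_norm_def)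
next
  case (real q)
  have q: "q \<ge> 1" using p real by (simp add: ennreal_1[symmetric] del: ennreal_1)
  have enn: "enn2real p = q" "p \<noteq> \<infinity>" using real q by auto
  let ?A = "norm a + C"
  have A: "?A > 0" using C_pos by (simp add: add_nonneg_pos)
  let ?I = "\<lambda>f. \<integral>\<^sup>+x. ennreal (norm (f x) powr q) \<partial>M"
  have le: "?I (kernel_operator M k a f) \<le> ennreal (?A powr q) * ?I f"
    by (rule nn_integral_kernel_operator_powr_le[OF f q])
  show ?thesis
  proof (cases "?I f")
    case top
    then have "Lp_norm p M f = \<infinity>" using enn by (simp add: Lp_norm_def)
    then show ?thesis using A by (simp add: ennreal_mult_top)
  next
    case i: (real i)
    then have le': "?I (kernel_operator M k a f) \<le> ennreal (?A powr q * i)" using le by (simp add: ennreal_mult)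
    then obtain l where l: "l \<ge> 0" "?I (kernel_operator M k a f) = ennreal l"
      by (cases "?I (kernel_operator M k a f)") (auto simp: top_unique)
    then have "l \<le> ?A powr q * i" using le' i by (simp add: ennreal_le_iff)
    then have "l powr (1 / q) \<le> (?A powr q * i) powr (1 / q)"
      using l q by (intro powr_mono2) auto
    also have "\<dots> = ?A * i powr (1 / q)"
      using A i q by (simp add: powr_mult powr_powr)
    finally have "ennreal (l powr (1 / q)) \<le> ennreal (?A * i powr (1 / q))" by (rule ennreal_leI)
    moreover have "Lp_norm p M (kernel_operator M k a f) = ennreal (l powr (1 / q))"
      using enn l by (simp add: Lp_norm_def)
    moreover have "Lp_norm p M f = ennreal (i powr (1 / q))"
      using enn i by (simp add: Lp_norm_def)
    ultimately show ?thesis using A by (simp add: ennreal_mult)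
  qed
qed

end

lemma nn_integral_powr_2:
  "(\<integral>\<^sup>+x. ennreal (norm (f x) powr 2) \<partial>M) = (\<integral>\<^sup>+x. ennreal ((norm (f x))\<^sup>2) \<partial>M)"
  by (intro nn_integral_cong) (simp add: powr_numeral)

lemma Lp_norm_2:
  assumes "f \<in> square_integrable M"
  shows "Lp_norm 2 M f = ennreal (sqrt (norm2_sq M f))"
  using norm2_sq_nonneg[of M f]
  by (simp add: Lp_norm_def nn_integral_powr_2 nn_integral_norm_sq[OF assms] powr_half_sqrt)

lemma Lp_space_2: "Lp_space 2 M = square_integrable M"
proof (intro equalityI subsetI)
  fix f assume "f \<in> Lp_space 2 M"
  then have f: "f \<in> borel_measurable M" "Lp_norm 2 M f < \<infinity>" by (auto simp: Lp_space_def)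
  have "(\<integral>\<^sup>+x. ennreal ((norm (f x))\<^sup>2) \<partial>M) \<noteq> \<infinity>"
  proof
    assume "(\<integral>\<^sup>+x. ennreal ((norm (f x))\<^sup>2) \<partial>M) = \<infinity>"
    then show False using f(2) by (simp add: Lp_norm_def nn_integral_powr_2)
  qed
  then show "f \<in> square_integrable M"
    using f(1) by (auto simp: square_integrable_def integrable_iff_bounded less_top)
next
  fix f assume "f \<in> square_integrable M"
  then show "f \<in> Lp_space 2 M" using Lp_norm_2 square_integrable_measurable by (auto simp: Lp_space_def)
qed

lemma Lp_norm_cong_AE:
  assumes "f \<in> borel_measurable M" "g \<in> borel_measurable M" "AE x in M. f x = g x"
  shows "Lp_norm p M f = Lp_norm p M g"
proof -
  have "(\<integral>\<^sup>+x. ennreal (norm (f x) powr q) \<partial>M) = (\<integral>\<^sup>+x. ennreal (norm (g x) powr q) \<partial>M)" for q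
    using assms by (intro nn_integral_cong_AE) auto
  moreover have "esssup M (\<lambda>x. enorm (f x)) = esssup M (\<lambda>x. enorm (g x))"
    using assms by (intro esssup_AE_cong) auto
  ultimately show ?thesis by (simp add: Lp_norm_def)
qed

section \<open>Multipliers given by kernels\<close>

text \<open>Kernels of operators \<open>\<mu>(L)\<close>: they satisfy Schur's test, and each Hermite function is an eigenfunction whose eigenvalue
  depends on the degree alone.\<close>

definition hermite_kernel ::
  "nat \<Rightarrow> real \<Rightarrow> (nat \<Rightarrow> complex) \<Rightarrow> ((nat \<Rightarrow> real) \<times> (nat \<Rightarrow> real) \<Rightarrow> complex) \<Rightarrow> bool" where
  "hermite_kernel n C \<mu> k \<longleftrightarrow> schur_bounded (lebesgue_n n) k C \<and>
     (\<forall>m. \<forall>\<alpha>\<in>multi_indices n m. \<forall>y\<in>space (lebesgue_n n).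
        (\<integral>x. k (x, y) * hermite_fun n \<alpha> x \<partial>lebesgue_n n) = \<mu> m * hermite_fun n \<alpha> y)"

lemma hermite_kernelD:
  assumes "hermite_kernel n C \<mu> k"
  shows "schur_bounded (lebesgue_n n) k C"
    and "\<alpha> \<in> multi_indices n m \<Longrightarrow> y \<in> space (lebesgue_n n) \<Longrightarrow>
        (\<integral>x. k (x, y) * hermite_fun n \<alpha> x \<partial>lebesgue_n n) = \<mu> m * hermite_fun n \<alpha> y"
  using assms by (auto simp: hermite_kernel_def)

lemma (in schur_bounded) square_integrable_kernel_operator:
  assumes "f \<in> square_integrable M"
  shows "kernel_operator M k a f \<in> square_integrable M"
proof -
  have f: "f \<in> borel_measurable M" using assms by (rule square_integrable_measurable)
  have "Lp_norm 2 M (kernel_operator M k a f) \<le> ennreal (norm a + C) * Lp_norm 2 M f"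
    by (rule Lp_norm_kernel_operator_le[OF f]) simp
  also have "\<dots> < \<infinity>" using assms by (simp add: Lp_norm_2 ennreal_mult_less_top)
  finally show ?thesis
    using kernel_operator_measurable[OF f] unfolding Lp_space_2[symmetric] Lp_space_def by simp
qed

text \<open>Since \<open>\<bar>f y h x\<bar> \<le> \<bar>f y\<bar>\<^sup>2 + \<bar>h x\<bar>\<^sup>2\<close>, one of the variables can always be integrated with the Schur bound.\<close>

lemma (in schur_bounded) integrable_kernel_pairing:
  assumes f: "f \<in> square_integrable M" and h: "h \<in> square_integrable M"
  shows "integrable (M \<Otimes>\<^sub>M M) (\<lambda>(x, y). k (x, y) * f y * h x)"
proof (rule integrableI_bounded)
  note [measurable] = square_integrable_measurable[OF f] square_integrable_measurable[OF h]
  show "(\<lambda>(x, y). k (x, y) * f y * h x) \<in> borel_measurable (M \<Otimes>\<^sub>M M)" by measurable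
  let ?F = "\<lambda>y. ennreal ((norm (f y))\<^sup>2)" and ?H = "\<lambda>x. ennreal ((norm (h x))\<^sup>2)" and ?K = "\<lambda>x y. enorm (k (x, y))"
  have "norm (k (x, y) * f y * h x) \<le> norm (k (x, y)) * ((norm (f y))\<^sup>2 + (norm (h x))\<^sup>2)" for x y
  proof -
    have "2 * (norm (f y) * norm (h x)) \<le> (norm (f y))\<^sup>2 + (norm (h x))\<^sup>2" "0 \<le> norm (f y) * norm (h x)"
      using sum_squares_bound[of "norm (f y)" "norm (h x)"] by (simp_all add: mult.assoc)
    then have "norm (f y) * norm (h x) \<le> (norm (f y))\<^sup>2 + (norm (h x))\<^sup>2" by linarith
    from mult_left_mono[OF this, of "norm (k (x, y))"] show ?thesis by (simp add: norm_mult mult.assoc)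
  qed
  then have le: "enorm (k (x, y) * f y * h x) \<le> ?K x y * ?F y + ?H x * ?K x y" for x y
    using ennreal_leI[of "norm (k (x, y) * f y * h x)" "norm (k (x, y)) * ((norm (f y))\<^sup>2 + (norm (h x))\<^sup>2)"]
    by (simp add: distrib_left ennreal_plus ennreal_mult mult.commute)
  have "(\<integral>\<^sup>+z. enorm (case z of (x, y) \<Rightarrow> k (x, y) * f y * h x) \<partial>(M \<Otimes>\<^sub>M M))
     = (\<integral>\<^sup>+x. (\<integral>\<^sup>+y. enorm (k (x, y) * f y * h x) \<partial>M) \<partial>M)"
    by (subst M1.nn_integral_fst[symmetric]) auto
  also have "\<dots> \<le> (\<integral>\<^sup>+x. (\<integral>\<^sup>+y. ?K x y * ?F y + ?H x * ?K x y \<partial>M) \<partial>M)"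
    by (intro nn_integral_mono le)
  also have "\<dots> = (\<integral>\<^sup>+x. (\<integral>\<^sup>+y. ?K x y * ?F y \<partial>M) + ?H x * (\<integral>\<^sup>+y. ?K x y \<partial>M) \<partial>M)"
    by (intro nn_integral_cong) (simp add: nn_integral_add nn_integral_cmult)
  also have "\<dots> = (\<integral>\<^sup>+x. (\<integral>\<^sup>+y. ?K x y * ?F y \<partial>M) \<partial>M) + (\<integral>\<^sup>+x. ?H x * (\<integral>\<^sup>+y. ?K x y \<partial>M) \<partial>M)"
    by (intro nn_integral_add) measurable
  also have "\<dots> \<le> ennreal C * (\<integral>\<^sup>+y. ?F y \<partial>M) + (\<integral>\<^sup>+x. ?H x * ennreal C \<partial>M)"
    by (intro add_mono nn_integral_kernel_swap nn_integral_mono mult_left_mono row_bound) auto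
  also have "\<dots> < \<infinity>"
    using f h by (simp add: nn_integral_multc nn_integral_norm_sq ennreal_mult_less_top)
  finally show "(\<integral>\<^sup>+z. enorm (case z of (x, y) \<Rightarrow> k (x, y) * f y * h x) \<partial>(M \<Otimes>\<^sub>M M)) < \<infinity>" .
qed

lemma hermite_coeff_kernel_operator:
  assumes k: "hermite_kernel n C \<mu> k" and f: "f \<in> L2 n"
    and \<alpha>: "\<alpha> \<in> multi_indices n m"
  shows "hermite_coeff n (kernel_operator (lebesgue_n n) k a f) \<alpha> = (a + \<mu> m) * hermite_coeff n f \<alpha>"
proof -
  let ?M = "lebesgue_n n" and ?H = "hermite_fun n \<alpha>"
  interpret schur_bounded ?M k C using k by (rule hermite_kernelD)
  note H = square_integrable_hermite_fun[of n \<alpha>]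
  have Kf: "kernel_operator ?M k 0 f \<in> square_integrable ?M"
    using f by (rule square_integrable_kernel_operator)
  have "hermite_coeff n (kernel_operator ?M k 0 f) \<alpha> = (\<integral>x. (\<integral>y. k (x, y) * f y * ?H x \<partial>?M) \<partial>?M)"
    by (simp add: hermite_coeff_def kernel_operator_def)
  also have "\<dots> = (\<integral>y. (\<integral>x. k (x, y) * f y * ?H x \<partial>?M) \<partial>?M)"
    by (rule Fubini_integral[symmetric]) (rule integrable_kernel_pairing[OF f H])
  also have "\<dots> = (\<integral>y. \<mu> m * (f y * ?H y) \<partial>?M)"
  proof (rule Bochner_Integration.integral_cong[OF refl])
    fix y assume y: "y \<in> space ?M"
    have "(\<integral>x. k (x, y) * f y * ?H x \<partial>?M) = (\<integral>x. f y * (k (x, y) * ?H x) \<partial>?M)"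
      by (simp only: mult_ac)
    also have "\<dots> = f y * (\<mu> m * ?H y)"
      using hermite_kernelD(2)[OF k \<alpha> y] by simp
    finally show "(\<integral>x. k (x, y) * f y * ?H x \<partial>?M) = \<mu> m * (f y * ?H y)" by (simp only: mult_ac)
  qed
  also have "\<dots> = \<mu> m * hermite_coeff n f \<alpha>" by (simp add: hermite_coeff_def)
  finally have 1: "hermite_coeff n (kernel_operator ?M k 0 f) \<alpha> = \<mu> m * hermite_coeff n f \<alpha>" .
  have "kernel_operator ?M k a f = (\<lambda>x. a * f x + kernel_operator ?M k 0 f x)"
    by (simp add: kernel_operator_def fun_eq_iff)
  then show ?thesis
    using hermite_coeff_add[OF square_integrable_cmult(1)[OF f, of a] Kf, of \<alpha>] 1
    by (simp add: hermite_coeff_cmult distrib_right)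
qed

definition uniformly_bounded_multiplier :: "nat \<Rightarrow> (nat \<Rightarrow> complex) \<Rightarrow> real \<Rightarrow> bool" where
  "uniformly_bounded_multiplier n \<Psi> C \<longleftrightarrow> (\<forall>p\<ge>1. \<forall>f \<in> Lp_space 2 (lebesgue_n n) \<inter> Lp_space p (lebesgue_n n).
        (\<exists>g. is_hermite_multiplier n \<Psi> f g) \<and>
        (\<forall>g. is_hermite_multiplier n \<Psi> f g \<longrightarrow>
          Lp_norm p (lebesgue_n n) g \<le> ennreal C * Lp_norm p (lebesgue_n n) f))"

lemma uniformly_bounded_multiplier_mono:
  assumes "uniformly_bounded_multiplier n \<Psi> C" "C \<le> D"
  shows "uniformly_bounded_multiplier n \<Psi> D"
proof -
  have "ennreal C * z \<le> ennreal D * z" for z using assms(2) by (intro mult_right_mono ennreal_leI) auto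
  then show ?thesis using assms(1) unfolding uniformly_bounded_multiplier_def by (blast intro: order_trans)
qed

lemma is_hermite_multiplier_iff:
  assumes f: "f \<in> L2 n"
  shows "is_hermite_multiplier n \<Psi> f g \<longleftrightarrow> g \<in> L2 n \<and>
    (\<lambda>N. sqnorm n (\<lambda>x. g x - (\<Sum>m<N. \<Psi> (2 * m + n) * hermite_projection n m f x))) \<longlonglongrightarrow> 0"
proof (cases "g \<in> L2 n")
  case True
  let ?r = "\<lambda>N x. g x - (\<Sum>m<N. \<Psi> (2 * m + n) * hermite_projection n m f x)"
  have r: "?r N \<in> L2 n" for N
    unfolding hermite_projection_eq[OF f] using True
    by (intro square_integrable_diff square_integrable_sum square_integrable_cmult(1) square_integrable_hermite_sum)
  have "(\<lambda>N. Lp_norm 2 (lebesgue_n n) (?r N)) \<longlonglongrightarrow> 0 \<longleftrightarrow> (\<lambda>N. ennreal (sqrt (sqnorm n (?r N)))) \<longlonglongrightarrow> ennreal 0"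
    by (simp only: Lp_norm_2[OF r] ennreal_0)
  also have "\<dots> \<longleftrightarrow> (\<lambda>N. sqrt (sqnorm n (?r N))) \<longlonglongrightarrow> 0"
    by (intro tendsto_ennreal_iff) (auto simp: norm2_sq_nonneg)
  also have "\<dots> \<longleftrightarrow> (\<lambda>N. sqnorm n (?r N)) \<longlonglongrightarrow> 0"
  proof
    assume "(\<lambda>N. sqrt (sqnorm n (?r N))) \<longlonglongrightarrow> 0"
    then have "(\<lambda>N. (sqrt (sqnorm n (?r N)))\<^sup>2) \<longlonglongrightarrow> 0\<^sup>2" by (intro tendsto_power)
    then show "(\<lambda>N. sqnorm n (?r N)) \<longlonglongrightarrow> 0" by (simp add: norm2_sq_nonneg)
  next
    assume "(\<lambda>N. sqnorm n (?r N)) \<longlonglongrightarrow> 0"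
    then show "(\<lambda>N. sqrt (sqnorm n (?r N))) \<longlonglongrightarrow> 0"
      using tendsto_real_sqrt by fastforce
  qed
  finally show ?thesis using True by (simp add: is_hermite_multiplier_def Lp_space_2)
qed (simp add: is_hermite_multiplier_def Lp_space_2)

lemma is_hermite_multiplier_unique:
  assumes f: "f \<in> L2 n"
    and g: "is_hermite_multiplier n \<Psi> f g" and h: "is_hermite_multiplier n \<Psi> f h"
  shows "AE x in lebesgue_n n. g x = h x"
proof -
  let ?M = "lebesgue_n n"
  let ?S = "\<lambda>N x. \<Sum>m<N. \<Psi> (2 * m + n) * hermite_projection n m f x"
  have g2: "g \<in> square_integrable ?M" and h2: "h \<in> square_integrable ?M"
    and lg: "(\<lambda>N. norm2_sq ?M (\<lambda>x. g x - ?S N x)) \<longlonglongrightarrow> 0"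
    and lh: "(\<lambda>N. norm2_sq ?M (\<lambda>x. h x - ?S N x)) \<longlonglongrightarrow> 0"
    using g h f by (auto simp: is_hermite_multiplier_iff)
  have S: "?S N \<in> square_integrable ?M" for N
    unfolding hermite_projection_eq[OF f]
    by (intro square_integrable_sum square_integrable_cmult(1) square_integrable_hermite_sum)
  have gh: "(\<lambda>x. g x - h x) \<in> square_integrable ?M" using g2 h2 by (rule square_integrable_diff)
  have "norm2_sq ?M (\<lambda>x. g x - h x) \<le> 2 * norm2_sq ?M (\<lambda>x. g x - ?S N x) + 2 * norm2_sq ?M (\<lambda>x. h x - ?S N x)" for N
  proof -
    have "norm2_sq ?M (\<lambda>x. (g x - ?S N x) + (-1) * (h x - ?S N x))
      \<le> 2 * norm2_sq ?M (\<lambda>x. g x - ?S N x) + 2 * norm2_sq ?M (\<lambda>x. (-1) * (h x - ?S N x))"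
      by (intro square_integrable_add square_integrable_cmult square_integrable_diff g2 h2 S)
    also have "norm2_sq ?M (\<lambda>x. (-1) * (h x - ?S N x)) = norm2_sq ?M (\<lambda>x. h x - ?S N x)"
      using square_integrable_cmult(2)[OF square_integrable_diff[OF h2 S], of "-1"] by simp
    finally show ?thesis by simp
  qed
  moreover have "(\<lambda>N. 2 * norm2_sq ?M (\<lambda>x. g x - ?S N x) + 2 * norm2_sq ?M (\<lambda>x. h x - ?S N x)) \<longlonglongrightarrow> 2 * 0 + 2 * 0"
    by (intro tendsto_intros lg lh)
  ultimately have "norm2_sq ?M (\<lambda>x. g x - h x) \<le> 0"
    by (intro LIMSEQ_le_const[where X = "\<lambda>N. 2 * norm2_sq ?M (\<lambda>x. g x - ?S N x) + 2 * norm2_sq ?M (\<lambda>x. h x - ?S N x)"]) auto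
  then have "norm2_sq ?M (\<lambda>x. g x - h x) = 0" using norm2_sq_nonneg[of ?M "\<lambda>x. g x - h x"] by linarith
  then have "AE x in ?M. (norm (g x - h x))\<^sup>2 = 0"
    using gh unfolding norm2_sq_def square_integrable_def
    by (subst (asm) integral_nonneg_eq_0_iff_AE) auto
  then show ?thesis by simp
qed

text \<open>The kernel operator multiplies the Hermite coefficients by the values of \<open>\<Psi>\<close>, so the partial sums defining the
  multiplier are those of the Hermite expansion of its image, and completeness applies.  As the multiplier is determined almost
  everywhere, the norm estimate carries over to every representative.\<close>

theorem uniformly_bounded_multiplier_kernel:
  assumes k: "hermite_kernel n C \<mu> k" and \<Psi>: "\<And>m. \<Psi> (2 * m + n) = a + \<mu> m"
  shows "uniformly_bounded_multiplier n \<Psi> (norm a + C)"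
  unfolding uniformly_bounded_multiplier_def
proof (intro allI impI ballI)
  let ?M = "lebesgue_n n"
  interpret schur_bounded ?M k C using k by (rule hermite_kernelD)
  fix p :: ennreal and f assume p: "p \<ge> 1" and "f \<in> Lp_space 2 ?M \<inter> Lp_space p ?M"
  then have f: "f \<in> square_integrable ?M" by (simp add: Lp_space_2)
  have fm: "f \<in> borel_measurable ?M" using f by (rule square_integrable_measurable)
  let ?g = "kernel_operator ?M k a f"
  have g: "?g \<in> square_integrable ?M" using f by (rule square_integrable_kernel_operator)
  have proj: "\<Psi> (2 * m + n) * hermite_projection n m f x = hermite_projection n m ?g x" for m x
    unfolding hermite_projection_eq[OF f] hermite_projection_eq[OF g] sum_distrib_left
    by (intro sum.cong refl) (simp add: hermite_coeff_kernel_operator[OF k f] \<Psi> mult.assoc)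
  have mult: "is_hermite_multiplier n \<Psi> f ?g"
    unfolding is_hermite_multiplier_iff[OF f] proj using g hermite_expansion_converges[OF g] by blast
  show "(\<exists>g. is_hermite_multiplier n \<Psi> f g) \<and>
        (\<forall>g. is_hermite_multiplier n \<Psi> f g \<longrightarrow> Lp_norm p ?M g \<le> ennreal (norm a + C) * Lp_norm p ?M f)"
  proof (intro conjI allI impI)
    show "\<exists>g. is_hermite_multiplier n \<Psi> f g" using mult by blast
    fix h assume h: "is_hermite_multiplier n \<Psi> f h"
    have hm: "h \<in> borel_measurable ?M"
      using h f by (simp add: is_hermite_multiplier_iff square_integrable_measurable)
    have "Lp_norm p ?M h = Lp_norm p ?M ?g"
      using hm fm by (intro Lp_norm_cong_AE is_hermite_multiplier_unique[OF f h mult] kernel_operator_measurable)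
    also have "\<dots> \<le> ennreal (norm a + C) * Lp_norm p ?M f"
      by (rule Lp_norm_kernel_operator_le[OF fm p])
    finally show "Lp_norm p ?M h \<le> ennreal (norm a + C) * Lp_norm p ?M f" .
  qed
qed

section \<open>Kernels of functions of the Hermite operator\<close>

text \<open>Integrals over time and sums over exponents or eigenspaces are all instances of this lemma.  The interchanges of integrals are
  justified by one and the same bound, that of the mixed integral of the absolute value.\<close>

lemma hermite_kernel_superposition:
  fixes \<Omega> :: "'w measure" and c :: "'w \<Rightarrow> complex"
  assumes \<Omega>: "sigma_finite_measure \<Omega>"
    and c [measurable]: "c \<in> borel_measurable \<Omega>" and b [measurable]: "b \<in> borel_measurable \<Omega>"
    and K [measurable]: "K \<in> borel_measurable (\<Omega> \<Otimes>\<^sub>M (lebesgue_n n \<Otimes>\<^sub>M lebesgue_n n))"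
    and kernels: "\<And>w. w \<in> space \<Omega> \<Longrightarrow> hermite_kernel n (b w) (\<mu> w) (\<lambda>z. K (w, z))"
    and bound: "(\<integral>\<^sup>+w. enorm (c w) * ennreal (b w) \<partial>\<Omega>) \<le> ennreal C" and C: "C > 0"
  shows "hermite_kernel n C (\<lambda>m. \<integral>w. c w * \<mu> w m \<partial>\<Omega>) (\<lambda>z. \<integral>w. c w * K (w, z) \<partial>\<Omega>)"
proof -
  let ?M = "lebesgue_n n" and ?k = "\<lambda>z. \<integral>w. c w * K (w, z) \<partial>\<Omega>"
  interpret \<Omega>: sigma_finite_measure \<Omega> by fact
  interpret M: sigma_finite_measure ?M by (rule sigma_finite_lebesgue_n)
  interpret P: pair_sigma_finite ?M \<Omega> by standard
  have row: "(\<integral>\<^sup>+y. enorm (K (w, x, y)) \<partial>?M) \<le> ennreal (b w)"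
    and column: "(\<integral>\<^sup>+y. enorm (K (w, y, x)) \<partial>?M) \<le> ennreal (b w)"
    if "w \<in> space \<Omega>" "x \<in> space ?M" for w x
    using schur_bounded.row_bound[OF hermite_kernelD(1)[OF kernels[OF that(1)]] that(2)]
      schur_bounded.column_bound[OF hermite_kernelD(1)[OF kernels[OF that(1)]] that(2)] by simp_all
  have mixed_bound: "(\<integral>\<^sup>+y. (\<integral>\<^sup>+w. enorm (c w * G w y) \<partial>\<Omega>) \<partial>?M) \<le> ennreal C"
    if G [measurable]: "(\<lambda>(y, w). G w y) \<in> borel_measurable (?M \<Otimes>\<^sub>M \<Omega>)"
      and Gb: "\<And>w. w \<in> space \<Omega> \<Longrightarrow> (\<integral>\<^sup>+y. enorm (G w y) \<partial>?M) \<le> ennreal (b w)" for G :: "'w \<Rightarrow> _ \<Rightarrow> complex"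
  proof -
    have "(\<integral>\<^sup>+y. (\<integral>\<^sup>+w. enorm (c w * G w y) \<partial>\<Omega>) \<partial>?M) = (\<integral>\<^sup>+w. (\<integral>\<^sup>+y. enorm (c w * G w y) \<partial>?M) \<partial>\<Omega>)"
      by (rule P.Fubini'[symmetric]) measurable
    also have "\<dots> \<le> (\<integral>\<^sup>+w. enorm (c w) * ennreal (b w) \<partial>\<Omega>)"
    proof (rule nn_integral_mono)
      fix w assume w [measurable]: "w \<in> space \<Omega>"
      have "(\<integral>\<^sup>+y. enorm (c w * G w y) \<partial>?M) = enorm (c w) * (\<integral>\<^sup>+y. enorm (G w y) \<partial>?M)"
        by (simp add: norm_mult ennreal_mult nn_integral_cmult)
      also have "\<dots> \<le> enorm (c w) * ennreal (b w)" by (intro mult_left_mono Gb w) auto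
      finally show "(\<integral>\<^sup>+y. enorm (c w * G w y) \<partial>?M) \<le> enorm (c w) * ennreal (b w)" .
    qed
    also note bound
    finally show ?thesis .
  qed
  have columns: "(\<integral>\<^sup>+x. (\<integral>\<^sup>+w. enorm (c w * K (w, x, y)) \<partial>\<Omega>) \<partial>?M) \<le> ennreal C"
    if [measurable]: "y \<in> space ?M" for y
    by (rule mixed_bound[OF _ column[OF _ that]]) measurable
  have "schur_bounded ?M ?k C"
  proof (rule schur_bounded.intro)
    show "?k \<in> borel_measurable (?M \<Otimes>\<^sub>M ?M)" by measurable
    fix x assume x [measurable]: "x \<in> space ?M"
    have rows: "(\<integral>\<^sup>+y. (\<integral>\<^sup>+w. enorm (c w * K (w, x, y)) \<partial>\<Omega>) \<partial>?M) \<le> ennreal C"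
      by (rule mixed_bound[OF _ row[OF _ x]]) measurable
    show "(\<integral>\<^sup>+y. enorm (\<integral>w. c w * K (w, x, y) \<partial>\<Omega>) \<partial>?M) \<le> ennreal C"
      by (rule order_trans[OF nn_integral_mono[OF ennreal_norm_integral_le] rows])
    show "(\<integral>\<^sup>+y. enorm (\<integral>w. c w * K (w, y, x) \<partial>\<Omega>) \<partial>?M) \<le> ennreal C"
      by (rule order_trans[OF nn_integral_mono[OF ennreal_norm_integral_le] columns[OF x]])
  qed (rule sigma_finite_lebesgue_n, rule C)
  moreover have "(\<integral>x. ?k (x, y) * hermite_fun n \<alpha> x \<partial>?M) = (\<integral>w. c w * \<mu> w m \<partial>\<Omega>) * hermite_fun n \<alpha> y"
    if \<alpha>: "\<alpha> \<in> multi_indices n m" and y [measurable]: "y \<in> space ?M" for m \<alpha> y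
  proof -
    let ?H = "hermite_fun n \<alpha>" and ?B = "(hermite_bound_const * (real m + 1)) ^ n"
    let ?f = "\<lambda>x w. c w * K (w, x, y) * ?H x"
    have int: "integrable (?M \<Otimes>\<^sub>M \<Omega>) (\<lambda>(x, w). ?f x w)"
    proof (rule integrableI_bounded)
      show meas [measurable]: "(\<lambda>(x, w). ?f x w) \<in> borel_measurable (?M \<Otimes>\<^sub>M \<Omega>)" by measurable
      have "(\<integral>\<^sup>+z. enorm (case z of (x, w) \<Rightarrow> ?f x w) \<partial>(?M \<Otimes>\<^sub>M \<Omega>)) = (\<integral>\<^sup>+x. (\<integral>\<^sup>+w. enorm (?f x w) \<partial>\<Omega>) \<partial>?M)"
        by (subst \<Omega>.nn_integral_fst[symmetric]) auto
      also have "\<dots> \<le> (\<integral>\<^sup>+x. (\<integral>\<^sup>+w. ennreal ?B * enorm (c w * K (w, x, y)) \<partial>\<Omega>) \<partial>?M)"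
      proof (intro nn_integral_mono)
        fix x w
        have "norm (?f x w) \<le> ?B * norm (c w * K (w, x, y))"
          using mult_right_mono[OF hermite_function_n_bounds(1)[OF \<alpha>, of x], of "norm (c w * K (w, x, y))"]
          by (simp add: norm_mult mult_ac)
        from ennreal_leI[OF this] show "enorm (?f x w) \<le> ennreal ?B * enorm (c w * K (w, x, y))"
          by (simp add: ennreal_mult hermite_bound_const_def)
      qed
      also have "\<dots> = (\<integral>\<^sup>+x. ennreal ?B * (\<integral>\<^sup>+w. enorm (c w * K (w, x, y)) \<partial>\<Omega>) \<partial>?M)"
        by (intro nn_integral_cong nn_integral_cmult) measurable
      also have "\<dots> = ennreal ?B * (\<integral>\<^sup>+x. (\<integral>\<^sup>+w. enorm (c w * K (w, x, y)) \<partial>\<Omega>) \<partial>?M)"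
        by (intro nn_integral_cmult) measurable
      also have "\<dots> \<le> ennreal ?B * ennreal C" by (intro mult_left_mono columns y) simp
      also have "\<dots> < \<infinity>" by (simp add: ennreal_mult_less_top)
      finally show "(\<integral>\<^sup>+z. enorm (case z of (x, w) \<Rightarrow> ?f x w) \<partial>(?M \<Otimes>\<^sub>M \<Omega>)) < \<infinity>" .
    qed
    have "(\<integral>x. ?k (x, y) * ?H x \<partial>?M) = (\<integral>x. (\<integral>w. ?f x w \<partial>\<Omega>) \<partial>?M)"
      by simp
    also have "\<dots> = (\<integral>w. (\<integral>x. ?f x w \<partial>?M) \<partial>\<Omega>)"
      by (rule P.Fubini_integral[symmetric]) (rule int)
    also have "\<dots> = (\<integral>w. c w * \<mu> w m * ?H y \<partial>\<Omega>)"
      using hermite_kernelD(2)[OF kernels \<alpha> y]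
      by (intro Bochner_Integration.integral_cong refl) (simp add: mult.assoc)
    finally show ?thesis by simp
  qed
  ultimately show ?thesis by (auto simp: hermite_kernel_def)
qed

lemma hermite_kernel_zero:
  assumes "C > 0"
  shows "hermite_kernel n C (\<lambda>m. 0) (\<lambda>z. 0)"
  using assms sigma_finite_lebesgue_n by (auto simp: hermite_kernel_def schur_bounded_def)

lemma hermite_kernel_mehler:
  assumes t: "t > 0"
  shows "hermite_kernel n ((1 / sqrt (cosh (2 * t))) ^ n) (\<lambda>m. of_real (exp (- (2 * real m + real n) * t)))
    (\<lambda>z. of_real (mehler_n n t (fst z) (snd z)))"
proof -
  let ?M = "lebesgue_n n" and ?k = "\<lambda>z. complex_of_real (mehler_n n t (fst z) (snd z))"
  have row: "(\<integral>\<^sup>+y. enorm (?k (x, y)) \<partial>?M) \<le> ennreal ((1 / sqrt (cosh (2 * t))) ^ n)" for x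
    using nn_integral_mehler_n_le[OF t] t by (simp add: mehler_n_nonneg)
  have "schur_bounded ?M ?k ((1 / sqrt (cosh (2 * t))) ^ n)"
  proof (rule schur_bounded.intro)
    show "sigma_finite_measure ?M" by (rule sigma_finite_lebesgue_n)
    show "?k \<in> borel_measurable (?M \<Otimes>\<^sub>M ?M)" by measurable
    show "(\<integral>\<^sup>+x. enorm (?k (x, y)) \<partial>?M) \<le> ennreal ((1 / sqrt (cosh (2 * t))) ^ n)" for y
      using row[of y] by (simp add: mehler_n_commute)
    show "(\<integral>\<^sup>+y. enorm (?k (x, y)) \<partial>?M) \<le> ennreal ((1 / sqrt (cosh (2 * t))) ^ n)" for x by (rule row)
  qed simp
  moreover have "(\<integral>x. ?k (x, y) * hermite_fun n \<alpha> x \<partial>?M) = of_real (exp (- (2 * real m + real n) * t)) * hermite_fun n \<alpha> y"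
    if "\<alpha> \<in> multi_indices n m" for \<alpha> m y
  proof -
    have "(\<integral>x. ?k (x, y) * hermite_fun n \<alpha> x \<partial>?M)
      = of_real (\<integral>x. mehler_n n t y x * hermite_function_n n \<alpha> x \<partial>?M)"
      by (simp add: mehler_n_commute[of n t _ y] flip: integral_complex_of_real)
    then show ?thesis using mehler_n_eigenfunction[OF t that] by simp
  qed
  ultimately show ?thesis by (simp add: hermite_kernel_def)
qed

text \<open>A multiple of the Erlang density, up to the value at zero.\<close>

lemma has_bochner_integral_power_exp:
  fixes l :: real
  assumes l: "l > 0"
  shows "has_bochner_integral lborel (\<lambda>t. if 0 < t then t ^ j / fact j * exp (- l * t) else 0) (1 / l ^ Suc j)"
proof -
  interpret prob_space "density lborel (erlang_density j l)" using l by (rule prob_space_erlang_density)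
  have "(\<integral>\<^sup>+t. ennreal (erlang_density j l t) \<partial>lborel) = ennreal 1"
    using emeasure_space_1 by (simp add: emeasure_density)
  then have "has_bochner_integral lborel (erlang_density j l) 1"
    using l by (intro has_bochner_integral_nn_integral) (auto simp: erlang_density_def)
  then have "has_bochner_integral lborel (\<lambda>t. 1 / l ^ Suc j * erlang_density j l t) (1 / l ^ Suc j * 1)"
    by (rule has_bochner_integral_mult_right)
  moreover have "AE t in lborel. 1 / l ^ Suc j * erlang_density j l t = (if 0 < t then t ^ j / fact j * exp (- l * t) else 0)"
    using AE_lborel_singleton[of "0::real"]
  proof eventually_elim
    case (elim t)
    then show ?case using l by (auto simp: erlang_density_def field_simps)
  qed
  ultimately show ?thesis
    by (subst (asm) has_bochner_integral_cong_AE) auto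
qed

text \<open>The operator is the integral of \<open>t\<^sup>j / j! exp (- t L)\<close>.  The measure space is the whole line, with a zero kernel for
  \<open>t \<le> 0\<close>, where there is no heat kernel.\<close>

lemma hermite_kernel_negative_power:
  assumes l: "0 < l" "l \<le> real n" and D: "D \<ge> 1"
    and decay: "\<And>t. t > 0 \<Longrightarrow> (1 / sqrt (cosh (2 * t))) ^ n \<le> D * exp (- l * t)"
  shows "\<exists>k. hermite_kernel n (D / l ^ Suc j) (\<lambda>m. 1 / of_nat (2 * m + n) ^ Suc j) k"
proof -
  let ?M = "lebesgue_n n"
  let ?c = "\<lambda>t. complex_of_real (if 0 < t then t ^ j / fact j else 0)"
  let ?b = "\<lambda>t::real. if 0 < t then (1 / sqrt (cosh (2 * t))) ^ n else 1"
  let ?K = "\<lambda>w. complex_of_real (if 0 < fst w then mehler_n n (fst w) (fst (snd w)) (snd (snd w)) else 0)"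
  let ?\<mu> = "\<lambda>t m. complex_of_real (if 0 < t then exp (- (2 * real m + real n) * t) else 0)"
  have "hermite_kernel n (D / l ^ Suc j) (\<lambda>m. \<integral>t. ?c t * ?\<mu> t m \<partial>lborel) (\<lambda>z. \<integral>t. ?c t * ?K (t, z) \<partial>lborel)"
  proof (rule hermite_kernel_superposition[where b = ?b])
    show "?K \<in> borel_measurable (lborel \<Otimes>\<^sub>M (?M \<Otimes>\<^sub>M ?M))" by measurable
    show "?b \<in> borel_measurable lborel" unfolding cosh_def by measurable
    show "hermite_kernel n (?b t) (?\<mu> t) (\<lambda>z. ?K (t, z))" for t
      using hermite_kernel_mehler[of t n] hermite_kernel_zero[of 1 n] by (cases "0 < t") simp_all
    have "(\<integral>\<^sup>+t. enorm (?c t) * ennreal (?b t) \<partial>lborel)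
       \<le> (\<integral>\<^sup>+t. ennreal (D * (if 0 < t then t ^ j / fact j * exp (- l * t) else 0)) \<partial>lborel)"
    proof (rule nn_integral_mono)
      fix t :: real
      have "norm (?c t) * ?b t \<le> D * (if 0 < t then t ^ j / fact j * exp (- l * t) else 0)"
        using mult_left_mono[OF decay[of t], of "t ^ j / fact j"] by (auto simp: mult_ac)
      note le = ennreal_leI[OF this]
      have b0: "0 \<le> ?b t" by simp
      show "enorm (?c t) * ennreal (?b t) \<le> ennreal (D * (if 0 < t then t ^ j / fact j * exp (- l * t) else 0))"
        unfolding ennreal_mult[OF norm_ge_zero b0, symmetric] by (rule le)
    qed
    also have "\<dots> = ennreal (D * (1 / l ^ Suc j))"
    proof -
      have "has_bochner_integral lborel (\<lambda>t. D * (if 0 < t then t ^ j / fact j * exp (- l * t) else 0)) (D * (1 / l ^ Suc j))"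
        by (intro has_bochner_integral_mult_right has_bochner_integral_power_exp l)
      then show ?thesis using D
        by (subst nn_integral_eq_integral) (auto simp: has_bochner_integral_iff)
    qed
    finally show "(\<integral>\<^sup>+t. enorm (?c t) * ennreal (?b t) \<partial>lborel) \<le> ennreal (D / l ^ Suc j)" by simp
  qed (use l D in \<open>auto simp: lborel.sigma_finite_measure_axioms\<close>)
  moreover have "(\<integral>t. ?c t * ?\<mu> t m \<partial>lborel) = 1 / of_nat (2 * m + n) ^ Suc j" for m
  proof -
    have L: "0 < 2 * real m + real n" using l by simp
    have "(\<integral>t. ?c t * ?\<mu> t m \<partial>lborel)
      = of_real (\<integral>t. (if 0 < t then t ^ j / fact j * exp (- (2 * real m + real n) * t) else 0) \<partial>lborel)"
      by (subst integral_complex_of_real[symmetric]) (intro Bochner_Integration.integral_cong refl, auto)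
    also have "(\<integral>t. (if 0 < t then t ^ j / fact j * exp (- (2 * real m + real n) * t) else 0) \<partial>lborel)
      = 1 / (2 * real m + real n) ^ Suc j"
      using has_bochner_integral_power_exp[OF L, of j] by (simp only: has_bochner_integral_iff)
    finally show ?thesis by simp
  qed
  ultimately show ?thesis by auto
qed

text \<open>A superposition over the counting measure; the bound on the eigenvalues turns its integral into a convergent series.\<close>

lemma hermite_kernel_series:
  fixes d :: "nat \<Rightarrow> complex"
  assumes kernels: "\<And>j. hermite_kernel n (b j) (\<mu> j) (k j)"
    and eigenvalue_le: "\<And>j m. norm (\<mu> j m) \<le> b j"
    and summable: "summable (\<lambda>j. norm (d j) * b j)"
  shows "\<exists>K. hermite_kernel n ((\<Sum>j. norm (d j) * b j) + 1) (\<lambda>m. \<Sum>j. d j * \<mu> j m) K"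
proof -
  let ?M = "lebesgue_n n" and ?C = "(\<Sum>j. norm (d j) * b j) + 1"
  have b: "b j > 0" for j using schur_bounded.C_pos[OF hermite_kernelD(1)[OF kernels]] .
  have S: "(\<Sum>j. norm (d j) * b j) \<ge> 0" using b by (intro suminf_nonneg summable) (simp add: less_imp_le)
  have "hermite_kernel n ?C (\<lambda>m. \<integral>j. d j * \<mu> j m \<partial>count_space UNIV)
     (\<lambda>z. \<integral>j. d j * (\<lambda>w. k (fst w) (snd w)) (j, z) \<partial>count_space UNIV)"
  proof (rule hermite_kernel_superposition[where b = b])
    show "sigma_finite_measure (count_space (UNIV :: nat set))"
      by (rule sigma_finite_measure_count_space)
    show "(\<lambda>w. k (fst w) (snd w)) \<in> borel_measurable (count_space UNIV \<Otimes>\<^sub>M (?M \<Otimes>\<^sub>M ?M))"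
      using schur_bounded.kernel_measurable[OF hermite_kernelD(1)[OF kernels]]
      by (intro measurable_pair_measure_countable1) auto
    show "hermite_kernel n (b j) (\<mu> j) (\<lambda>z. k (fst (j, z)) (snd (j, z)))" for j
      using kernels[of j] by simp
    have "(\<integral>\<^sup>+j. enorm (d j) * ennreal (b j) \<partial>count_space UNIV) = (\<Sum>j. ennreal (norm (d j) * b j))"
      using b by (simp add: nn_integral_count_space_nat ennreal_mult less_imp_le)
    also have "\<dots> = ennreal (\<Sum>j. norm (d j) * b j)"
      using b summable by (intro suminf_ennreal2) (auto simp: less_imp_le)
    also have "\<dots> \<le> ennreal ?C" by (intro ennreal_leI) simp
    finally show "(\<integral>\<^sup>+j. enorm (d j) * ennreal (b j) \<partial>count_space UNIV) \<le> ennreal ?C" .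
  qed (use S in auto)
  moreover have "(\<integral>j. d j * \<mu> j m \<partial>count_space UNIV) = (\<Sum>j. d j * \<mu> j m)" for m
  proof (rule integral_count_space_nat)
    have "summable (\<lambda>j. norm (d j * \<mu> j m))"
      using eigenvalue_le
      by (intro summable_comparison_test[OF _ summable] exI[of _ 0]) (auto simp: norm_mult intro: mult_left_mono)
    then show "integrable (count_space UNIV) (\<lambda>j. d j * \<mu> j m)"
      by (simp add: integrable_count_space_nat_iff)
  qed
  ultimately show ?thesis by auto
qed

lemma card_multi_indices_le: "card (multi_indices n m) \<le> (m + 1) ^ n"
proof -
  have sub: "multi_indices n m \<subseteq> {..<n} \<rightarrow>\<^sub>E {..m}"
    unfolding multi_indices_def by (fastforce intro!: PiE_I member_le_sum dest: PiE_arb)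
  have "card (multi_indices n m) \<le> card ({..<n} \<rightarrow>\<^sub>E {..m})"
    by (intro card_mono sub finite_PiE) auto
  then show ?thesis by (simp add: card_PiE)
qed

definition projection_bound :: "nat \<Rightarrow> nat \<Rightarrow> real" where
  "projection_bound n m = hermite_bound_const ^ (2 * n) * (real m + 1) ^ (3 * n)"

text \<open>Each summand contributes the supremum of one factor times the \<open>L\<^sup>1\<close> norm of the other.\<close>

lemma hermite_kernel_projection:
  "hermite_kernel n (projection_bound n j) (\<lambda>m. if m = j then 1 else 0)
     (\<lambda>z. \<Sum>\<beta>\<in>multi_indices n j. hermite_fun n \<beta> (fst z) * hermite_fun n \<beta> (snd z))"
proof -
  let ?M = "lebesgue_n n" and ?S = "multi_indices n j"
  let ?k = "\<lambda>z. \<Sum>\<beta>\<in>?S. hermite_fun n \<beta> (fst z) * hermite_fun n \<beta> (snd z)"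
  let ?B = "(hermite_bound_const * (real j + 1)) ^ n"
  have B: "?B \<ge> 0" by (simp add: hermite_bound_const_def)
  have row: "(\<integral>\<^sup>+y. enorm (?k (x, y)) \<partial>?M) \<le> ennreal (projection_bound n j)" for x
  proof -
    have "(\<integral>\<^sup>+y. enorm (?k (x, y)) \<partial>?M) \<le> (\<integral>\<^sup>+y. ennreal (\<Sum>\<beta>\<in>?S. ?B * \<bar>hermite_function_n n \<beta> y\<bar>) \<partial>?M)"
    proof (intro nn_integral_mono ennreal_leI)
      fix y
      have "norm (?k (x, y)) \<le> (\<Sum>\<beta>\<in>?S. norm (hermite_fun n \<beta> x * hermite_fun n \<beta> y))"
        by (simp add: norm_sum)
      also have "\<dots> \<le> (\<Sum>\<beta>\<in>?S. ?B * \<bar>hermite_function_n n \<beta> y\<bar>)"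
        unfolding norm_mult norm_of_real by (intro sum_mono mult_right_mono hermite_function_n_bounds(1)) auto
      finally show "norm (?k (x, y)) \<le> (\<Sum>\<beta>\<in>?S. ?B * \<bar>hermite_function_n n \<beta> y\<bar>)" .
    qed
    also have "\<dots> = ennreal (\<integral>y. (\<Sum>\<beta>\<in>?S. ?B * \<bar>hermite_function_n n \<beta> y\<bar>) \<partial>?M)"
      using B by (intro nn_integral_eq_integral) (auto intro!: Bochner_Integration.integrable_sum integrable_hermite_function_n sum_nonneg)
    also have "(\<integral>y. (\<Sum>\<beta>\<in>?S. ?B * \<bar>hermite_function_n n \<beta> y\<bar>) \<partial>?M) = (\<Sum>\<beta>\<in>?S. ?B * (\<integral>y. \<bar>hermite_function_n n \<beta> y\<bar> \<partial>?M))"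
      by (subst Bochner_Integration.integral_sum) (auto intro: integrable_hermite_function_n)
    also have "\<dots> \<le> (\<Sum>\<beta>\<in>?S. ?B * ?B)"
      using B by (intro sum_mono mult_left_mono hermite_function_n_bounds(2)) auto
    also have "\<dots> = real (card ?S) * (?B * ?B)" by simp
    also have "\<dots> \<le> real ((j + 1) ^ n) * (?B * ?B)"
      by (intro mult_right_mono of_nat_mono card_multi_indices_le) simp
    also have "\<dots> = projection_bound n j"
    proof -
      have "real ((j + 1) ^ n) = (real j + 1) ^ n" by (simp add: add.commute)
      moreover have "3 * n = n + (n + n)" "2 * n = n + n" by simp_all
      ultimately show ?thesis
        unfolding projection_bound_def by (simp only: power_add power_mult_distrib mult_ac)
    qed
    finally show ?thesis by (auto intro: ennreal_leI)
  qed
  have "schur_bounded ?M ?k (projection_bound n j)"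
  proof (rule schur_bounded.intro)
    show "sigma_finite_measure ?M" by (rule sigma_finite_lebesgue_n)
    show "?k \<in> borel_measurable (?M \<Otimes>\<^sub>M ?M)" by measurable
    show "(\<integral>\<^sup>+x. enorm (?k (x, y)) \<partial>?M) \<le> ennreal (projection_bound n j)" for y
      using row[of y] by (simp add: mult.commute)
    show "projection_bound n j > 0" by (simp add: projection_bound_def hermite_bound_const_def add_nonneg_pos)
    show "(\<integral>\<^sup>+y. enorm (?k (x, y)) \<partial>?M) \<le> ennreal (projection_bound n j)" for x by (rule row)
  qed
  moreover have "(\<integral>x. ?k (x, y) * hermite_fun n \<alpha> x \<partial>?M) = (if m = j then 1 else 0) * hermite_fun n \<alpha> y"
    if \<alpha>: "\<alpha> \<in> multi_indices n m" for \<alpha> m y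
  proof -
    have "(\<integral>x. ?k (x, y) * hermite_fun n \<alpha> x \<partial>?M) = hermite_coeff n (\<lambda>x. \<Sum>\<beta>\<in>?S. hermite_fun n \<beta> y * hermite_fun n \<beta> x) \<alpha>"
      by (simp add: hermite_coeff_def mult.commute)
    also have "\<dots> = (if \<alpha> \<in> ?S then hermite_fun n \<alpha> y else 0)"
      using \<alpha> multi_indices_subset by (intro hermite_coeff_hermite_sum finite_multi_indices) auto
    finally show ?thesis using \<alpha> by (auto simp: multi_indices_def)
  qed
  ultimately show ?thesis by (simp add: hermite_kernel_def)
qed

section \<open>Multipliers analytic at infinity\<close>

text \<open>A superposition over a space of two points.\<close>

lemma hermite_kernel_add:
  assumes k: "hermite_kernel n C \<mu> k" and h: "hermite_kernel n D \<nu> h"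
  shows "\<exists>K. hermite_kernel n (C + D) (\<lambda>m. \<mu> m + \<nu> m) K"
proof -
  let ?M = "lebesgue_n n" and ?B = "count_space (UNIV :: bool set)"
  let ?b = "\<lambda>w. if w then C else D" and ?\<mu> = "\<lambda>w. if w then \<mu> else \<nu>" and ?K = "\<lambda>w z. if w then k z else h z"
  have pos: "C > 0" "D > 0"
    using schur_bounded.C_pos[OF hermite_kernelD(1)[OF k]] schur_bounded.C_pos[OF hermite_kernelD(1)[OF h]] by auto
  have "hermite_kernel n (C + D) (\<lambda>m. \<integral>w. 1 * ?\<mu> w m \<partial>?B) (\<lambda>z. \<integral>w. 1 * (\<lambda>v. ?K (fst v) (snd v)) (w, z) \<partial>?B)"
  proof (rule hermite_kernel_superposition[where b = ?b])
    show "sigma_finite_measure ?B" by (rule sigma_finite_measure_count_space)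
    have "k \<in> borel_measurable (?M \<Otimes>\<^sub>M ?M)" "h \<in> borel_measurable (?M \<Otimes>\<^sub>M ?M)"
      using schur_bounded.kernel_measurable[OF hermite_kernelD(1)[OF k]] schur_bounded.kernel_measurable[OF hermite_kernelD(1)[OF h]] by auto
    then have "(\<lambda>z. ?K (fst (w, z)) (snd (w, z))) \<in> borel_measurable (?M \<Otimes>\<^sub>M ?M)" for w
      by (cases w) auto
    then show "(\<lambda>v. ?K (fst v) (snd v)) \<in> borel_measurable (?B \<Otimes>\<^sub>M (?M \<Otimes>\<^sub>M ?M))"
      by (intro measurable_pair_measure_countable1) auto
    show "hermite_kernel n (?b w) (?\<mu> w) (\<lambda>z. ?K (fst (w, z)) (snd (w, z)))" for w
      using k h by (cases w) auto
    show "(\<integral>\<^sup>+w. ennreal (norm (1::complex)) * ennreal (?b w) \<partial>?B) \<le> ennreal (C + D)"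
      using pos by (simp add: nn_integral_count_space_finite UNIV_bool add.commute)
  qed (use pos in auto)
  moreover have "(\<integral>w. 1 * ?\<mu> w m \<partial>?B) = \<mu> m + \<nu> m" for m
    by (simp add: lebesgue_integral_count_space_finite UNIV_bool add.commute)
  ultimately show ?thesis by auto
qed

text \<open>Taylor expansion at zero; the terms at a point inside the disc of convergence are bounded, which gives the geometric estimate.\<close>

lemma analytic_at_infinity_expansion:
  assumes "analytic_at_infinity \<Psi>"
  obtains a :: "nat \<Rightarrow> complex" and A R :: real and k0 :: nat
  where "A \<ge> 0" "R > 0" "real k0 > R" "\<And>j. norm (a j) \<le> A * R ^ j"
    "\<And>k. k \<ge> k0 \<Longrightarrow> (\<lambda>j. a j / of_nat k ^ j) sums \<Psi> k"
proof -
  obtain \<Phi> where an: "\<Phi> analytic_on {0}" and ev: "\<forall>\<^sub>F k in sequentially. \<Psi> k = \<Phi> (1 / of_nat k)"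
    using assms unfolding analytic_at_infinity_def by blast
  obtain r where r: "r > 0" and hol: "\<Phi> holomorphic_on ball 0 r"
    using an unfolding analytic_on_def by auto
  define a where "a j = (deriv ^^ j) \<Phi> 0 / fact j" for j
  \<comment> \<open>\<open>1 / R\<close> lies strictly inside the disc of convergence\<close>
  define R where "R = 2 / r"
  have series: "(\<lambda>j. a j * w ^ j) sums \<Phi> w" if "norm w < r" for w
    using holomorphic_power_series[OF hol, of w] that by (simp add: a_def)
  have R: "R > 0" using r by (simp add: R_def)
  have "(\<lambda>j. a j * of_real (1 / R) ^ j) sums \<Phi> (of_real (1 / R))"
    using r by (intro series) (simp add: R_def)
  then have "Bseq (\<lambda>j. a j * of_real (1 / R) ^ j)"
    by (intro convergent_imp_Bseq convergentI[OF summable_LIMSEQ_zero] sums_summable)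
  then obtain A where A: "A > 0" "\<And>j. norm (a j * of_real (1 / R) ^ j) \<le> A"
    by (auto simp: Bseq_def)
  have bound: "norm (a j) \<le> A * R ^ j" for j
  proof -
    have "norm (a j) * (1 / R) ^ j \<le> A" using A(2)[of j] R by (simp add: norm_mult norm_power norm_divide)
    then show ?thesis using R by (simp add: field_simps)
  qed
  obtain k1 where k1: "\<And>k. k \<ge> k1 \<Longrightarrow> \<Psi> k = \<Phi> (1 / of_nat k)"
    using ev by (auto simp: eventually_sequentially)
  obtain k2 :: nat where k2: "R < real k2" using reals_Archimedean2 by blast
  define k0 where "k0 = max k1 k2"
  have sums: "(\<lambda>j. a j / of_nat k ^ j) sums \<Psi> k" if "k \<ge> k0" for k
  proof -
    have kR: "R < real k" using k2 that by (simp add: k0_def)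
    moreover have "0 < real k" using kR R by linarith
    ultimately have "1 / real k < r" using r by (simp add: R_def field_simps)
    then have "(\<lambda>j. a j * (1 / of_nat k) ^ j) sums \<Phi> (1 / of_nat k)"
      by (intro series) (simp add: norm_divide)
    then show ?thesis using k1[of k] that by (simp add: k0_def power_divide)
  qed
  show ?thesis
    by (rule that[of A R k0 a]) (use A R bound sums k2 in \<open>auto simp: k0_def\<close>)
qed

lemma inverse_sqrt_cosh_bounds:
  fixes t :: real
  shows "0 \<le> 1 / sqrt (cosh (2 * t))" "1 / sqrt (cosh (2 * t)) \<le> 1" "1 / sqrt (cosh (2 * t)) \<le> sqrt 2 * exp (- t)"
proof -
  have "exp (2 * t) / 2 \<le> cosh (2 * t)" by (simp add: cosh_field_def)
  then have "sqrt (exp (2 * t) / 2) \<le> sqrt (cosh (2 * t))" by (rule real_sqrt_le_mono)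
  moreover have "sqrt (exp (2 * t) / 2) = exp t / sqrt 2" by (simp add: real_sqrt_divide exp_double)
  ultimately have "exp t / sqrt 2 \<le> sqrt (cosh (2 * t))" by simp
  then have "1 / sqrt (cosh (2 * t)) \<le> 1 / (exp t / sqrt 2)" by (intro divide_left_mono) auto
  then show "1 / sqrt (cosh (2 * t)) \<le> sqrt 2 * exp (- t)" by (simp add: exp_minus field_simps)
  show "1 / sqrt (cosh (2 * t)) \<le> 1" using cosh_real_ge_1[of "2 * t"] by simp
qed simp

text \<open>The bound contains \<open>N\<close> but not \<open>n\<close>: the bound for the mass of the heat kernel decreases with the dimension, because
  \<open>cosh (2 t) \<ge> 1\<close>, and so it is enough to use the decay in dimension \<open>N\<close>.\<close>

lemma hermite_kernel_negative_power_series: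
  fixes d :: "nat \<Rightarrow> complex"
  assumes N: "1 \<le> N" "N \<le> n" and summable: "summable (\<lambda>j. norm (d j) * (sqrt 2 ^ N / real N ^ Suc j))"
  shows "\<exists>K. hermite_kernel n ((\<Sum>j. norm (d j) * (sqrt 2 ^ N / real N ^ Suc j)) + 1)
    (\<lambda>m. \<Sum>j. d j * (1 / of_nat (2 * m + n) ^ Suc j)) K"
proof -
  have decay: "(1 / sqrt (cosh (2 * t))) ^ n \<le> sqrt 2 ^ N * exp (- real N * t)" for t :: real
  proof -
    have "(1 / sqrt (cosh (2 * t))) ^ n \<le> (1 / sqrt (cosh (2 * t))) ^ N"
      by (intro power_decreasing N inverse_sqrt_cosh_bounds)
    also have "\<dots> \<le> (sqrt 2 * exp (- t)) ^ N"
      by (intro power_mono inverse_sqrt_cosh_bounds)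
    also have "\<dots> = sqrt 2 ^ N * exp (real N * - t)" unfolding power_mult_distrib exp_of_nat_mult ..
    finally show ?thesis by simp
  qed
  have D: "1 \<le> sqrt 2 ^ N" by (intro one_le_power) simp
  have "\<exists>k. \<forall>j. hermite_kernel n (sqrt 2 ^ N / real N ^ Suc j) (\<lambda>m. 1 / of_nat (2 * m + n) ^ Suc j) (k j)"
    using N D decay by (intro choice allI hermite_kernel_negative_power) auto
  then obtain k where k: "\<And>j. hermite_kernel n (sqrt 2 ^ N / real N ^ Suc j) (\<lambda>m. 1 / of_nat (2 * m + n) ^ Suc j) (k j)"
    by blast
  show ?thesis
  proof (rule hermite_kernel_series[OF k _ summable])
    fix j m
    have "real N ^ Suc j \<le> real (2 * m + n) ^ Suc j" using N by (intro power_mono) auto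
    then have "1 / real (2 * m + n) ^ Suc j \<le> sqrt 2 ^ N / real N ^ Suc j"
      using N D by (intro frac_le) auto
    then show "norm (1 / complex_of_nat (2 * m + n) ^ Suc j) \<le> sqrt 2 ^ N / real N ^ Suc j"
      by (simp only: norm_divide norm_power norm_of_nat norm_one)
  qed
qed

lemma uniform_bound_large_dimension:
  assumes coeffs: "\<And>j. norm (a j) \<le> A * R ^ j" and R: "0 < R" "R < real k0" and A: "A \<ge> 0"
    and sums: "\<And>k. k \<ge> k0 \<Longrightarrow> (\<lambda>j. a j / of_nat k ^ j) sums \<Psi> k"
  shows "\<exists>C. \<forall>n\<ge>k0. uniformly_bounded_multiplier n \<Psi> C"
proof -
  let ?b = "\<lambda>j. norm (a (Suc j)) * (sqrt 2 ^ k0 / real k0 ^ Suc j)"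
  have k0: "1 \<le> k0" using R by (cases k0) auto
  have summable: "summable ?b"
  proof (rule summable_comparison_test)
    show "\<exists>N. \<forall>j\<ge>N. norm (?b j) \<le> sqrt 2 ^ k0 * A * (R / real k0) ^ Suc j"
    proof (intro exI allI impI)
      fix j
      have "?b j \<le> (A * R ^ Suc j) * (sqrt 2 ^ k0 / real k0 ^ Suc j)"
        by (intro mult_right_mono coeffs) simp
      also have "\<dots> = sqrt 2 ^ k0 * A * (R / real k0) ^ Suc j" by (simp add: power_divide)
      finally show "norm (?b j) \<le> sqrt 2 ^ k0 * A * (R / real k0) ^ Suc j" by simp
    qed
    have "norm (R / real k0) < 1" using R by simp
    then show "summable (\<lambda>j. sqrt 2 ^ k0 * A * (R / real k0) ^ Suc j)"
      by (intro summable_mult) (simp only: summable_Suc_iff summable_geometric)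
  qed
  have "uniformly_bounded_multiplier n \<Psi> (norm (a 0) + (suminf ?b + 1))" if n: "n \<ge> k0" for n
  proof -
    obtain K where "hermite_kernel n (suminf ?b + 1) (\<lambda>m. \<Sum>j. a (Suc j) * (1 / of_nat (2 * m + n) ^ Suc j)) K"
      using hermite_kernel_negative_power_series[OF k0 n summable] by blast
    moreover have "\<Psi> (2 * m + n) = a 0 + (\<Sum>j. a (Suc j) * (1 / of_nat (2 * m + n) ^ Suc j))" for m
    proof -
      have s: "(\<lambda>j. a j / of_nat (2 * m + n) ^ j) sums \<Psi> (2 * m + n)" using n by (intro sums) simp
      then have "\<Psi> (2 * m + n) = (\<Sum>j. a j / of_nat (2 * m + n) ^ j)" by (rule sums_unique)
      also have "\<dots> = a 0 + (\<Sum>j. a (Suc j) / of_nat (2 * m + n) ^ Suc j)"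
        using suminf_split_head[OF sums_summable[OF s]] by simp
      finally show ?thesis by simp
    qed
    ultimately show ?thesis by (rule uniformly_bounded_multiplier_kernel)
  qed
  then show ?thesis by blast
qed

lemma power_series_tail_bound:
  fixes a :: "nat \<Rightarrow> complex"
  assumes coeffs: "\<And>j. norm (a j) \<le> A * R ^ j" and R: "0 < R" "2 * R \<le> k" and A: "A \<ge> 0"
    and sums: "(\<lambda>j. a j / of_real k ^ j) sums s"
  shows "norm (s - (\<Sum>j<J. a j / of_real k ^ j)) \<le> 2 * A * (R / k) ^ J"
proof -
  define q where "q = R / k"
  have k: "k > 0" using R by simp
  have q: "0 \<le> q" "q \<le> 1 / 2" using R k by (auto simp: q_def field_simps)
  have le: "norm (a (j + J) / of_real k ^ (j + J)) \<le> A * q ^ J * q ^ j" for j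
  proof -
    have "norm (a (j + J) / of_real k ^ (j + J)) = norm (a (j + J)) / k ^ (j + J)"
      using k by (simp add: norm_divide norm_power)
    also have "\<dots> \<le> A * R ^ (j + J) / k ^ (j + J)"
      using k by (intro divide_right_mono coeffs) simp
    also have "\<dots> = A * q ^ J * q ^ j" by (simp add: q_def power_divide power_add mult_ac)
    finally show ?thesis .
  qed
  have geo: "(\<lambda>j. A * q ^ J * q ^ j) sums (A * q ^ J * (1 / (1 - q)))"
    using q by (intro sums_mult geometric_sums) simp
  have "s - (\<Sum>j<J. a j / of_real k ^ j) = (\<Sum>j. a (j + J) / of_real k ^ (j + J))"
    using sums_unique[OF sums_split_initial_segment[OF sums, of J]] by simp
  also have "norm \<dots> \<le> (\<Sum>j. A * q ^ J * q ^ j)"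
    by (rule norm_suminf_le[OF le sums_summable[OF geo]])
  also have "\<dots> = A * q ^ J * (1 / (1 - q))" by (rule sums_unique[OF geo, symmetric])
  also have "\<dots> \<le> A * q ^ J * 2"
    using q A by (intro mult_left_mono) (auto simp: field_simps)
  finally show ?thesis by (simp add: q_def mult_ac)
qed

text \<open>A partial sum of the expansion is treated by the powers of \<open>L\<close>, the remainder by projections onto eigenspaces.  The
  remainder includes the whole deviation for those \<open>k\<close> at which the expansion is not valid.\<close>

lemma bound_fixed_dimension:
  assumes coeffs: "\<And>j. norm (a j) \<le> A * R ^ j" and R: "0 < R" and A: "A \<ge> 0"
    and sums: "\<And>k. k \<ge> k0 \<Longrightarrow> (\<lambda>j. a j / of_nat k ^ j) sums \<Psi> k" and n: "n \<ge> 1"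
  shows "\<exists>C. uniformly_bounded_multiplier n \<Psi> C"
proof -
  \<comment> \<open>projection bounds grow like the power \<open>3 n\<close>, so the remainder is taken two orders smaller\<close>
  define J where "J = 3 * n + 1"
  define d where "d j = (if j < J then a (Suc j) else 0)" for j
  define S where "S m = (\<Sum>j. d j * (1 / of_nat (2 * m + n) ^ Suc j))" for m
  define r where "r m = \<Psi> (2 * m + n) - a 0 - S m" for m
  have "summable (\<lambda>j. norm (d j) * (sqrt 2 ^ 1 / real 1 ^ Suc j))"
    by (rule summable_finite[of "{..<J}"]) (auto simp: d_def)
  from hermite_kernel_negative_power_series[OF order_refl n this]
  obtain K1 where K1: "hermite_kernel n ((\<Sum>j. norm (d j) * (sqrt 2 ^ 1 / real 1 ^ Suc j)) + 1) S K1"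
    unfolding S_def by blast
  have S: "a 0 + S m = (\<Sum>j<Suc J. a j / of_nat (2 * m + n) ^ j)" for m
  proof -
    have "S m = (\<Sum>j<J. d j * (1 / of_nat (2 * m + n) ^ Suc j))"
      unfolding S_def by (intro suminf_finite) (auto simp: d_def)
    also have "\<dots> = (\<Sum>j<J. a (Suc j) / of_nat (2 * m + n) ^ Suc j)"
      by (intro sum.cong) (auto simp: d_def)
    finally show ?thesis unfolding sum.lessThan_Suc_shift by simp
  qed
  have tail: "norm (r m) * projection_bound n m \<le> 2 * A * R ^ Suc J * hermite_bound_const ^ (2 * n) * inverse (real (Suc m) ^ 2)"
    if m: "2 * m + n \<ge> k0" "2 * R \<le> real (2 * m + n)" for m
  proof -
    let ?k = "real (2 * m + n)"
    have "norm (r m) = norm (\<Psi> (2 * m + n) - (\<Sum>j<Suc J. a j / of_real ?k ^ j))"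
      using S[of m] by (simp only: r_def diff_diff_eq of_real_of_nat_eq)
    also have "\<dots> \<le> 2 * A * (R / ?k) ^ Suc J"
      using sums[OF m(1)] by (intro power_series_tail_bound coeffs R A m) (simp only: of_real_of_nat_eq)
    also have "\<dots> \<le> 2 * A * (R / real (Suc m)) ^ Suc J"
      using A R n by (intro mult_left_mono power_mono divide_left_mono) auto
    finally have "norm (r m) * projection_bound n m
      \<le> 2 * A * (R / real (Suc m)) ^ Suc J * (hermite_bound_const ^ (2 * n) * real (Suc m) ^ (3 * n))"
      unfolding projection_bound_def
      by (intro mult_mono) (auto simp: A R hermite_bound_const_def less_imp_le add.commute)
    also have "\<dots> = 2 * A * R ^ Suc J * hermite_bound_const ^ (2 * n) * (real (Suc m) ^ (3 * n) / real (Suc m) ^ Suc J)"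
      by (simp only: power_divide) simp
    also have "real (Suc m) ^ (3 * n) / real (Suc m) ^ Suc J = inverse (real (Suc m) ^ 2)"
    proof -
      have "x ^ Suc J = x ^ (3 * n) * x ^ 2" for x :: real
        unfolding J_def by (simp add: power_add power2_eq_square)
      then show ?thesis by (simp add: inverse_eq_divide del: of_nat_Suc)
    qed
    finally show ?thesis .
  qed
  have summable_r: "summable (\<lambda>m. norm (r m) * projection_bound n m)"
  proof (rule summable_comparison_test_ev)
    obtain m0 :: nat where m0: "max (real k0) (2 * R) < real m0" using reals_Archimedean2 by blast
    show "\<forall>\<^sub>F m in sequentially. norm (norm (r m) * projection_bound n m)
        \<le> 2 * A * R ^ Suc J * hermite_bound_const ^ (2 * n) * inverse (real (Suc m) ^ 2)"
      using eventually_ge_at_top[of m0]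
    proof eventually_elim
      case (elim m)
      have "projection_bound n m \<ge> 0" by (simp add: projection_bound_def hermite_bound_const_def)
      moreover have "2 * m + n \<ge> k0" "2 * R \<le> real (2 * m + n)" using m0 elim by auto
      ultimately show ?case using tail[of m] by simp
    qed
    have "summable (\<lambda>m. inverse (real (Suc m) ^ 2))"
      using inverse_power_summable[of 2, where 'a = real] by (subst summable_Suc_iff) auto
    then show "summable (\<lambda>m. 2 * A * R ^ Suc J * hermite_bound_const ^ (2 * n) * inverse (real (Suc m) ^ 2))"
      by (rule summable_mult)
  qed
  have le: "norm (if m = j then 1 else 0 :: complex) \<le> projection_bound n j" for j m
  proof -
    have "1 \<le> projection_bound n j"
      unfolding projection_bound_def
      by (intro mult_ge1_I one_le_power) (auto simp: hermite_bound_const_def)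
    then show ?thesis by auto
  qed
  from hermite_kernel_series[OF hermite_kernel_projection le summable_r]
  obtain K2 where K2: "hermite_kernel n ((\<Sum>m. norm (r m) * projection_bound n m) + 1) (\<lambda>m. \<Sum>j. r j * (if m = j then 1 else 0)) K2"
    by blast
  obtain K where "hermite_kernel n (((\<Sum>j. norm (d j) * (sqrt 2 ^ 1 / real 1 ^ Suc j)) + 1) + ((\<Sum>m. norm (r m) * projection_bound n m) + 1))
      (\<lambda>m. S m + (\<Sum>j. r j * (if m = j then 1 else 0))) K"
    using hermite_kernel_add[OF K1 K2] by blast
  moreover have "\<Psi> (2 * m + n) = a 0 + (S m + (\<Sum>j. r j * (if m = j then 1 else 0)))" for m
  proof -
    have "(\<Sum>j. r j * (if m = j then 1 else 0)) = (\<Sum>j\<in>{m}. r j * (if m = j then 1 else 0))"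
      by (intro suminf_finite) auto
    then show ?thesis by (simp add: r_def)
  qed
  ultimately show ?thesis by (blast intro: uniformly_bounded_multiplier_kernel)
qed

theorem theorem2:
  fixes \<Psi> :: "nat \<Rightarrow> complex"
  assumes "analytic_at_infinity \<Psi>"
  shows "\<exists>C::real. 0 \<le> C \<and>
    (\<forall>p::ennreal. \<forall>n::nat. 1 \<le> p \<longrightarrow> 1 \<le> n \<longrightarrow>
      (\<forall>f \<in> Lp_space 2 (lebesgue_n n) \<inter> Lp_space p (lebesgue_n n).
        (\<exists>g. is_hermite_multiplier n \<Psi> f g) \<and>
        (\<forall>g. is_hermite_multiplier n \<Psi> f g \<longrightarrow>
          Lp_norm p (lebesgue_n n) g \<le> ennreal C * Lp_norm p (lebesgue_n n) f)))"
proof -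
  obtain a A R k0 where A: "A \<ge> 0" and R: "R > 0" "R < real k0" and coeffs: "\<And>j. norm (a j) \<le> A * R ^ j"
    and sums: "\<And>k. k \<ge> k0 \<Longrightarrow> (\<lambda>j. a j / of_nat k ^ j) sums \<Psi> k"
    by (rule analytic_at_infinity_expansion[OF assms], rule that)
  have "\<exists>C. \<forall>n\<ge>k0. uniformly_bounded_multiplier n \<Psi> C"
    by (rule uniform_bound_large_dimension[OF coeffs R A sums])
  then obtain C0 where C0: "\<forall>n\<ge>k0. uniformly_bounded_multiplier n \<Psi> C0" ..
  define c where "c n = (SOME C. uniformly_bounded_multiplier n \<Psi> C)" for n
  have c: "uniformly_bounded_multiplier n \<Psi> (c n)" if "n \<ge> 1" for n
    unfolding c_def by (rule someI_ex[OF bound_fixed_dimension[OF coeffs R(1) A sums that]])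
  define C where "C = \<bar>C0\<bar> + (\<Sum>n<k0. \<bar>c n\<bar>)"
  have bounded: "uniformly_bounded_multiplier n \<Psi> C" if "n \<ge> 1" for n
  proof (cases "n < k0")
    case True
    have "c n \<le> (\<Sum>n<k0. \<bar>c n\<bar>)"
      using True member_le_sum[of n "{..<k0}" "\<lambda>n. \<bar>c n\<bar>"] by simp
    then have "c n \<le> C" by (simp add: C_def)
    with c[OF that] show ?thesis by (rule uniformly_bounded_multiplier_mono)
  next
    case False
    have "uniformly_bounded_multiplier n \<Psi> C0" using C0 False by simp
    moreover have "0 \<le> (\<Sum>n<k0. \<bar>c n\<bar>)" by (intro sum_nonneg) simp
    then have "C0 \<le> C" unfolding C_def by linarith
    ultimately show ?thesis by (rule uniformly_bounded_multiplier_mono)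
  qed
  have "0 \<le> C" by (simp add: C_def sum_nonneg)
  then show ?thesis
    using bounded unfolding uniformly_bounded_multiplier_def by (intro exI[of _ C] conjI allI impI) auto
qed

end
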